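(* Let $\lambda$ be a nonzero integer partition, let $n = h_\lambda(1,1)+1$, and let $c \in \mathfrak{S}_n$ be a Coxeter element. Then the map $\operatorname{RSK}_{\lambda,c}$ is a bijection from the set of fillings of shape $\lambda$ onto the set of reverse plane partitions of shape $\lambda$. (In particular, for every filling $f$ of shape $\lambda$, $\operatorname{RSK}_{\lambda,c}(f)$ is a reverse plane partition.)
   Context: Integer partitions: an integer partition is a weakly decreasing sequence $\lambda=(\lambda_k)_{k\ge 1}$ of nonnegative integers with finitely many nonzero terms. Its Ferrers diagram is $\operatorname{Fer}(\lambda)=\{(i,j)\in(\mathbb{N}^* )^2 : j \le \lambda_i\}$ ($i$ = row index, $j$ = column index). $\unlhd$ denotes the componentwise (product) order on $(\mathbb{N}^* )^2$. A filling of shape $\lambda$ is any map $f:\operatorname{Fer}(\lambda)\to\mathbb{N}$; it is a reverse plane partition if it is weakly increasing with respect to $\unlhd$. The hook length of the box $(1,1)$ is $h_\lambda(1,1)=\#\{(i,j)\in\operatorname{Fer}(\lambda): i=1 \text{ or } j=1\}$. For $m\in\mathbb{Z}$, the $m$-th diagonal is $D_m(\lambda)=\{(i,j)\in\operatorname{Fer}(\lambda): i-j+\lambda_1=m\}$; it is nonempty for $1\le m\le h_\lambda(1,1)$, and $(u_m,v_m)$ denotes its $\unlhd$-maximal element. Greene–Kleitman invariants: for a finite directed acyclic graph $G$ without multiple arrows and a map $f:G_0\to\mathbb{N}$ on its vertices, a path is a sequence of vertices $(v_0,\dots,v_k)$, $k\ge0$, with each $(v_t,v_{t+1})$ an arrow;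 its support is its set of vertices. For $\ell\ge1$ let $\Pi_\ell(G)$ be the set of $\ell$-tuples of paths, the support of a tuple being the union of the supports, and $\mathrm{wt}_f(\underline\gamma)=\sum_{v\in\operatorname{Supp}(\underline\gamma)}f(v)$. Put $M_0=0$, $M_\ell=\max_{\underline\gamma\in\Pi_\ell(G)}\mathrm{wt}_f(\underline\gamma)$, and $\operatorname{GK}_G(f)=(M_\ell-M_{\ell-1})_{\ell\ge1}$ (an integer partition). Interval bipartitions: an interval bipartition is a pair $(\mathbf B,\mathbf E)$ of subsets of $\mathbb{N}^*$ forming a set partition of an interval $\{i,\dots,j\}$; it is elementary if $1\in\mathbf B$ and $\max(\mathbf B\cup\mathbf E)\in\mathbf E$. For $\mathbf B=\{b_1<\dots<b_p\}$, $\mathbf E=\{e_1<\dots<e_q\}$, define $\lambda(\mathbf B,\mathbf E)_i=\#\{e\in\mathbf E: b_i<e\}$ for $i\le p$ and $0$ for $i>p$; thus $(i,j)\in\operatorname{Fer}(\lambda(\mathbf B,\mathbf E))$ iff $b_i<e_{q-j+1}$. For a nonzero $\lambda$ there is a unique elementary interval bipartition $(\mathbf B,\mathbf E)$ with $\lambda(\mathbf B,\mathbf E)=\lambda$; it partitions $\{1,\dots,n\}$ with $n=h_\lambda(1,1)+1$. Coxeter elements and AR quivers: permutations compose right to left; $s_i=(i,i+1)$. A Coxeter element of $\mathfrak{S}_n$ is a product of all of $s_1,\dots,s_{n-1}$, each exactly once, in some order. For a Coxeter element $c$, the Auslander–Reiten quiver $\operatorname{AR}(c)$ is the directed graph whose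 vertices are the transpositions $(i,j)$ with $1\le i<j\le n$, with arrows $(i,j)\to(i,c(j))$ whenever $i<c(j)$, and $(i,j)\to(c(i),j)$ whenever $c(i)<j$. For $1\le m\le n-1$, $\operatorname{AR}_m(c)$ is the full subgraph of $\operatorname{AR}(c)$ on the vertices $(i,j)$ with $i\le m<j$. The map $\operatorname{RSK}_{\lambda,c}$: let $(\mathbf B,\mathbf E)$ (with $\mathbf B=\{b_1<\dots<b_p\}$, $\mathbf E=\{e_1<\dots<e_q\}$) be the elementary interval bipartition with $\lambda(\mathbf B,\mathbf E)=\lambda$. For a filling $f$ of shape $\lambda$, define $\overline f$ on the vertices of $\operatorname{AR}(c)$ by $\overline f(b_i,e_{q-j+1})=f(i,j)$ for $(i,j)\in\operatorname{Fer}(\lambda)$ and $\overline f(x,y)=0$ for all other transpositions. Then $g=\operatorname{RSK}_{\lambda,c}(f)$ is the filling of shape $\lambda$ given, for each $m\in\{1,\dots,n-1\}$ and each $(i,j)\in D_m(\lambda)$, by $g(i,j)=\operatorname{GK}_{\operatorname{AR}_m(c)}(\overline f|_{\operatorname{AR}_m(c)})_{u_m-i+1}$. *)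

theory Defs
  imports Main "HOL-Library.FuncSet" "HOL-Combinatorics.Transposition"
begin

text \<open>A partition is represented by a function lam :: nat => nat, where only the values
at indices k >= 1 matter (the value at 0 is ignored everywhere).\<close>

definition is_partition :: "(nat \<Rightarrow> nat) \<Rightarrow> bool" where
  "is_partition lam \<longleftrightarrow>
     (\<forall>i j. 1 \<le> i \<longrightarrow> i \<le> j \<longrightarrow> lam j \<le> lam i) \<and> finite {k. 1 \<le> k \<and> lam k \<noteq> 0}"

definition nonzero_partition :: "(nat \<Rightarrow> nat) \<Rightarrow> bool" where
  "nonzero_partition lam \<longleftrightarrow> (\<exists>k\<ge>1. lam k \<noteq> 0)"

definition Fer :: "(nat \<Rightarrow> nat) \<Rightarrow> (nat \<times> nat) set" where
  "Fer lam = {(i, j). 1 \<le> i \<and> 1 \<le> j \<and> j \<le> lam i}"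

definition prod_le :: "nat \<times> nat \<Rightarrow> nat \<times> nat \<Rightarrow> bool" where
  "prod_le p q \<longleftrightarrow> fst p \<le> fst q \<and> snd p \<le> snd q"

definition fillings :: "(nat \<Rightarrow> nat) \<Rightarrow> (nat \<times> nat \<Rightarrow> nat) set" where
  "fillings lam = Fer lam \<rightarrow>\<^sub>E (UNIV :: nat set)"

definition rpp :: "(nat \<Rightarrow> nat) \<Rightarrow> (nat \<times> nat \<Rightarrow> nat) set" where
  "rpp lam = {f \<in> fillings lam. \<forall>p\<in>Fer lam. \<forall>q\<in>Fer lam. prod_le p q \<longrightarrow> f p \<le> f q}"

definition hook11 :: "(nat \<Rightarrow> nat) \<Rightarrow> nat" where
  "hook11 lam = card {(i, j) \<in> Fer lam. i = 1 \<or> j = 1}"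

definition diag :: "(nat \<Rightarrow> nat) \<Rightarrow> nat \<Rightarrow> (nat \<times> nat) set" where
  "diag lam m = {(i, j) \<in> Fer lam. int i - int j + int (lam 1) = int m}"

definition diag_max :: "(nat \<Rightarrow> nat) \<Rightarrow> nat \<Rightarrow> nat \<times> nat" where
  "diag_max lam m = (THE p. p \<in> diag lam m \<and> (\<forall>q\<in>diag lam m. prod_le q p))"

definition is_path :: "'a set \<Rightarrow> ('a \<Rightarrow> 'a \<Rightarrow> bool) \<Rightarrow> 'a list \<Rightarrow> bool" where
  "is_path V Ed p \<longleftrightarrow> p \<noteq> [] \<and> set p \<subseteq> V \<and> (\<forall>k. Suc k < length p \<longrightarrow> Ed (p ! k) (p ! Suc k))"

definition GK_M :: "'a set \<Rightarrow> ('a \<Rightarrow> 'a \<Rightarrow> bool) \<Rightarrow> ('a \<Rightarrow> nat) \<Rightarrow> nat \<Rightarrow> nat" where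
  "GK_M V Ed w l = (if l = 0 then 0 else
     Max {sum w (\<Union>p\<in>set ps. set p) | ps. length ps = l \<and> (\<forall>p\<in>set ps. is_path V Ed p)})"

text \<open>GK V Ed w l is the l-th part (l >= 1) of the Greene--Kleitman partition\<close>
definition GK :: "'a set \<Rightarrow> ('a \<Rightarrow> 'a \<Rightarrow> bool) \<Rightarrow> ('a \<Rightarrow> nat) \<Rightarrow> nat \<Rightarrow> nat" where
  "GK V Ed w l = GK_M V Ed w l - GK_M V Ed w (l - 1)"

definition interval_bipartition :: "nat set \<Rightarrow> nat set \<Rightarrow> bool" where
  "interval_bipartition B E \<longleftrightarrow> B \<inter> E = {} \<and> 0 \<notin> B \<union> E \<and> (\<exists>a b. B \<union> E = {a..b})"

definition elementary :: "nat set \<Rightarrow> nat set \<Rightarrow> bool" where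
  "elementary B E \<longleftrightarrow> interval_bipartition B E \<and> 1 \<in> B \<and> Max (B \<union> E) \<in> E"

definition nth_el :: "nat set \<Rightarrow> nat \<Rightarrow> nat" where
  "nth_el S i = sorted_list_of_set S ! (i - 1)"

definition pos_el :: "nat set \<Rightarrow> nat \<Rightarrow> nat" where
  "pos_el S x = card {y \<in> S. y \<le> x}"

definition lamBE :: "nat set \<Rightarrow> nat set \<Rightarrow> nat \<Rightarrow> nat" where
  "lamBE B E i = (if 1 \<le> i \<and> i \<le> card B then card {e \<in> E. nth_el B i < e} else 0)"

definition ebp :: "(nat \<Rightarrow> nat) \<Rightarrow> nat set \<times> nat set" where
  "ebp lam = (THE BE. elementary (fst BE) (snd BE) \<and> (\<forall>i\<ge>1. lamBE (fst BE) (snd BE) i = lam i))"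

definition sref :: "nat \<Rightarrow> nat \<Rightarrow> nat" where
  "sref i = Transposition.transpose i (Suc i)"

definition coxeter :: "nat \<Rightarrow> (nat \<Rightarrow> nat) \<Rightarrow> bool" where
  "coxeter n c \<longleftrightarrow> (\<exists>\<sigma>. distinct \<sigma> \<and> set \<sigma> = {1..<n} \<and> c = foldr (\<lambda>i acc. sref i \<circ> acc) \<sigma> id)"

definition ar_vert :: "nat \<Rightarrow> (nat \<times> nat) set" where
  "ar_vert n = {(i, j). 1 \<le> i \<and> i < j \<and> j \<le> n}"

definition ar_edge :: "(nat \<Rightarrow> nat) \<Rightarrow> nat \<times> nat \<Rightarrow> nat \<times> nat \<Rightarrow> bool" where
  "ar_edge c u v \<longleftrightarrow>
     (fst u < c (snd u) \<and> v = (fst u, c (snd u))) \<or> (c (fst u) < snd u \<and> v = (c (fst u), snd u))"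

definition ar_vert_m :: "nat \<Rightarrow> nat \<Rightarrow> (nat \<times> nat) set" where
  "ar_vert_m n m = {(i, j) \<in> ar_vert n. i \<le> m \<and> m < j}"

definition fbar :: "(nat \<Rightarrow> nat) \<Rightarrow> (nat \<times> nat \<Rightarrow> nat) \<Rightarrow> nat \<times> nat \<Rightarrow> nat" where
  "fbar lam f xy = (let B = fst (ebp lam); E = snd (ebp lam); x = fst xy; y = snd xy;
      i = pos_el B x; j = card E + 1 - pos_el E y in
      if x \<in> B \<and> y \<in> E \<and> (i, j) \<in> Fer lam then f (i, j) else 0)"

definition RSK :: "(nat \<Rightarrow> nat) \<Rightarrow> (nat \<Rightarrow> nat) \<Rightarrow> (nat \<times> nat \<Rightarrow> nat) \<Rightarrow> (nat \<times> nat \<Rightarrow> nat)" where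
  "RSK lam c f = (\<lambda>p \<in> Fer lam.
      let n = hook11 lam + 1; i = fst p; j = snd p; m = i + lam 1 - j; u = fst (diag_max lam m) in
      GK (ar_vert_m n m) (ar_edge c) (fbar lam f) (u + 1 - i))"

end

theory Submission
  imports Defs "Jordan_Normal_Form.Determinant" Complex_Main
begin

text \<open>
  A Coxeter element is an \<open>n\<close>-cycle that runs from \<open>1\<close> increasingly to \<open>n\<close> and then decreasingly back to
  \<open>1\<close>. Hence \<open>AR\<^sub>m(c)\<close> is a rectangular grid with rows \<open>1, \<dots>, m\<close> and columns \<open>m + 1, \<dots>, n\<close>, and passing
  from \<open>m\<close> to \<open>m + 1\<close> adds a row, or removes a column, at one of the two ends of the linear order.

  Remove a corner \<open>(u, v)\<close> from the diagram. Only the diagonal through \<open>(u, v)\<close> changes: the Greene--Kleitman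
  shape \<open>\<mu>\<close> of the \<open>(u - 1) \<times> (v - 1)\<close> rectangle and the entry \<open>w = f (u, v)\<close> are traded for the shape \<open>\<rho>\<close> of the
  \<open>u \<times> v\<close> rectangle, while the shapes \<open>\<nu>1\<close>, \<open>\<nu>2\<close> of the \<open>u \<times> (v - 1)\<close> and \<open>(u - 1) \<times> v\<close> rectangles stay fixed.
  With \<open>M\<^sub>k\<close> denoting partial sums of a shape, the four shapes satisfy one of two tropical octahedron recurrences,
    \<open>M\<^sub>k \<rho> + M\<^sub>k\<^sub>-\<^sub>1 \<mu> = w + max (M\<^sub>k \<nu>1 + M\<^sub>k\<^sub>-\<^sub>1 \<nu>2) (M\<^sub>k\<^sub>-\<^sub>1 \<nu>1 + M\<^sub>k \<nu>2)\<close> or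
    \<open>M\<^sub>k \<rho> + M\<^sub>k \<mu> = max (M\<^sub>k \<nu>1 + M\<^sub>k \<nu>2) (M\<^sub>k\<^sub>+\<^sub>1 \<rho> + M\<^sub>k\<^sub>-\<^sub>1 \<mu>)\<close>,
  according to whether the new row and the new column are added at equal or at opposite ends. Both are invertible
  and respect interlacing, which is the reverse plane partition condition along the diagonal.

  The recurrences are obtained without path surgery: weight a cell of entry \<open>a\<close> by \<open>t ^ a\<close>. The minors of the path
  matrix grow like \<open>t ^ M\<^sub>k\<close>, because multilinearity of the determinant and the maximal weight of a union of \<open>k\<close>
  chains obey the same recursion, cell by cell, and all terms are positive. The three-term Pluecker relation between
  these minors then tropicalises to the recurrences.
\<close>

section \<open>Maximal weight of a union of cliques\<close>

text \<open>The obstacle is positivity. A growth rate determines an exponent only if nothing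
  cancels, but a minor of the path matrix can vanish identically, for instance when there are too
  few rows for the paths to spread out. Enough rows of weight zero put in front of the grid make the
  minors in question positive and leave all maximal weights unchanged; this is why both recurrences
  are first proved on padded grids.

  Advancing by single cells produces determinants whose rows come from two successive stages. On the
  side of chains this forces a separate region for every chain; \<open>k\<close> chains in one
  rectangle correspond to the special case of consecutive end columns. Likewise, the vanishing of a
  determinant with two equal rows has to be matched by an exchange of cells between two chains.

  The Coxeter element enters through integer keys of rows and columns that are independent of
  \<open>m\<close>. Their signs let a new row or column come first or last without renumbering the
  earlier ones.\<close>

definition clique :: "('a \<Rightarrow> 'a \<Rightarrow> bool) \<Rightarrow> 'a set \<Rightarrow> bool" where
  "clique Q K \<longleftrightarrow> (\<forall>x\<in>K. \<forall>y\<in>K. Q x y)"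

text \<open>The cliques may overlap and may be empty, so \<open>k\<close> is only an upper bound on
  their number, and weights are later summed over the union without multiplicity.\<close>

definition covered :: "('a \<Rightarrow> 'a \<Rightarrow> bool) \<Rightarrow> (nat \<Rightarrow> 'a set) \<Rightarrow> nat \<Rightarrow> 'a set \<Rightarrow> bool" where
  "covered Q Rg k U \<longleftrightarrow> (\<exists>K. (\<forall>t<k. clique Q (K t) \<and> K t \<subseteq> Rg t) \<and> U = (\<Union>t<k. K t))"

definition cover_max :: "('a \<Rightarrow> 'a \<Rightarrow> bool) \<Rightarrow> (nat \<Rightarrow> 'a set) \<Rightarrow> ('a \<Rightarrow> nat) \<Rightarrow> nat \<Rightarrow> nat" where
  "cover_max Q Rg w k = Max (sum w ` {U. covered Q Rg k U})"

lemma clique_subset: "clique Q K \<Longrightarrow> L \<subseteq> K \<Longrightarrow> clique Q L"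
  unfolding clique_def by blast

lemma clique_Un:
  assumes "clique Q K" "clique Q L" "\<And>x y. x \<in> K \<Longrightarrow> y \<in> L \<Longrightarrow> Q x y \<and> Q y x"
  shows "clique Q (K \<union> L)"
  using assms unfolding clique_def by blast

lemma clique_empty [simp]: "clique Q {}"
  by (simp add: clique_def)

lemma coveredI: "(\<And>t. t < k \<Longrightarrow> clique Q (K t)) \<Longrightarrow> (\<And>t. t < k \<Longrightarrow> K t \<subseteq> Rg t) \<Longrightarrow> covered Q Rg k (\<Union>t<k. K t)"
  unfolding covered_def by blast

lemma coveredE:
  assumes "covered Q Rg k U"
  obtains K where "\<And>t. t < k \<Longrightarrow> clique Q (K t) \<and> K t \<subseteq> Rg t" "U = (\<Union>t<k. K t)"
  using assms unfolding covered_def by auto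

lemma covered_empty: "covered Q Rg k {}"
  unfolding covered_def by (rule exI[of _ "\<lambda>_. {}"]) auto

lemma covered_subset: "covered Q Rg k U \<Longrightarrow> U \<subseteq> (\<Union>t<k. Rg t)"
  unfolding covered_def by blast

lemma covered_mono:
  "covered Q Rg k U \<Longrightarrow> (\<And>t. t < k \<Longrightarrow> Rg t \<subseteq> Rg' t) \<Longrightarrow> covered Q Rg' k U"
proof -
  assume cov: "covered Q Rg k U" and sub: "\<And>t. t < k \<Longrightarrow> Rg t \<subseteq> Rg' t"
  from cov obtain K where K: "\<And>t. t < k \<Longrightarrow> clique Q (K t) \<and> K t \<subseteq> Rg t" "U = (\<Union>t<k. K t)"
    by (elim coveredE) (rule that; simp)
  show ?thesis unfolding K(2)
  proof (rule coveredI)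
    fix t assume "t < k"
    then show "clique Q (K t)" "K t \<subseteq> Rg' t" using K(1)[of t] sub[of t] by auto
  qed
qed

lemma covered_Suc:
  "covered Q Rg (Suc k) U \<longleftrightarrow> (\<exists>V K. covered Q Rg k V \<and> clique Q K \<and> K \<subseteq> Rg k \<and> U = V \<union> K)"
proof
  assume "covered Q Rg (Suc k) U"
  then obtain K where K: "\<And>t. t < Suc k \<Longrightarrow> clique Q (K t) \<and> K t \<subseteq> Rg t" "U = (\<Union>t<Suc k. K t)"
    by (elim coveredE) (rule that; simp)
  have "U = (\<Union>t<k. K t) \<union> K k" using K(2) by (auto simp: less_Suc_eq)
  moreover have "covered Q Rg k (\<Union>t<k. K t)" by (intro coveredI) (use K(1) in auto)
  ultimately show "\<exists>V K. covered Q Rg k V \<and> clique Q K \<and> K \<subseteq> Rg k \<and> U = V \<union> K"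
    using K(1) by blast
next
  assume "\<exists>V K. covered Q Rg k V \<and> clique Q K \<and> K \<subseteq> Rg k \<and> U = V \<union> K"
  then obtain V K where V: "covered Q Rg k V" and K': "clique Q K" "K \<subseteq> Rg k" "U = V \<union> K" by blast
  from V obtain L where L: "\<And>t. t < k \<Longrightarrow> clique Q (L t) \<and> L t \<subseteq> Rg t" "V = (\<Union>t<k. L t)"
    by (elim coveredE) (rule that; simp)
    have "covered Q Rg (Suc k) (\<Union>t<Suc k. (L(k := K)) t)"
    by (intro coveredI) (use L(1) K' in \<open>auto simp: less_Suc_eq\<close>)
  moreover have "(\<Union>t<Suc k. (L(k := K)) t) = U" unfolding K'(3) L(2) by (auto simp: less_Suc_eq)
  ultimately show "covered Q Rg (Suc k) U" by simp
qed

lemma finite_covered: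
  assumes "\<And>t. t < k \<Longrightarrow> finite (Rg t)"
  shows "finite {U. covered Q Rg k U}"
proof (rule finite_subset)
  show "{U. covered Q Rg k U} \<subseteq> Pow (\<Union>t<k. Rg t)" by (auto dest: covered_subset)
  show "finite (Pow (\<Union>t<k. Rg t))" using assms by auto
qed

lemma cover_max_ge:
  assumes "\<And>t. t < k \<Longrightarrow> finite (Rg t)" "covered Q Rg k U"
  shows "sum w U \<le> cover_max Q Rg w k"
  unfolding cover_max_def using assms finite_covered[of k Rg Q] by (intro Max_ge) auto

lemma cover_max_le:
  assumes "\<And>t. t < k \<Longrightarrow> finite (Rg t)" "\<And>U. covered Q Rg k U \<Longrightarrow> sum w U \<le> x"
  shows "cover_max Q Rg w k \<le> x"
  unfolding cover_max_def using assms finite_covered[of k Rg Q] covered_empty[of Q Rg k]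
  by (subst Max_le_iff) auto

lemma cover_max_mono:
  assumes "\<And>t. t < k \<Longrightarrow> finite (Rg t)" "\<And>t. t < k' \<Longrightarrow> finite (Rg' t)"
    and "\<And>U. covered Q Rg k U \<Longrightarrow> \<exists>U'. covered Q' Rg' k' U' \<and> sum w U \<le> sum w' U'"
  shows "cover_max Q Rg w k \<le> cover_max Q' Rg' w' k'"
proof (rule cover_max_le[OF assms(1)])
  fix U assume "covered Q Rg k U"
  then obtain U' where "covered Q' Rg' k' U'" "sum w U \<le> sum w' U'" using assms(3) by blast
  then show "sum w U \<le> cover_max Q' Rg' w' k'"
    using cover_max_ge[of k' Rg' Q' U' w'] assms(2) by fastforce
qed auto

lemma cover_max_region_mono:
  assumes "\<And>t. t < k \<Longrightarrow> finite (Rg' t)" "\<And>t. t < k \<Longrightarrow> Rg t \<subseteq> Rg' t"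
  shows "cover_max Q Rg w k \<le> cover_max Q Rg' w k"
proof (rule cover_max_mono)
  fix U assume "covered Q Rg k U"
  then have "covered Q Rg' k U" using assms(2) by (rule covered_mono)
  then show "\<exists>U'. covered Q Rg' k U' \<and> sum w U \<le> sum w U'" by blast
qed (use assms in \<open>auto intro: finite_subset\<close>)

lemma cover_max_cong:
  assumes "\<And>t. t < k \<Longrightarrow> Rg t = Rg' t"
  shows "cover_max Q Rg w k = cover_max Q Rg' w k"
proof -
  have "covered Q Rg k U = covered Q Rg' k U" for U
    unfolding covered_def using assms by (metis (no_types, lifting))
  then show ?thesis by (simp add: cover_max_def)
qed

lemma cover_max_0 [simp]: "cover_max Q Rg w 0 = 0"
proof -
  have "{U. covered Q Rg 0 U} = {{}}" by (auto simp: covered_def)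
  then show ?thesis by (simp add: cover_max_def)
qed

section \<open>Chains in rectangles of a grid\<close>

definition comparable :: "nat \<times> nat \<Rightarrow> nat \<times> nat \<Rightarrow> bool" where
  "comparable x y \<longleftrightarrow> (fst x \<le> fst y \<and> snd x \<le> snd y) \<or> (fst y \<le> fst x \<and> snd y \<le> snd x)"

definition rect :: "nat \<Rightarrow> nat \<Rightarrow> nat \<Rightarrow> (nat \<times> nat) set" where
  "rect d p c = {..<p} \<times> {d..<c}"

lemma finite_rect [simp]: "finite (rect d p c)"
  by (simp add: rect_def)

lemma rect_mono: "p \<le> p' \<Longrightarrow> c \<le> c' \<Longrightarrow> rect d p c \<subseteq> rect d p' c'"
  by (auto simp: rect_def)

text \<open>The member of the family containing the least cell of the outermost line can absorb that whole line.\<close>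

lemma absorb_line:
  fixes f g :: "nat \<times> nat \<Rightarrow> nat"
  assumes cmp: "\<And>x y. comparable x y \<longleftrightarrow> (f x \<le> f y \<and> g x \<le> g y) \<or> (f y \<le> f x \<and> g y \<le> g x)"
    and I: "I \<noteq> {}" and fin: "finite (\<Union>t\<in>I. K t)"
    and K: "\<And>t. t \<in> I \<Longrightarrow> clique comparable (K t)" and top: "\<And>t x. t \<in> I \<Longrightarrow> x \<in> K t \<Longrightarrow> f x \<le> m"
  shows "\<exists>a\<in>I. clique comparable (K a \<union> {x \<in> (\<Union>t\<in>I. K t). f x = m})"
proof (cases "{x \<in> (\<Union>t\<in>I. K t). f x = m} = {}")
  case True
  obtain a where "a \<in> I" using I by blast
  then show ?thesis using K[of a] by (intro bexI[of _ a]) (simp_all only: True Un_empty_right)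
next
  case False
  let ?Z = "{x \<in> (\<Union>t\<in>I. K t). f x = m}"
  have "finite ?Z" using fin by (rule rev_finite_subset) auto
  then have "finite (g ` ?Z)" "g ` ?Z \<noteq> {}" using False by auto
  then have "Min (g ` ?Z) \<in> g ` ?Z" and min: "\<And>x. x \<in> ?Z \<Longrightarrow> Min (g ` ?Z) \<le> g x"
    by (rule Min_in, blast intro: Min_le)
  then obtain z where z: "z \<in> ?Z" "\<And>x. x \<in> ?Z \<Longrightarrow> g z \<le> g x"
    by (elim imageE) (rule that; simp)
  then obtain a where a: "a \<in> I" "z \<in> K a" by blast
  have below: "f x \<le> f y \<and> g x \<le> g y" if x: "x \<in> K a" "f x \<noteq> m" and y: "y \<in> ?Z" for x y
  proof -
    have "comparable x z" using K[OF a(1)] a(2) x(1) by (auto simp: clique_def)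
    moreover have "f x < m" using top[OF a(1) x(1)] x(2) by simp
    ultimately have "g x \<le> g z" using z(1) by (auto simp: cmp)
    then show ?thesis using z(2)[OF y] y \<open>f x < m\<close> by auto
  qed
  have ZZ: "comparable x y" if "x \<in> ?Z" "y \<in> ?Z" for x y
    using that by (auto simp: cmp)
  have KZ: "comparable x y \<and> comparable y x" if "x \<in> K a" "y \<in> ?Z" for x y
  proof (cases "f x = m")
    case True
    then have "x \<in> ?Z" using that(1) a(1) by auto
    then show ?thesis using ZZ that(2) by blast
  next
    case False
    then show ?thesis using below[OF that(1) False that(2)] cmp by blast
  qed
  have "clique comparable (K a \<union> ?Z)"
    using K[OF a(1)] ZZ KZ by (intro clique_Un) (simp_all only: clique_def, blast+)
  then show ?thesis using a(1) by blast
qed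

text \<open>In a rectangle, a cell of the last row and a cell of the last column are incomparable
  unless one of them is the corner, so a chain without its corner misses one of the two lines.
  Conversely the corner, being the greatest cell, extends every chain. No other region contains it,
  hence its weight is gained exactly once.\<close>

lemma cover_max_corner:
  assumes t0: "t0 < k" and Rg: "Rg t0 = rect d (Suc p) (Suc j)" and dj: "d \<le> j"
    and fin: "\<And>t. t < k \<Longrightarrow> finite (Rg t)"
    and other: "\<And>t. t < k \<Longrightarrow> t \<noteq> t0 \<Longrightarrow> (p, j) \<notin> Rg t"
  shows "cover_max comparable Rg w k = w (p, j)
    + max (cover_max comparable (Rg(t0 := rect d p (Suc j))) w k)
          (cover_max comparable (Rg(t0 := rect d (Suc p) j)) w k)" (is "_ = _ + max ?A ?B")
proof (rule antisym)
  have finA: "finite ((Rg(t0 := rect d p' j')) t)" if "t < k" for p' j' t using fin that by auto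
  show "cover_max comparable Rg w k \<le> w (p, j) + max ?A ?B"
  proof (rule cover_max_le[OF fin])
    fix U assume "covered comparable Rg k U"
    then obtain K where K: "\<And>t. t < k \<Longrightarrow> clique comparable (K t) \<and> K t \<subseteq> Rg t" "U = (\<Union>t<k. K t)"
      by (elim coveredE) (rule that; simp)
    let ?K = "K(t0 := K t0 - {(p, j)})"
    have sub: "K t0 - {(p, j)} \<subseteq> rect d p (Suc j) \<or> K t0 - {(p, j)} \<subseteq> rect d (Suc p) j"
    proof (rule ccontr)
      assume "\<not> ?thesis"
      then obtain x y where x: "x \<in> K t0" "x \<noteq> (p, j)" "x \<notin> rect d p (Suc j)"
        and y: "y \<in> K t0" "y \<noteq> (p, j)" "y \<notin> rect d (Suc p) j" by blast
      have "x \<in> rect d (Suc p) (Suc j)" "y \<in> rect d (Suc p) (Suc j)" using K(1)[OF t0] x(1) y(1) Rg by auto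
      then have "fst x = p" "snd x < j" "snd y = j" "fst y < p"
        using x(2,3) y(2,3) by (cases x; cases y; auto simp: rect_def)+
      moreover have "comparable x y" using K(1)[OF t0] x(1) y(1) by (auto simp: clique_def)
      ultimately show False by (auto simp: comparable_def)
    qed
    have cov: "covered comparable (Rg(t0 := R)) k (\<Union>t<k. ?K t)" if "K t0 - {(p, j)} \<subseteq> R" for R
      by (rule coveredI) (use K(1) that in \<open>auto intro: clique_subset\<close>)
    have "sum w (\<Union>t<k. ?K t) \<le> max ?A ?B"
      using sub
    proof
      assume "K t0 - {(p, j)} \<subseteq> rect d p (Suc j)"
      from cover_max_ge[OF finA cov[OF this], of w] show ?thesis by simp
    next
      assume "K t0 - {(p, j)} \<subseteq> rect d (Suc p) j"
      from cover_max_ge[OF finA cov[OF this], of w] show ?thesis by simp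
    qed
    moreover have "sum w U \<le> w (p, j) + sum w (\<Union>t<k. ?K t)"
    proof -
      have finK: "finite (\<Union>t<k. ?K t)" using K(1) fin by (auto intro: finite_subset)
      have "U \<subseteq> insert (p, j) (\<Union>t<k. ?K t)" unfolding K(2) by auto
      then have "sum w U \<le> sum w (insert (p, j) (\<Union>t<k. ?K t))" using finK by (intro sum_mono2) auto
      also have "\<dots> \<le> w (p, j) + sum w (\<Union>t<k. ?K t)" using finK by (simp add: sum.insert_if)
      finally show ?thesis .
    qed
    ultimately show "sum w U \<le> w (p, j) + max ?A ?B" by simp
  qed auto
  have ge: "w (p, j) + cover_max comparable (Rg(t0 := R)) w k \<le> cover_max comparable Rg w k"
    if R: "R \<subseteq> rect d (Suc p) (Suc j)" "(p, j) \<notin> R" for R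
  proof -
    have finR: "finite ((Rg(t0 := R)) t)" if "t < k" for t
      using fin that R finite_subset[OF R(1)] by auto
    \<comment> \<open>Subtraction of naturals may truncate; that the corner alone already attains
      its weight is shown below to undo it.\<close>
    have "cover_max comparable (Rg(t0 := R)) w k \<le> cover_max comparable Rg w k - w (p, j)"
    proof (rule cover_max_le[OF finR])
      fix U assume "covered comparable (Rg(t0 := R)) k U"
      then obtain K where K: "\<And>t. t < k \<Longrightarrow> clique comparable (K t) \<and> K t \<subseteq> (Rg(t0 := R)) t" "U = (\<Union>t<k. K t)"
        by (elim coveredE) (rule that; simp)
      let ?K = "K(t0 := insert (p, j) (K t0))"
      have K0: "K t0 \<subseteq> R" "clique comparable (K t0)" using K(1)[OF t0] by auto
      have le: "fst x \<le> p \<and> snd x \<le> j" if "x \<in> K t0" for x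
        using that K0 R(1) by (auto simp: rect_def)
      have "clique comparable (insert (p, j) (K t0))"
        using K0(2) le by (auto simp: clique_def comparable_def)
      moreover have "insert (p, j) (K t0) \<subseteq> Rg t0" using K0(1) R(1) Rg dj by (auto simp: rect_def)
      ultimately have "clique comparable (?K t) \<and> ?K t \<subseteq> Rg t" if "t < k" for t
        using K(1)[OF that] by (cases "t = t0") simp_all
      then have "covered comparable Rg k (\<Union>t<k. ?K t)" by (intro coveredI) blast+
      moreover have "(\<Union>t<k. ?K t) = insert (p, j) U" using K(2) t0 by (auto split: if_splits)
      ultimately have cov: "covered comparable Rg k (insert (p, j) U)" by simp
      have "sum w (insert (p, j) U) \<le> cover_max comparable Rg w k"
        using fin cov by (rule cover_max_ge)
      moreover have "(p, j) \<notin> U"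
      proof
        assume "(p, j) \<in> U"
        then obtain t where t: "t < k" "(p, j) \<in> K t" using K(2) by auto
        then show False using K(1)[OF t(1)] other[OF t(1)] R(2) by (auto split: if_splits)
      qed
      moreover have "finite U" unfolding K(2) using K(1) finR by (meson finite_UN_I finite_lessThan finite_subset lessThan_iff)
      ultimately show "sum w U \<le> cover_max comparable Rg w k - w (p, j)" by simp
    qed auto
    moreover have "w (p, j) \<le> cover_max comparable Rg w k"
    proof -
      have "covered comparable Rg k (\<Union>t<k. (\<lambda>t. if t = t0 then {(p, j)} else {}) t)"
        by (rule coveredI) (use Rg dj in \<open>auto simp: clique_def comparable_def rect_def\<close>)
      moreover have "(\<Union>t<k. (\<lambda>t. if t = t0 then {(p, j)} else {}) t) = {(p, j)}" using t0 by auto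
      ultimately show ?thesis using cover_max_ge[of k Rg comparable "{(p, j)}" w] fin by simp
    qed
    ultimately show ?thesis by simp
  qed
  have "w (p, j) + ?A \<le> cover_max comparable Rg w k" "w (p, j) + ?B \<le> cover_max comparable Rg w k"
    by (rule ge; auto simp: rect_def)+
  then show "w (p, j) + max ?A ?B \<le> cover_max comparable Rg w k" by (simp add: max_def)
qed

text \<open>When two chains share a rectangle, one of them can take over all their cells in row
  \<open>p\<close>, and the other then avoids that row. This is the counterpart of the vanishing of
  a determinant with two equal rows.\<close>

lemma cover_max_exchange:
  assumes t: "t0 < k" "t1 < k" "t0 \<noteq> t1" and Rg: "Rg t1 = rect d (Suc p) j"
    and fin: "\<And>t. t < k \<Longrightarrow> finite (Rg t)"
  shows "cover_max comparable (Rg(t0 := rect d (Suc p) j)) w k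
       \<le> cover_max comparable (Rg(t0 := rect d p (Suc j))) w k"
proof (rule cover_max_mono)
  fix U assume "covered comparable (Rg(t0 := rect d (Suc p) j)) k U"
  then obtain K where K: "\<And>t. t < k \<Longrightarrow> clique comparable (K t) \<and> K t \<subseteq> (Rg(t0 := rect d (Suc p) j)) t"
    "U = (\<Union>t<k. K t)" by (elim coveredE) (rule that; simp)
  have K01: "K t \<subseteq> rect d (Suc p) j" "clique comparable (K t)" if "t \<in> {t0, t1}" for t
    using K(1)[of t] that t Rg by auto
  let ?Z = "{x \<in> (\<Union>t\<in>{t0, t1}. K t). fst x = p}"
  have "\<exists>a\<in>{t0, t1}. clique comparable (K a \<union> ?Z)"
  proof (rule absorb_line[where g = snd])
    show "finite (\<Union>t\<in>{t0, t1}. K t)"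
      using finite_subset[OF K01(1) finite_rect] by simp
    show "fst x \<le> p" if "t \<in> {t0, t1}" "x \<in> K t" for t x
      using K01(1)[OF that(1)] that(2) by (auto simp: rect_def)
  qed (use K01 in \<open>auto simp: comparable_def\<close>)
  then obtain a where a: "a \<in> {t0, t1}" "clique comparable (K a \<union> ?Z)" by blast
  then obtain b where b: "{a, b} = {t0, t1}" "a \<noteq> b" using t by blast
  let ?K = "K(t1 := K a \<union> ?Z, t0 := K b - ?Z)"
  have b': "b \<in> {t0, t1}" using b by blast
  have "K b - ?Z \<subseteq> rect d p (Suc j)"
  proof
    fix x assume x: "x \<in> K b - ?Z"
    then have "fst x \<noteq> p" using b' by blast
    then show "x \<in> rect d p (Suc j)" using x K01(1)[OF b'] by (auto simp: rect_def)
  qed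
  moreover have "K a \<union> ?Z \<subseteq> rect d (Suc p) j" using K01(1) a(1) by auto
  moreover have "clique comparable (K b - ?Z)" using K01(2)[OF b'] by (rule clique_subset) auto
  ultimately have "clique comparable (?K i) \<and> ?K i \<subseteq> (Rg(t0 := rect d p (Suc j))) i" if "i < k" for i
    using K(1)[OF that] a(2) t Rg by (cases "i = t0"; cases "i = t1") simp_all
  then have cov: "covered comparable (Rg(t0 := rect d p (Suc j))) k (\<Union>t<k. ?K t)"
    by (intro coveredI) blast+
  have "K t0 \<union> K t1 = K a \<union> K b" using b(1) by (metis doubleton_eq_iff Un_commute)
  then have "(K a \<union> ?Z) \<union> (K b - ?Z) = K t0 \<union> K t1" using a(1) b' by auto
  moreover have "(\<Union>t<k. ?K t) = (\<Union>t\<in>{..<k} - {t0, t1}. K t) \<union> ((K a \<union> ?Z) \<union> (K b - ?Z))"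
    using t by (auto split: if_splits)
  moreover have "U = (\<Union>t\<in>{..<k} - {t0, t1}. K t) \<union> (K t0 \<union> K t1)" unfolding K(2) using t by auto
  ultimately have "(\<Union>t<k. ?K t) = U" by simp
  then show "\<exists>U'. covered comparable (Rg(t0 := rect d p (Suc j))) k U' \<and> sum w U \<le> sum w U'"
    using cov by (metis order_refl)
qed (use fin in auto)

text \<open>One chain can absorb all covered cells of the last column; the others then live in a
  rectangle with one column less, to which induction applies. This later turns paths ending in
  consecutive columns into chains of an unrestricted rectangle.\<close>

lemma covered_staircase:
  assumes "covered comparable (\<lambda>_. rect d p q) k U" "k \<le> q"
  shows "covered comparable (\<lambda>t. rect d p (Suc (q - k + t))) k U"
  using assms
proof (induction k arbitrary: q U)
  case 0
  then show ?case by (simp add: covered_def)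
next
  case (Suc k)
  then obtain K where K: "\<And>t. t < Suc k \<Longrightarrow> clique comparable (K t) \<and> K t \<subseteq> rect d p q" "U = (\<Union>t<Suc k. K t)"
    by (elim coveredE) (rule that; simp)
  let ?Z = "{x \<in> (\<Union>t\<in>{..<Suc k}. K t). snd x = q - 1}"
  have "\<exists>a\<in>{..<Suc k}. clique comparable (K a \<union> ?Z)"
  proof (rule absorb_line[where g = fst])
    show "finite (\<Union>t\<in>{..<Suc k}. K t)"
      using K(1) by (intro finite_UN_I) (simp, blast intro: finite_subset[OF _ finite_rect])
    show "snd x \<le> q - 1" if "t \<in> {..<Suc k}" "x \<in> K t" for t x
      using K(1)[of t] that by (force simp: rect_def)
  qed (use K in \<open>auto simp: comparable_def\<close>)
  then obtain a where a: "a < Suc k" "clique comparable (K a \<union> ?Z)" by blast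
  \<comment> \<open>The absorbing chain takes the last index \<open>k\<close>, whose region is the
    full rectangle; chain \<open>k\<close> moves to the vacated index \<open>a\<close>.\<close>
  define L where "L t = (if t = a then K k else K t) - ?Z" for t
  have L: "clique comparable (L t) \<and> L t \<subseteq> rect d p (q - 1)" if "t < k" for t
  proof -
    define t' where "t' = (if t = a then k else t)"
    have t': "t' < Suc k" "L t = K t' - ?Z" using that by (auto simp: t'_def L_def)
    have "L t \<subseteq> rect d p (q - 1)"
    proof
      fix x assume x: "x \<in> L t"
      then have "x \<in> rect d p q" "snd x \<noteq> q - 1" using t' K(1)[OF t'(1)] by auto
      then show "x \<in> rect d p (q - 1)" by (auto simp: rect_def)
    qed
    then show ?thesis using K(1)[OF t'(1)] t'(2) by (auto intro: clique_subset)
  qed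
  have "covered comparable (\<lambda>_. rect d p (q - 1)) k (\<Union>t<k. L t)" using L by (intro coveredI) auto
  from Suc.IH[OF this] have "covered comparable (\<lambda>t. rect d p (Suc (q - 1 - k + t))) k (\<Union>t<k. L t)"
    using Suc.prems by simp
  moreover have "q - 1 - k = q - Suc k" by simp
  moreover have "K a \<union> ?Z \<subseteq> rect d p (Suc (q - Suc k + k))"
    using K(1) a(1) Suc.prems by auto
  moreover have "U = (\<Union>t<k. L t) \<union> (K a \<union> ?Z)"
  proof -
    have "U = (\<Union>t<k. if t = a then K k else K t) \<union> K a"
      unfolding K(2) using a(1) by (auto simp: less_Suc_eq split: if_splits)
    moreover have "?Z \<subseteq> U" using K(2) by auto
    ultimately show ?thesis unfolding L_def by blast
  qed
  ultimately show ?case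
    unfolding covered_Suc using a(2)
    by (intro exI[of _ "\<Union>t<k. L t"] exI[of _ "K a \<union> ?Z"] conjI) (simp_all only:)
qed

lemma cover_max_staircase:
  assumes "k \<le> q"
  shows "cover_max comparable (\<lambda>t. rect d p (Suc (q - k + t))) w k = cover_max comparable (\<lambda>_. rect d p q) w k"
proof (rule antisym)
  show "cover_max comparable (\<lambda>t. rect d p (Suc (q - k + t))) w k \<le> cover_max comparable (\<lambda>_. rect d p q) w k"
    using assms by (intro cover_max_region_mono rect_mono) auto
  show "cover_max comparable (\<lambda>_. rect d p q) w k \<le> cover_max comparable (\<lambda>t. rect d p (Suc (q - k + t))) w k"
    using covered_staircase[OF _ assms] by (intro cover_max_mono) auto
qed

section \<open>Minors and the three-term Pluecker relation\<close>

definition vmat :: "nat \<Rightarrow> nat \<Rightarrow> (nat \<Rightarrow> nat \<Rightarrow> real) \<Rightarrow> real mat" where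
  "vmat d k v = mat k k (\<lambda>(i, l). v i (d + l))"

definition minor :: "nat \<Rightarrow> nat \<Rightarrow> (nat \<Rightarrow> nat \<Rightarrow> real) \<Rightarrow> real" where
  "minor d k v = det (vmat d k v)"

lemma vmat_carrier [simp]: "vmat d k v \<in> carrier_mat k k"
  by (simp add: vmat_def)

lemma vmat_dim [simp]: "dim_row (vmat d k v) = k" "dim_col (vmat d k v) = k"
  by (simp_all add: vmat_def)

lemma vmat_index [simp]: "i < k \<Longrightarrow> l < k \<Longrightarrow> vmat d k v $$ (i, l) = v i (d + l)"
  by (simp add: vmat_def)

lemma minor_cong:
  assumes "\<And>i l. i < k \<Longrightarrow> l < k \<Longrightarrow> v i (d + l) = v' i (d + l)"
  shows "minor d k v = minor d k v'"
proof -
  have "vmat d k v = vmat d k v'" using assms by (intro eq_matI) auto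
  then show ?thesis by (simp add: minor_def)
qed

lemma minor_0 [simp]: "minor d 0 v = 1"
  by (simp add: minor_def)

text \<open>The coefficients are the cofactors along row \<open>t\<close>, which do not see that
  row; their existence suffices for every use of linearity below.\<close>

lemma minor_expand:
  assumes "t < k"
  shows "\<exists>c. \<forall>y. minor d k (v(t := y)) = (\<Sum>l<k. y (d + l) * c l)"
proof -
  have "minor d k (v(t := y)) = (\<Sum>l<k. y (d + l) * cofactor (vmat d k v) t l)" for y
  proof -
    have "mat_delete (vmat d k (v(t := y))) t l = mat_delete (vmat d k v) t l" if "l < k" for l
      using assms that by (intro eq_matI) (auto simp: mat_delete_def)
    then have "cofactor (vmat d k (v(t := y))) t l = cofactor (vmat d k v) t l" if "l < k" for l
      using that by (simp add: cofactor_def)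
    then show ?thesis
      unfolding minor_def by (subst laplace_expansion_row[OF vmat_carrier assms]) (simp add: assms)
  qed
  then show ?thesis by blast
qed

text \<open>The combination \<open>x * (y l + z l)\<close> has the form of one step of the recursion
  for \<open>pvec\<close>.\<close>

lemma minor_linear:
  assumes "t < k"
  shows "minor d k (v(t := (\<lambda>l. x * (y l + z l)))) = x * (minor d k (v(t := y)) + minor d k (v(t := z)))"
proof -
  obtain c where "\<And>y. minor d k (v(t := y)) = (\<Sum>l<k. y (d + l) * c l)"
    using minor_expand[OF assms] by blast
  then show ?thesis
    by (simp add: sum_distrib_left sum.distrib algebra_simps)
qed

lemma minor_zero_row:
  assumes "t < k" "\<And>l. l < k \<Longrightarrow> v t (d + l) = 0"
  shows "minor d k v = 0"
proof -
  obtain c where c: "\<And>y. minor d k (v(t := y)) = (\<Sum>l<k. y (d + l) * c l)"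
    using minor_expand[OF assms(1)] by blast
  show ?thesis using c[of "v t"] assms by simp
qed

lemma minor_eq_rows:
  assumes "i < k" "j < k" "i \<noteq> j" "v i = v j"
  shows "minor d k v = 0"
  unfolding minor_def
  by (rule det_identical_rows[OF vmat_carrier assms(3,1,2)]) (use assms in \<open>auto intro!: eq_vecI\<close>)

lemma minor_swap:
  assumes "i < k" "j < k" "i \<noteq> j"
  shows "minor d k (v(i := v j, j := v i)) = - minor d k v"
proof -
  have "vmat d k (v(i := v j, j := v i)) = swaprows i j (vmat d k v)"
    using assms by (intro eq_matI) auto
  then show ?thesis using det_swaprows[OF assms vmat_carrier] by (simp add: minor_def)
qed

lemma minor_rotate:
  "minor d (Suc k) (\<lambda>i. if i = k then u else v i)
     = (-1) ^ k * minor d (Suc k) (\<lambda>i. if i = 0 then u else v (i - 1))"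
proof -
  let ?A = "vmat d (Suc k) (\<lambda>i. if i = k then u else v i)"
  have "swap_row_to_front ?A k = vmat d (Suc k) (\<lambda>i. if i = 0 then u else v (i - 1))"
    by (subst swap_row_to_front_result[OF vmat_carrier], simp) (intro eq_matI, auto)
  then show ?thesis
    using swap_row_to_front_det[OF vmat_carrier, of k "Suc k" d "\<lambda>i. if i = k then u else v i"]
    by (simp add: minor_def flip: mult.assoc power_add)
qed

section \<open>Unit rows, brackets and the three-term relation\<close>

definition unitv :: "nat \<Rightarrow> nat \<Rightarrow> real" where
  "unitv m l = (if l = m then 1 else 0)"

text \<open>Read from right to left, a unit row enlarges a minor without changing it. Minors of
  different orders thus become brackets of one order, as the three-term relation requires.\<close>

lemma minor_unit_last:
  assumes "v k = unitv (d + k)"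
  shows "minor d (Suc k) v = minor d k v"
proof -
  have eq: "mat_delete (vmat d (Suc k) v) k k = vmat d k v"
    by (intro eq_matI) (auto simp: mat_delete_def)
  have "minor d (Suc k) v = (\<Sum>l<Suc k. v k (d + l) * cofactor (vmat d (Suc k) v) k l)"
    unfolding minor_def by (subst laplace_expansion_row[OF vmat_carrier, of k]) auto
  also have "\<dots> = (\<Sum>l<Suc k. if l = k then cofactor (vmat d (Suc k) v) k k else 0)"
    by (intro sum.cong) (auto simp: assms unitv_def)
  also have "\<dots> = minor d k v" using eq by (simp add: cofactor_def minor_def)
  finally show ?thesis .
qed

text \<open>Together with the row, the first column disappears and the offset rises to
  \<open>Suc d\<close>; this produces the minors of a grid without its first column.\<close>

lemma minor_unit_first:
  assumes "v 0 = unitv d"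
  shows "minor d (Suc k) v = minor (Suc d) k (\<lambda>i. v (Suc i))"
proof -
  have eq: "mat_delete (vmat d (Suc k) v) 0 0 = vmat (Suc d) k (\<lambda>i. v (Suc i))"
    by (intro eq_matI) (auto simp: mat_delete_def)
  have "minor d (Suc k) v = (\<Sum>l<Suc k. v 0 (d + l) * cofactor (vmat d (Suc k) v) 0 l)"
    unfolding minor_def by (subst laplace_expansion_row[OF vmat_carrier, of 0]) auto
  also have "\<dots> = (\<Sum>l<Suc k. if l = 0 then cofactor (vmat d (Suc k) v) 0 0 else 0)"
    by (intro sum.cong) (auto simp: assms unitv_def)
  also have "\<dots> = minor (Suc d) k (\<lambda>i. v (Suc i))"
    using eq by (simp add: cofactor_def minor_def del: sum.lessThan_Suc)
  finally show ?thesis .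
qed

lemma minor_kernel:
  assumes "minor d k v \<noteq> 0" and "\<And>i. i < k \<Longrightarrow> (\<Sum>l<k. v i (d + l) * c l) = 0" and "l < k"
  shows "c l = 0"
proof -
  let ?c = "vec k c"
  have "vmat d k v *\<^sub>v ?c = 0\<^sub>v k"
    using assms(2) by (intro eq_vecI) (auto simp: scalar_prod_def atLeast0LessThan)
  moreover have "det (vmat d k v) \<noteq> 0" using assms(1) by (simp add: minor_def)
  ultimately have "?c = 0\<^sub>v k"
    using det_0_iff_vec_prod_zero[OF vmat_carrier, of d k v] vec_carrier by blast
  then have "?c $ l = 0\<^sub>v k $ l" by simp
  then show ?thesis using assms(3) by simp
qed

text \<open>The rows \<open>X 1\<close>, ..., \<open>X k\<close> are common to all minors of a
  three-term relation; \<open>X 0\<close> and \<open>X (Suc k)\<close> are overwritten and therefore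
  free to serve as arguments.\<close>

definition bracket :: "nat \<Rightarrow> nat \<Rightarrow> (nat \<Rightarrow> nat \<Rightarrow> real) \<Rightarrow> (nat \<Rightarrow> real) \<Rightarrow> (nat \<Rightarrow> real) \<Rightarrow> real" where
  "bracket d k X u v = minor d (Suc (Suc k)) (X(0 := u, Suc k := v))"

lemma bracket_swap: "bracket d k X v u = - bracket d k X u v"
  using minor_swap[of 0 "Suc (Suc k)" "Suc k" d "X(0 := u, Suc k := v)"]
  by (simp add: bracket_def fun_upd_twist)

lemma bracket_self: "bracket d k X u u = 0"
  unfolding bracket_def by (rule minor_eq_rows[of 0 _ "Suc k"]) auto

lemma bracket_row_left: "0 < i \<Longrightarrow> i \<le> k \<Longrightarrow> bracket d k X (X i) v = 0"
  unfolding bracket_def by (rule minor_eq_rows[of 0 _ i]) auto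

lemma bracket_row_right: "0 < i \<Longrightarrow> i \<le> k \<Longrightarrow> bracket d k X v (X i) = 0"
  by (subst bracket_swap) (simp add: bracket_row_left)

text \<open>Both sides are linear in \<^term>\<open>a\<close> and agree on the rows of the matrix of \<^term>\<open>bracket d k X p q\<close>,
  which span the whole space.\<close>

lemma pluecker:
  assumes "bracket d k X p q \<noteq> 0"
  shows "bracket d k X a b * bracket d k X p q
       = bracket d k X a q * bracket d k X p b + bracket d k X p a * bracket d k X q b"
proof -
  let ?n = "Suc (Suc k)" and ?B = "bracket d k X"
  have lin: "\<exists>c. \<forall>u. ?B u v = (\<Sum>l<?n. u (d + l) * c l)" for v
  proof -
    have "?B u v = minor d ?n ((X(Suc k := v))(0 := u))" for u
      by (simp add: bracket_def fun_upd_twist)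
    then show ?thesis using minor_expand[of 0 ?n d "X(Suc k := v)"] by simp
  qed
  obtain cb where cb: "\<And>u. ?B u b = (\<Sum>l<?n. u (d + l) * cb l)" using lin by blast
  obtain cq where cq: "\<And>u. ?B u q = (\<Sum>l<?n. u (d + l) * cq l)" using lin by blast
  obtain cp where cp: "\<And>u. ?B u p = (\<Sum>l<?n. u (d + l) * cp l)" using lin by blast
  define c where "c l = cb l * ?B p q - cq l * ?B p b + cp l * ?B q b" for l
  have psi: "(\<Sum>l<?n. u (d + l) * c l) = ?B u b * ?B p q - ?B u q * ?B p b - ?B p u * ?B q b" for u
  proof -
    have "(\<Sum>l<?n. u (d + l) * c l) = ?B u b * ?B p q - ?B u q * ?B p b + ?B u p * ?B q b"
    proof -
      have "(\<Sum>l<?n. u (d + l) * c l)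
          = (\<Sum>l<?n. u (d + l) * cb l * ?B p q - u (d + l) * cq l * ?B p b + u (d + l) * cp l * ?B q b)"
        by (intro sum.cong) (simp_all add: c_def algebra_simps)
      also have "\<dots> = ?B u b * ?B p q - ?B u q * ?B p b + ?B u p * ?B q b"
        unfolding cb[of u] cq[of u] cp[of u] sum.distrib sum_subtractf sum_distrib_right ..
      finally show ?thesis .
    qed
    also have "?B u p = - ?B p u" by (rule bracket_swap)
    finally show ?thesis by simp
  qed
  have "c l = 0" if "l < ?n" for l
  proof (rule minor_kernel[OF _ _ that])
    show "minor d ?n (X(0 := p, Suc k := q)) \<noteq> 0" using assms by (simp add: bracket_def)
    fix i assume i: "i < ?n"
    consider "i = 0" | "i = Suc k" | "0 < i" "i \<le> k" using i by linarith
    then have "?B v b * ?B p q - ?B v q * ?B p b - ?B p v * ?B q b = 0"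
      if "v = (X(0 := p, Suc k := q)) i" for v
      by cases (use that in \<open>simp_all add: bracket_self bracket_row_left bracket_row_right\<close>)
    then show "(\<Sum>l<?n. (X(0 := p, Suc k := q)) i (d + l) * c l) = 0" unfolding psi by simp
  qed
  then have "(\<Sum>l<?n. a (d + l) * c l) = 0" by simp
  then show ?thesis unfolding psi by simp
qed

section \<open>Growth of the minors of the path matrix\<close>

text \<open>The bounds hold on the whole ray from 1 and not only in the limit; with the positive
  lower constant this makes such functions positive there, and sums and products stay in the
  class.\<close>

definition asymp_pow :: "(real \<Rightarrow> real) \<Rightarrow> nat \<Rightarrow> bool" where
  "asymp_pow F n \<longleftrightarrow> (\<exists>a>0. \<exists>b. \<forall>t\<ge>1. a * t ^ n \<le> F t \<and> F t \<le> b * t ^ n)"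

lemma asymp_powI: "0 < a \<Longrightarrow> (\<And>t. 1 \<le> t \<Longrightarrow> a * t ^ n \<le> F t \<and> F t \<le> b * t ^ n) \<Longrightarrow> asymp_pow F n"
  unfolding asymp_pow_def by blast

lemma asymp_powE:
  assumes "asymp_pow F n"
  obtains a b where "0 < a" "0 < b" "\<And>t. 1 \<le> t \<Longrightarrow> a * t ^ n \<le> F t" "\<And>t. 1 \<le> t \<Longrightarrow> F t \<le> b * t ^ n"
proof -
  obtain a b where ab: "0 < a" "\<forall>t\<ge>1. a * t ^ n \<le> F t \<and> F t \<le> b * t ^ n"
    using assms unfolding asymp_pow_def by blast
  have "a \<le> b" using ab(2)[rule_format, of 1] by simp
  then show ?thesis using ab by (intro that[of a b]) auto
qed

lemma asymp_pow_pos: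
  assumes "asymp_pow F n" "1 \<le> t"
  shows "0 < F t"
proof -
  obtain a b where ab: "0 < a" "\<And>t. 1 \<le> t \<Longrightarrow> a * t ^ n \<le> F t" using assms(1) by (rule asymp_powE) (rule that)
  have "0 < a * t ^ n" using ab(1) assms(2) by simp
  then show ?thesis using ab(2)[OF assms(2)] by linarith
qed

lemma asymp_pow_cong: "asymp_pow F n \<Longrightarrow> (\<And>t. 1 \<le> t \<Longrightarrow> F t = G t) \<Longrightarrow> asymp_pow G n"
  unfolding asymp_pow_def by simp

lemma asymp_pow_power: "asymp_pow (\<lambda>t. t ^ n) n"
  by (rule asymp_powI[of 1 _ _ 1]) auto

lemma asymp_pow_mult:
  assumes "asymp_pow F m" "asymp_pow G n"
  shows "asymp_pow (\<lambda>t. F t * G t) (m + n)"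
proof -
  obtain a b where ab: "0 < a" "0 < b" "\<And>t. 1 \<le> t \<Longrightarrow> a * t ^ m \<le> F t" "\<And>t. 1 \<le> t \<Longrightarrow> F t \<le> b * t ^ m"
    using assms(1) by (rule asymp_powE) (rule that)
  obtain c d where cd: "0 < c" "0 < d" "\<And>t. 1 \<le> t \<Longrightarrow> c * t ^ n \<le> G t" "\<And>t. 1 \<le> t \<Longrightarrow> G t \<le> d * t ^ n"
    using assms(2) by (rule asymp_powE) (rule that)
  show ?thesis
  proof (rule asymp_powI[of "a * c" _ _ "b * d"], use ab cd in simp, intro conjI)
    fix t :: real assume t: "1 \<le> t"
    have "a * t ^ m * (c * t ^ n) \<le> F t * G t"
      using ab(1) ab(3)[OF t] cd(1) cd(3)[OF t] t asymp_pow_pos[OF assms(1) t]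
      by (intro mult_mono) auto
    then show "a * c * t ^ (m + n) \<le> F t * G t" by (simp add: power_add mult_ac)
    have "F t * G t \<le> b * t ^ m * (d * t ^ n)"
      using ab(2) ab(4)[OF t] cd(2) cd(4)[OF t] t asymp_pow_pos[OF assms(2) t]
      by (intro mult_mono) auto
    then show "F t * G t \<le> b * d * t ^ (m + n)" by (simp add: power_add mult_ac)
  qed
qed

text \<open>Both functions are positive, so nothing cancels and the larger exponent survives: this
  is where sums turn into maxima.\<close>

lemma asymp_pow_add:
  assumes "asymp_pow F m" "asymp_pow G n"
  shows "asymp_pow (\<lambda>t. F t + G t) (max m n)"
proof -
  obtain a b where ab: "0 < a" "0 < b" "\<And>t. 1 \<le> t \<Longrightarrow> a * t ^ m \<le> F t" "\<And>t. 1 \<le> t \<Longrightarrow> F t \<le> b * t ^ m"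
    using assms(1) by (rule asymp_powE) (rule that)
  obtain c d where cd: "0 < c" "0 < d" "\<And>t. 1 \<le> t \<Longrightarrow> c * t ^ n \<le> G t" "\<And>t. 1 \<le> t \<Longrightarrow> G t \<le> d * t ^ n"
    using assms(2) by (rule asymp_powE) (rule that)
  show ?thesis
  proof (rule asymp_powI[of "min a c" _ _ "b + d"], use ab cd in simp, intro conjI)
    fix t :: real assume t: "1 \<le> t"
    have F: "0 < F t" "0 < G t" using assms asymp_pow_pos t by auto
    have "min a c * t ^ max m n \<le> a * t ^ m \<or> min a c * t ^ max m n \<le> c * t ^ n"
      using t by (cases "m \<le> n") (auto simp: max_def intro!: mult_right_mono)
    then show "min a c * t ^ max m n \<le> F t + G t"
      using ab(3)[OF t] cd(3)[OF t] F by linarith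
    have "b * t ^ m \<le> b * t ^ max m n" "d * t ^ n \<le> d * t ^ max m n"
      using t ab(2) cd(2) by (auto intro!: mult_left_mono power_increasing)
    then show "F t + G t \<le> (b + d) * t ^ max m n"
      using ab(4)[OF t] cd(4)[OF t] by (simp add: algebra_simps)
  qed
qed

lemma asymp_pow_le:
  assumes "asymp_pow F m" "asymp_pow F n"
  shows "m \<le> n"
proof (rule ccontr)
  assume "\<not> m \<le> n"
  then obtain e where e: "m = n + Suc e" using less_iff_Suc_add[of n m] by auto
  obtain a where a: "0 < a" "\<And>t. 1 \<le> t \<Longrightarrow> a * t ^ m \<le> F t" using assms(1) by (rule asymp_powE) (rule that)
  obtain b where b: "0 < b" "\<And>t. 1 \<le> t \<Longrightarrow> F t \<le> b * t ^ n" using assms(2) by (rule asymp_powE) (rule that)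
  \<comment> \<open>Chosen so that \<open>b < a * t\<close>: one surplus power of \<open>t\<close>
    outweighs the quotient of the two constants.\<close>
  define t where "t = 1 + b / a"
  have t: "1 \<le> t" "b < a * t" using a(1) b(1) by (auto simp: t_def field_simps)
  have "a * t * t ^ n \<le> a * t ^ Suc e * t ^ n"
    using t a(1) by (intro mult_right_mono mult_left_mono) (auto simp: self_le_power)
  also have "\<dots> \<le> b * t ^ n" using a(2)[OF t(1)] b(2)[OF t(1)] by (simp add: e power_add mult_ac)
  finally have "a * t * t ^ n \<le> b * t ^ n" .
  moreover have "0 < t ^ n" using t by simp
  ultimately show False using t(2) by simp
qed

lemma asymp_pow_unique: "asymp_pow F m \<Longrightarrow> asymp_pow F n \<Longrightarrow> m = n"
  by (meson antisym asymp_pow_le)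

text \<open>Component \<open>l\<close> of \<open>pvec t w p c\<close> is the generating function of the lattice paths through the first \<open>p\<close> rows that
  enter in column \<open>l\<close> and leave in column \<open>c\<close>.\<close>

fun pvec :: "real \<Rightarrow> (nat \<times> nat \<Rightarrow> nat) \<Rightarrow> nat \<Rightarrow> nat \<Rightarrow> nat \<Rightarrow> real" where
  "pvec t w 0 c = unitv c"
| "pvec t w (Suc p) 0 = (\<lambda>l. t ^ w (p, 0) * (pvec t w p 0 l + 0))"
| "pvec t w (Suc p) (Suc c) = (\<lambda>l. t ^ w (p, Suc c) * (pvec t w p (Suc c) l + pvec t w (Suc p) c l))"

lemma pvec_upper: "c < l \<Longrightarrow> pvec t w p c l = 0"
  by (induction t w p c arbitrary: l rule: pvec.induct) (auto simp: unitv_def)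

text \<open>The vectors after the first \<^term>\<open>j\<close> columns of row \<^term>\<open>p\<close> have been processed.\<close>

definition svec :: "real \<Rightarrow> (nat \<times> nat \<Rightarrow> nat) \<Rightarrow> nat \<Rightarrow> nat \<Rightarrow> nat \<Rightarrow> nat \<Rightarrow> real" where
  "svec t w p j c = (if c < j then pvec t w (Suc p) c else pvec t w p c)"

definition sdet :: "real \<Rightarrow> (nat \<times> nat \<Rightarrow> nat) \<Rightarrow> nat \<Rightarrow> nat \<Rightarrow> nat \<Rightarrow> nat \<Rightarrow> (nat \<Rightarrow> nat) \<Rightarrow> real" where
  "sdet t w d k p j s = minor d k (\<lambda>i. svec t w p j (s i))"

text \<open>The region of the chain that corresponds to row \<open>i\<close> of \<open>sdet\<close>:
  row \<open>p\<close> is open to it only once its end column has been processed.\<close>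

definition sreg :: "nat \<Rightarrow> nat \<Rightarrow> nat \<Rightarrow> (nat \<Rightarrow> nat) \<Rightarrow> nat \<Rightarrow> (nat \<times> nat) set" where
  "sreg d p j s i = rect d (if s i < j then Suc p else p) (Suc (s i))"

definition valid :: "nat \<Rightarrow> nat \<Rightarrow> nat \<Rightarrow> (nat \<Rightarrow> nat) \<Rightarrow> bool" where
  "valid d k q s \<longleftrightarrow> (\<forall>i i'. i < i' \<longrightarrow> i' < k \<longrightarrow> s i < s i') \<and> (\<forall>i<k. d \<le> s i \<and> s i < q)"

definition movable :: "nat \<Rightarrow> nat \<Rightarrow> (nat \<Rightarrow> nat) \<Rightarrow> nat \<Rightarrow> bool" where
  "movable d k s j \<longleftrightarrow> d < j \<and> (\<forall>i<k. s i \<noteq> j - 1)"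

lemma valid_inj: "valid d k q s \<Longrightarrow> i < k \<Longrightarrow> i' < k \<Longrightarrow> s i = s i' \<Longrightarrow> i = i'"
  unfolding valid_def by (metis less_irrefl linorder_neqE_nat)

lemma valid_lower:
  assumes "valid d k q s" "i < k"
  shows "d + i \<le> s i"
  using assms(2)
proof (induction i)
  case 0 then show ?case using assms(1) by (simp add: valid_def)
next
  case (Suc i)
  then have "s i < s (Suc i)" using assms(1) by (simp add: valid_def)
  then show ?case using Suc by simp
qed

lemma valid_move:
  assumes "valid d k q s" "i0 < k" "s i0 = j" "movable d k s j"
  shows "valid d k q (s(i0 := j - 1))"
  unfolding valid_def
proof (intro conjI allI impI)
  fix i i' assume i: "i < i'" "i' < k"
  have lt: "s i < s i'" using assms(1) i by (simp add: valid_def)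
  have "s i \<noteq> j - 1" using assms(4) i by (simp add: movable_def)
  then show "(s(i0 := j - 1)) i < (s(i0 := j - 1)) i'"
    using lt i assms(3) by auto
next
  fix i assume i: "i < k"
  have "d \<le> s i" "s i < q" using assms(1) i by (auto simp: valid_def)
  moreover have "d < j" using assms(4) by (simp add: movable_def)
  ultimately show "d \<le> (s(i0 := j - 1)) i" "(s(i0 := j - 1)) i < q" using assms(3) by auto
qed

lemma sdet_skip:
  assumes "\<And>i. i < k \<Longrightarrow> s i \<noteq> j"
  shows "sdet t w d k p (Suc j) s = sdet t w d k p j s"
  unfolding sdet_def using assms by (intro minor_cong) (auto simp: svec_def less_Suc_eq)

text \<open>Processing the cell \<open>(p, j)\<close> changes row \<open>i0\<close> only, by the
  recursion of \<open>pvec\<close>, so linearity gives two minors. The second belongs to the moved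
  position vector; if the move is blocked, it has a repeated row or a row that vanishes on its
  columns.\<close>

lemma sdet_step:
  assumes v: "valid d k q s" and i0: "i0 < k" "s i0 = j"
  shows "sdet t w d k p (Suc j) s = t ^ w (p, j) *
    (sdet t w d k p j s + (if movable d k s j then sdet t w d k p j (s(i0 := j - 1)) else 0))"
proof -
  \<comment> \<open>The vector of the left neighbour, already updated; column 0 has none, in
    accordance with the summand 0 in \<open>pvec\<close>.\<close>
  define z where "z = (if j = 0 then (\<lambda>_. 0) else pvec t w (Suc p) (j - 1))"
  let ?v = "\<lambda>i. svec t w p j (s i)"
  have pv: "pvec t w (Suc p) j = (\<lambda>l. t ^ w (p, j) * (pvec t w p j l + z l))"
    by (cases j) (auto simp: z_def)
  have ne: "s i \<noteq> j" if "i < k" "i \<noteq> i0" for i using valid_inj[OF v that(1) i0(1)] i0(2) that(2) by auto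
  have "sdet t w d k p (Suc j) s = minor d k (?v(i0 := pvec t w (Suc p) j))"
    unfolding sdet_def using ne i0 by (intro minor_cong) (auto simp: svec_def less_Suc_eq)
  also have "\<dots> = t ^ w (p, j) * (minor d k (?v(i0 := pvec t w p j)) + minor d k (?v(i0 := z)))"
    unfolding pv using i0(1) by (rule minor_linear)
  also have "minor d k (?v(i0 := pvec t w p j)) = sdet t w d k p j s"
    unfolding sdet_def using i0 by (intro minor_cong) (auto simp: svec_def)
  also have "minor d k (?v(i0 := z)) = (if movable d k s j then sdet t w d k p j (s(i0 := j - 1)) else 0)"
  proof (cases "movable d k s j")
    case True
    then have "0 < j" by (auto simp: movable_def)
    then have "minor d k (?v(i0 := z)) = sdet t w d k p j (s(i0 := j - 1))"
      unfolding sdet_def by (intro minor_cong) (auto simp: svec_def z_def)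
    then show ?thesis using True by simp
  next
    case False
    have "minor d k (?v(i0 := z)) = 0"
    proof (cases "d < j")
      case True
      then obtain i where i: "i < k" "s i = j - 1" using False by (auto simp: movable_def)
      then have "i \<noteq> i0" using i0 True by auto
      then show ?thesis using i i0 True
        by (intro minor_eq_rows[of i k i0]) (auto simp: svec_def z_def)
    next
      case le: False
      have "z (d + l) = 0" for l using le by (auto simp: z_def intro: pvec_upper simp del: pvec.simps)
      then show ?thesis using i0 by (intro minor_zero_row[of i0 k]) auto
    qed
    then show ?thesis using False by simp
  qed
  finally show ?thesis .
qed

lemma sreg_finite [simp]: "finite (sreg d p j s i)"
  by (simp add: sreg_def)

lemma cover_max_skip:
  assumes "\<And>i. i < k \<Longrightarrow> s i \<noteq> j"
  shows "cover_max comparable (sreg d p (Suc j) s) w k = cover_max comparable (sreg d p j s) w k"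
  using assms by (intro cover_max_cong) (auto simp: sreg_def less_Suc_eq)

text \<open>The tropical image of \<open>sdet_step\<close>: a product becomes a sum, a sum becomes a
  maximum, and a vanishing minor becomes a dominated term. A blocked move is dominated by
  \<open>cover_max_exchange\<close>, or because its region has no columns.\<close>

lemma cover_max_step:
  assumes v: "valid d k q s" and i0: "i0 < k" "s i0 = j"
  shows "cover_max comparable (sreg d p (Suc j) s) w k = w (p, j) +
    (if movable d k s j
     then max (cover_max comparable (sreg d p j s) w k) (cover_max comparable (sreg d p j (s(i0 := j - 1))) w k)
     else cover_max comparable (sreg d p j s) w k)"
proof -
  let ?R = "sreg d p (Suc j) s"
  have ne: "s i \<noteq> j" if "i < k" "i \<noteq> i0" for i using valid_inj[OF v that(1) i0(1)] i0(2) that(2) by auto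
  have dj: "d \<le> j" using v i0 by (auto simp: valid_def)
  have "cover_max comparable ?R w k = w (p, j)
    + max (cover_max comparable (?R(i0 := rect d p (Suc j))) w k)
          (cover_max comparable (?R(i0 := rect d (Suc p) j)) w k)"
    using i0 dj ne by (intro cover_max_corner) (auto simp: sreg_def rect_def less_Suc_eq)
  moreover have "cover_max comparable (?R(i0 := rect d p (Suc j))) w k = cover_max comparable (sreg d p j s) w k"
    using i0 ne by (intro cover_max_cong) (auto simp: sreg_def less_Suc_eq)
  moreover have "cover_max comparable (?R(i0 := rect d (Suc p) j)) w k
      = cover_max comparable (sreg d p j (s(i0 := j - 1))) w k" if "movable d k s j"
    using i0 ne that by (intro cover_max_cong) (auto simp: sreg_def movable_def less_Suc_eq)
  moreover have "cover_max comparable (?R(i0 := rect d (Suc p) j)) w k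
      \<le> cover_max comparable (?R(i0 := rect d p (Suc j))) w k" if nm: "\<not> movable d k s j"
  proof (cases "d < j")
    case True
    then obtain i where i: "i < k" "s i = j - 1" using nm by (auto simp: movable_def)
    then have "i \<noteq> i0" using i0 True by auto
    then show ?thesis
      using i i0 True by (intro cover_max_exchange[of i0 k i]) (auto simp: sreg_def)
  next
    case False
    then have "rect d (Suc p) j = {}" by (auto simp: rect_def)
    then show ?thesis by (intro cover_max_region_mono) auto
  qed
  ultimately show ?thesis by (auto simp: max_def)
qed

lemma sdet_complete:
  "(\<And>i. i < k \<Longrightarrow> s i < j) \<Longrightarrow> sdet t w d k p j s = sdet t w d k (Suc p) 0 s"
  unfolding sdet_def by (intro minor_cong) (auto simp: svec_def)

lemma cover_max_complete:
  "(\<And>i. i < k \<Longrightarrow> s i < j) \<Longrightarrow>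
     cover_max comparable (sreg d p j s) w k = cover_max comparable (sreg d (Suc p) 0 s) w k"
  by (intro cover_max_cong) (auto simp: sreg_def)

lemma minor_unitv: "minor d k (\<lambda>i. unitv (d + i)) = 1"
  by (induction k) (simp_all add: minor_unit_last)

lemma sdet_initial:
  assumes v: "valid d k q s"
  shows "sdet t w d k 0 0 s = (if \<forall>i<k. s i = d + i then 1 else 0)"
proof (cases "\<forall>i<k. s i = d + i")
  case True
  have "sdet t w d k 0 0 s = minor d k (\<lambda>i. unitv (d + i))"
    unfolding sdet_def using True by (intro minor_cong) (simp add: svec_def)
  then show ?thesis using True by (simp add: minor_unitv)
next
  case False
  then obtain i where i: "i < k" "s i \<noteq> d + i" by blast
  then have lt: "d + i < s i" using valid_lower[OF v i(1)] by simp
  have up: "d + i' < s i'" if "i \<le> i'" "i' < k" for i'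
    using that
  proof (induction i' rule: dec_induct)
    case base
    then show ?case using lt by simp
  next
    case (step n)
    then have "s n < s (Suc n)" using v by (simp add: valid_def)
    then show ?case using step by simp
  qed
  \<comment> \<open>An excess over the lowest position persists up to the last index, so the last
    unit vector lies outside the columns of the minor.\<close>
  have "d + (k - 1) < s (k - 1)" using up[of "k - 1"] i(1) by simp
  then have "sdet t w d k 0 0 s = 0"
    unfolding sdet_def using i(1) by (intro minor_zero_row[of "k - 1"]) (auto simp: svec_def unitv_def)
  then show ?thesis using False by simp
qed

lemma sdet_nonneg_step:
  assumes nn: "\<And>s. valid d k q s \<Longrightarrow> 0 \<le> sdet t w d k p j s" and v: "valid d k q s" and w: "w (p, j) = 0"
  shows "sdet t w d k p j s \<le> sdet t w d k p (Suc j) s"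
proof (cases "\<exists>i<k. s i = j")
  case True
  then obtain i where i: "i < k" "s i = j" by blast
  show ?thesis
    using nn[OF valid_move[OF v i]] by (simp add: sdet_step[OF v i] w)
next
  case False
  then show ?thesis using sdet_skip[of k s j] by auto
qed

text \<open>Along weightless rows every determinant eventually becomes positive: a position vector is reached
  from the lowest one after as many rows as the total height it gains.\<close>

lemma sdet_weightless:
  assumes w: "\<And>r c. r < n \<Longrightarrow> w (r, c) = 0"
  shows "p < n \<or> p = n \<and> j = 0 \<Longrightarrow> valid d k q s \<Longrightarrow> 0 \<le> sdet t w d k p j s \<and>
    ((\<Sum>i<k. s i) \<le> (\<Sum>i<k. d + i) + p \<longrightarrow> 0 < sdet t w d k p j s)"
proof (induction p arbitrary: j s)
  case 0
  then show ?case
  proof (induction j arbitrary: s)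
    case 0
    have "\<forall>i<k. s i = d + i" if "(\<Sum>i<k. s i) \<le> (\<Sum>i<k. d + i)"
    proof (rule ccontr)
      assume "\<not> ?thesis"
      then obtain i where "i < k" "d + i \<noteq> s i" by metis
      then have "(\<Sum>i<k. d + i) < (\<Sum>i<k. s i)"
        using valid_lower[OF 0(2)] by (intro sum_strict_mono_ex1) (auto intro!: bexI[of _ i] simp: le_neq_implies_less)
      then show False using that by simp
    qed
    then show ?case using 0 by (auto simp: sdet_initial)
  next
    case (Suc j)
    have "sdet t w d k 0 j s \<le> sdet t w d k 0 (Suc j) s"
      using Suc by (intro sdet_nonneg_step) (auto simp: w)
    then show ?case using Suc.IH[of s] Suc.prems by auto
  qed
next
  case (Suc p)
  note IH0 = Suc.IH
  have pn: "p < n" using Suc.prems by auto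
  have mono: "sdet t w d k p j s \<le> sdet t w d k p (j + e) s" if "valid d k q s" for j e s
  proof (induction e)
    case (Suc e)
    have "sdet t w d k p (j + e) s \<le> sdet t w d k p (Suc (j + e)) s"
      using that pn IH0 by (intro sdet_nonneg_step) (auto simp: w)
    then show ?case using Suc by simp
  qed simp
  have base: "0 \<le> sdet t w d k (Suc p) 0 s \<and>
    ((\<Sum>i<k. s i) \<le> (\<Sum>i<k. d + i) + Suc p \<longrightarrow> 0 < sdet t w d k (Suc p) 0 s)" if v: "valid d k q s" for s
  proof -
    have lim: "sdet t w d k p (j + q) s = sdet t w d k (Suc p) 0 s" for j
      using v by (intro sdet_complete) (auto simp: valid_def)
    have IH: "0 \<le> sdet t w d k p j s \<and> ((\<Sum>i<k. s i) \<le> (\<Sum>i<k. d + i) + p \<longrightarrow> 0 < sdet t w d k p j s)"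
      if "valid d k q s" for j s using Suc.IH that pn by blast
    show ?thesis
    proof (cases "(\<Sum>i<k. s i) = (\<Sum>i<k. d + i) + Suc p")
      case False
      then show ?thesis using IH[OF v, of "0 + q"] unfolding lim by auto
    next
      case True
      have "\<exists>i. i < k \<and> d + i < s i"
      proof (rule ccontr)
        assume "\<not> ?thesis"
        then have "(\<Sum>i<k. s i) \<le> (\<Sum>i<k. d + i)" by (intro sum_mono) (meson lessThan_iff not_less)
        then show False using True by simp
      qed
      \<comment> \<open>Below the first raised position all positions are lowest, so this one is
        free to move down. The moved vector has total height one less, which the induction
        hypothesis covers.\<close>
      then obtain i0 where i0: "i0 < k" "d + i0 < s i0" "\<And>i. i < i0 \<Longrightarrow> \<not> (i < k \<and> d + i < s i)"
        using exists_least_iff[of "\<lambda>i. i < k \<and> d + i < s i"] by metis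
      define j where "j = s i0"
      have mv: "movable d k s j"
        unfolding movable_def
      proof (intro conjI allI impI)
        show "d < j" using i0 by (simp add: j_def)
        fix i assume i: "i < k"
        show "s i \<noteq> j - 1"
        proof (cases "i < i0")
          case True then show ?thesis using i0(2) i0(3)[OF True] i by (simp add: j_def)
        next
          case False
          then have "s i0 \<le> s i" using v i by (cases "i = i0") (auto simp: valid_def less_imp_le)
          then show ?thesis using i0(2) by (simp add: j_def)
        qed
      qed
      let ?s = "s(i0 := j - 1)"
      have v': "valid d k q ?s" by (rule valid_move[OF v i0(1) _ mv]) (simp add: j_def)
      have "(\<Sum>i<k. ?s i) + 1 = (\<Sum>i<k. s i)"
      proof -
        have "(\<Sum>i<k. ?s i) = (j - 1) + (\<Sum>i\<in>{..<k} - {i0}. s i)"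
          using i0(1) by (subst sum.remove[of _ i0]) auto
        moreover have "(\<Sum>i<k. s i) = j + (\<Sum>i\<in>{..<k} - {i0}. s i)"
          using i0(1) by (subst sum.remove[of _ i0]) (auto simp: j_def)
        moreover have "0 < j" using i0 by (simp add: j_def)
        ultimately show ?thesis by simp
      qed
      then have "0 < sdet t w d k p j ?s" using IH[OF v', of j] True by simp
      moreover have "sdet t w d k p (Suc j) s = sdet t w d k p j s + sdet t w d k p j ?s"
        using sdet_step[OF v i0(1) j_def[symmetric], of t w p] mv w[OF pn] by simp
      moreover have "0 \<le> sdet t w d k p j s" using IH[OF v] by simp
      ultimately have "0 < sdet t w d k p (Suc j) s" by simp
      then have "0 < sdet t w d k (Suc p) 0 s" using mono[OF v, of "Suc j" q] unfolding lim by simp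
      then show ?thesis by simp
    qed
  qed
  show ?case using Suc.prems
  proof (induction j arbitrary: s)
    case 0
    then show ?case using base by blast
  next
    case (Suc j)
    have "sdet t w d k (Suc p) j s \<le> sdet t w d k (Suc p) (Suc j) s"
      using Suc by (intro sdet_nonneg_step) (auto simp: w)
    then show ?case using Suc.IH[of s] Suc.prems by auto
  qed
qed

lemma asymp_sdet_step:
  assumes IH: "\<And>s. valid d k q s \<Longrightarrow> asymp_pow (\<lambda>t. sdet t w d k p j s) (cover_max comparable (sreg d p j s) w k)"
    and v: "valid d k q s"
  shows "asymp_pow (\<lambda>t. sdet t w d k p (Suc j) s) (cover_max comparable (sreg d p (Suc j) s) w k)"
proof (cases "\<exists>i<k. s i = j")
  case True
  then obtain i where i: "i < k" "s i = j" by blast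
  show ?thesis
  proof (cases "movable d k s j")
    case mv: True
    have "asymp_pow (\<lambda>t. t ^ w (p, j) * (sdet t w d k p j s + sdet t w d k p j (s(i := j - 1))))
      (w (p, j) + max (cover_max comparable (sreg d p j s) w k) (cover_max comparable (sreg d p j (s(i := j - 1))) w k))"
      by (intro asymp_pow_mult asymp_pow_power asymp_pow_add IH v valid_move[OF v i mv])
    then show ?thesis using mv by (simp add: sdet_step[OF v i] cover_max_step[OF v i])
  next
    case False
    have "asymp_pow (\<lambda>t. t ^ w (p, j) * sdet t w d k p j s) (w (p, j) + cover_max comparable (sreg d p j s) w k)"
      by (intro asymp_pow_mult asymp_pow_power IH v)
    then show ?thesis using False by (simp add: sdet_step[OF v i] cover_max_step[OF v i])
  qed
next
  case False
  then show ?thesis using IH[OF v] by (simp add: sdet_skip cover_max_skip)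
qed

lemma pvec_weightless:
  assumes "\<And>r c. r < n \<Longrightarrow> w (r, c) = 0" "p \<le> n"
  shows "pvec t w p c = pvec 1 w p c"
proof -
  have "p \<le> n \<Longrightarrow> (\<And>r c. r < n \<Longrightarrow> w (r, c) = 0) \<Longrightarrow> pvec t w p c = pvec 1 w p c"
    by (induction t w p c rule: pvec.induct) simp_all
  then show ?thesis using assms by blast
qed

text \<open>The constant \<open>k * q\<close> bounds the total height of a position vector, so
  \<open>n\<close> weightless rows make every determinant positive before any weight is met. Up to
  there it does not depend on \<open>t\<close> and has exponent 0; afterwards each cell acts on
  determinants and chains by matching steps.\<close>

lemma asymp_sdet:
  assumes w: "\<And>r c. r < n \<Longrightarrow> w (r, c) = 0" and n: "k * q \<le> n" "n \<le> p" and v: "valid d k q s"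
  shows "asymp_pow (\<lambda>t. sdet t w d k p j s) (cover_max comparable (sreg d p j s) w k)"
  using n(2) v
proof (induction p arbitrary: j s rule: dec_induct)
  case base
  show ?case using base
  proof (induction j arbitrary: s)
    case 0
    have "cover_max comparable (sreg d n 0 s) w k \<le> 0"
    proof (rule cover_max_le)
      fix U assume "covered comparable (sreg d n 0 s) k U"
      then have "U \<subseteq> (\<Union>i<k. sreg d n 0 s i)" by (rule covered_subset)
      then have "\<forall>x\<in>U. w x = 0" using w by (fastforce simp: sreg_def rect_def)
      then show "sum w U \<le> 0" by simp
    qed simp
    then have cm: "cover_max comparable (sreg d n 0 s) w k = 0" by simp
    have "(\<Sum>i<k. s i) \<le> (\<Sum>i<k. q)" using 0 by (intro sum_mono) (auto simp: valid_def less_imp_le)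
    also have "\<dots> \<le> n" using n(1) by simp
    finally have "0 < sdet 1 w d k n 0 s" using sdet_weightless[of n w n 0 d k q s 1] w 0 by simp
    moreover have "sdet t w d k n 0 s = sdet 1 w d k n 0 s" for t
      unfolding sdet_def using pvec_weightless[of n w n t] w by (intro minor_cong) (simp add: svec_def)
    then have "(\<lambda>t. sdet t w d k n 0 s) = (\<lambda>t. sdet 1 w d k n 0 s)" by blast
    ultimately show ?case
      by (simp only: cm) (intro asymp_powI[of "sdet 1 w d k n 0 s" _ _ "sdet 1 w d k n 0 s"], auto)
  next
    case (Suc j)
    then show ?case by (rule asymp_sdet_step)
  qed
next
  case (step p)
  show ?case using step.prems
  proof (induction j arbitrary: s)
    case 0
    have lt: "\<And>i. i < k \<Longrightarrow> s i < q" using 0 by (simp add: valid_def)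
    show ?case using step.IH[OF 0, of q] by (simp add: sdet_complete[OF lt] cover_max_complete[OF lt])
  next
    case (Suc j)
    then show ?case by (rule asymp_sdet_step)
  qed
qed

section \<open>The two local rules on a grid\<close>

declare pvec.simps [simp del]

abbreviation grid_max :: "(nat \<times> nat \<Rightarrow> nat) \<Rightarrow> nat \<Rightarrow> nat \<Rightarrow> nat \<Rightarrow> nat \<Rightarrow> nat" where
  "grid_max w d k p c \<equiv> cover_max comparable (\<lambda>_. rect d p c) w k"

abbreviation cdet :: "real \<Rightarrow> (nat \<times> nat \<Rightarrow> nat) \<Rightarrow> nat \<Rightarrow> nat \<Rightarrow> nat \<Rightarrow> nat \<Rightarrow> real" where
  "cdet t w d k p a \<equiv> minor d k (\<lambda>i. pvec t w p (a + i))"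

lemma asymp_cdet:
  assumes w: "\<And>r c. r < n \<Longrightarrow> w (r, c) = 0" and n: "k * (a + k) \<le> n" "n \<le> p" and a: "d \<le> a"
  shows "asymp_pow (\<lambda>t. cdet t w d k p a) (grid_max w d k p (a + k))"
proof -
  have v: "valid d k (a + k) (\<lambda>i. a + i)" using a by (auto simp: valid_def)
  have "asymp_pow (\<lambda>t. sdet t w d k p 0 (\<lambda>i. a + i)) (cover_max comparable (sreg d p 0 (\<lambda>i. a + i)) w k)"
    using w n(1) n(2) v by (rule asymp_sdet)
  moreover have "cover_max comparable (sreg d p 0 (\<lambda>i. a + i)) w k = grid_max w d k p (a + k)"
    using cover_max_staircase[of k "a + k" d p w] by (simp add: sreg_def[abs_def])
  ultimately show ?thesis by (simp add: sdet_def svec_def)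
qed

section \<open>Determinant identities for consecutive end columns\<close>

text \<open>Among consecutive end columns only the first can be reached from the left, the others
  being blocked by their neighbours; in row \<open>p\<close> these merely pick up the weight of
  their own cell.\<close>

lemma cdet_row:
  assumes "0 < k" "d \<le> a"
  shows "cdet t w d k (Suc p) a = (\<Prod>i\<in>{1..<k}. t ^ w (p, a + i)) *
    minor d k (\<lambda>i. if i = 0 then pvec t w (Suc p) a else pvec t w p (a + i))"
proof -
  have v: "valid d k (a + k) (\<lambda>i. a + i)" using assms by (auto simp: valid_def)
  have step: "sdet t w d k p (Suc (a + m)) (\<lambda>i. a + i)
      = (\<Prod>i\<in>{1..m}. t ^ w (p, a + i)) * sdet t w d k p (Suc a) (\<lambda>i. a + i)" if "m < k" for m
    using that
  proof (induction m)
    case (Suc m)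
    have "\<not> movable d k (\<lambda>i. a + i) (a + Suc m)" using Suc.prems by (auto simp: movable_def)
    then show ?case using sdet_step[OF v Suc.prems, of "a + Suc m" t w p] Suc by simp
  qed simp
  have "cdet t w d k (Suc p) a = sdet t w d k p (Suc (a + (k - 1))) (\<lambda>i. a + i)"
    unfolding sdet_def using assms by (intro minor_cong) (auto simp: svec_def)
  also have "\<dots> = (\<Prod>i\<in>{1..k-1}. t ^ w (p, a + i)) * sdet t w d k p (Suc a) (\<lambda>i. a + i)"
    using assms by (intro step) simp
  also have "sdet t w d k p (Suc a) (\<lambda>i. a + i)
      = minor d k (\<lambda>i. if i = 0 then pvec t w (Suc p) a else pvec t w p (a + i))"
    unfolding sdet_def by (intro minor_cong) (auto simp: svec_def)
  also have "{1..k-1} = {1..<k}" using assms by auto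
  finally show ?thesis .
qed

text \<open>By its recursion \<open>pvec t w (Suc p) (Suc a)\<close> combines the new vector of
  column \<open>a\<close> with \<open>pvec t w p (Suc a)\<close>, which is a row already. So the new
  vector may be taken one column further right at the price of one weight, and minors starting in
  \<open>a\<close> and in \<open>Suc a\<close> share the same new vector.\<close>

lemma cdet_row_shift:
  assumes "d \<le> a"
  shows "cdet t w d (Suc (Suc n)) (Suc p) a = (\<Prod>i\<in>{1..n}. t ^ w (p, Suc a + i)) *
    minor d (Suc (Suc n)) (\<lambda>i. if i = 0 then pvec t w (Suc p) (Suc a) else pvec t w p (a + i))"
proof -
  let ?v = "\<lambda>i. pvec t w p (a + i)" and ?k = "Suc (Suc n)"
  have upd: "(\<lambda>i. if i = 0 then u else ?v i) = ?v(0 := u)" for u by auto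
  have "minor d ?k (?v(0 := pvec t w (Suc p) (Suc a)))
      = t ^ w (p, Suc a) * (minor d ?k (?v(0 := pvec t w p (Suc a))) + minor d ?k (?v(0 := pvec t w (Suc p) a)))"
    by (simp only: pvec.simps(3)) (rule minor_linear, simp)
  also have "minor d ?k (?v(0 := pvec t w p (Suc a))) = 0"
    by (rule minor_eq_rows[of 0 _ 1]) auto
  finally have "minor d ?k (?v(0 := pvec t w (Suc p) (Suc a))) = t ^ w (p, Suc a) * minor d ?k (?v(0 := pvec t w (Suc p) a))"
    by (simp only: add_0)
  moreover have "(\<Prod>i\<in>{1..<?k}. t ^ w (p, a + i)) = t ^ w (p, Suc a) * (\<Prod>i\<in>{1..n}. t ^ w (p, Suc a + i))"
  proof -
    have "(\<Prod>i\<in>{1..<?k}. t ^ w (p, a + i)) = (\<Prod>i\<in>{1..Suc n}. t ^ w (p, a + i))"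
      by (rule prod.cong) auto
    also have "\<dots> = t ^ w (p, a + 1) * (\<Prod>i\<in>{Suc 1..Suc n}. t ^ w (p, a + i))"
      by (rule prod.atLeast_Suc_atMost) simp
    also have "(\<Prod>i\<in>{Suc 1..Suc n}. t ^ w (p, a + i)) = (\<Prod>i\<in>{1..n}. t ^ w (p, a + Suc i))"
      by (rule prod.shift_bounds_cl_Suc_ivl)
    finally show ?thesis by simp
  qed
  ultimately show ?thesis unfolding upd using cdet_row[of ?k d a t w p] assms unfolding upd by simp
qed

lemma minor_second_rotate:
  "minor d (Suc (Suc n)) (\<lambda>i. if i = 0 then b else X (i - 1)) = (-1) ^ n * bracket d n X b (X 0)"
proof -
  have "bracket d n X (X 0) b = minor d (Suc (Suc n)) (\<lambda>i. if i = Suc n then b else X i)"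
    unfolding bracket_def by (intro minor_cong) auto
  also have "\<dots> = (-1) ^ Suc n * minor d (Suc (Suc n)) (\<lambda>i. if i = 0 then b else X (i - 1))"
    by (rule minor_rotate)
  finally show ?thesis by (subst bracket_swap) (simp flip: power_add mult.assoc)
qed

lemma sign_mult_self: "(-1::real) ^ n * (-1) ^ n = 1"
  by (simp flip: power_add)

text \<open>The three-term relation for \<open>b\<close>, \<open>X 0\<close>,
  \<open>X (Suc n)\<close> and the unit vector \<open>e\<close> over the rows \<open>X 1\<close>,
  ..., \<open>X n\<close>; \<open>e\<close> brings minors of order \<open>n + 1\<close> to order
  \<open>n + 2\<close>. The weights split off the minors agree on both sides except for that of the
  corner.\<close>

lemma cdet_pure:
  fixes t :: real
  assumes "1 \<le> a" and ne: "cdet t w 0 (Suc (Suc n)) (Suc p) a \<noteq> 0"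
  shows "cdet t w 0 (Suc (Suc n)) (Suc p) a * cdet t w 0 (Suc n) p a = t ^ w (p, a + Suc n) *
    (cdet t w 0 (Suc (Suc n)) (Suc p) (a - 1) * cdet t w 0 (Suc n) p (Suc a)
     + cdet t w 0 (Suc n) (Suc p) a * cdet t w 0 (Suc (Suc n)) p a)"
proof -
  define X where "X i = pvec t w p (a + i)" for i
  define b e T where "b = pvec t w (Suc p) a" and "e = unitv (Suc n)"
    and "T = (\<Prod>i\<in>{1..n}. t ^ w (p, a + i))"
  let ?k = "Suc (Suc n)" and ?B = "bracket 0 n X"
  have last: "?B u e = minor 0 (Suc n) (X(0 := u))" for u
    unfolding bracket_def by (subst minor_unit_last) (auto simp: e_def intro: minor_cong)
  have rho: "cdet t w 0 ?k (Suc p) a = t ^ w (p, a + Suc n) * T * ?B b (X (Suc n))"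
  proof -
    have "minor 0 ?k (\<lambda>i. if i = 0 then pvec t w (Suc p) a else pvec t w p (a + i)) = ?B b (X (Suc n))"
      unfolding bracket_def by (intro minor_cong) (auto simp: X_def b_def)
    moreover have "{1..<?k} = insert (Suc n) {1..n}" by auto
    ultimately show ?thesis using cdet_row[of ?k 0 a t w p] by (simp add: T_def)
  qed
  have mu: "cdet t w 0 (Suc n) p a = ?B (X 0) e"
    unfolding last by (intro minor_cong) (auto simp: X_def)
  have n2: "cdet t w 0 ?k p a = ?B (X 0) (X (Suc n))"
    unfolding bracket_def by (intro minor_cong) (auto simp: X_def)
  have n2': "cdet t w 0 (Suc n) p (Suc a) = (-1) ^ n * ?B (X (Suc n)) e"
  proof -
    have "cdet t w 0 (Suc n) p (Suc a) = minor 0 (Suc n) (\<lambda>i. if i = n then X (Suc n) else X (Suc i))"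
      by (intro minor_cong) (auto simp: X_def)
    also have "\<dots> = (-1) ^ n * minor 0 (Suc n) (\<lambda>i. if i = 0 then X (Suc n) else X (Suc (i - 1)))"
      by (rule minor_rotate)
    also have "minor 0 (Suc n) (\<lambda>i. if i = 0 then X (Suc n) else X (Suc (i - 1))) = ?B (X (Suc n)) e"
      unfolding last by (intro minor_cong) auto
    finally show ?thesis .
  qed
  have n1': "cdet t w 0 (Suc n) (Suc p) a = T * ?B b e"
  proof -
    have "minor 0 (Suc n) (\<lambda>i. if i = 0 then pvec t w (Suc p) a else pvec t w p (a + i)) = ?B b e"
      unfolding last by (intro minor_cong) (auto simp: X_def b_def)
    moreover have "{1..<Suc n} = {1..n}" by auto
    ultimately show ?thesis using cdet_row[of "Suc n" 0 a t w p] by (simp add: T_def)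
  qed
  have n1: "cdet t w 0 ?k (Suc p) (a - 1) = T * ((-1) ^ n * ?B b (X 0))"
  proof -
    have "minor 0 ?k (\<lambda>i. if i = 0 then b else X (i - 1)) = (-1) ^ n * ?B b (X 0)"
      by (rule minor_second_rotate)
    moreover have "minor 0 ?k (\<lambda>i. if i = 0 then pvec t w (Suc p) a else pvec t w p (a - 1 + i))
        = minor 0 ?k (\<lambda>i. if i = 0 then b else X (i - 1))"
      using assms(1) by (intro minor_cong) (auto simp: X_def b_def)
    moreover have sa: "Suc (a - 1) = a" using assms(1) by simp
    ultimately show ?thesis
      using cdet_row_shift[where d = 0 and a = "a - 1" and n = n and t = t and w = w and p = p, unfolded sa]
      by (simp only: T_def le0)
  qed
  have "?B b (X (Suc n)) \<noteq> 0" using ne unfolding rho by auto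
  from pluecker[OF this, of "X 0" e]
  have "?B b (X (Suc n)) * ?B (X 0) e = ?B b (X 0) * ?B (X (Suc n)) e + ?B b e * ?B (X 0) (X (Suc n))"
    by (simp add: algebra_simps)
  then have "t ^ w (p, a + Suc n) * T * (?B b (X (Suc n)) * ?B (X 0) e)
      = t ^ w (p, a + Suc n) * T * (((-1) ^ n * (-1) ^ n) * (?B b (X 0) * ?B (X (Suc n)) e) + ?B b e * ?B (X 0) (X (Suc n)))"
    by (simp add: sign_mult_self)
  then show ?thesis unfolding rho mu n2 n2' n1 n1' by (simp only: algebra_simps)
qed

text \<open>The unit vector \<open>e0\<close> replaces \<open>X (Suc n)\<close> in the relation: it
  strikes out column 0 and so yields the minors of the grid without its first column. Each product
  has exactly one factor with \<open>Suc p\<close> rows, so the same weights split off everywhere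
  and no corner weight appears.\<close>

lemma cdet_mixed:
  fixes t :: real
  assumes "1 \<le> a" and ne: "cdet t w 0 (Suc n) (Suc p) a \<noteq> 0"
  shows "cdet t w 0 (Suc n) (Suc p) a * cdet t w 1 (Suc n) p a =
    cdet t w 1 (Suc n) (Suc p) a * cdet t w 0 (Suc n) p a
    + cdet t w 0 (Suc (Suc n)) (Suc p) (a - 1) * cdet t w 1 n p (Suc a)"
proof -
  define X where "X i = pvec t w p (a + i)" for i
  define b e e0 T where "b = pvec t w (Suc p) a" and "e = unitv (Suc n)" and "e0 = unitv 0"
    and "T = (\<Prod>i\<in>{1..n}. t ^ w (p, a + i))"
  let ?k = "Suc (Suc n)" and ?B = "bracket 0 n X"
  have last: "?B u e = minor 0 (Suc n) (X(0 := u))" for u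
    unfolding bracket_def by (subst minor_unit_last) (auto simp: e_def intro: minor_cong)
  have first: "?B e0 u = (-1) ^ n * minor 1 (Suc n) (X(0 := u))" for u
  proof -
    have "?B e0 u = minor 1 (Suc n) (\<lambda>i. if i = n then u else X (Suc i))"
      unfolding bracket_def by (subst minor_unit_first) (auto simp: e0_def intro: minor_cong)
    also have "\<dots> = (-1) ^ n * minor 1 (Suc n) (\<lambda>i. if i = 0 then u else X (Suc (i - 1)))"
      by (rule minor_rotate)
    also have "minor 1 (Suc n) (\<lambda>i. if i = 0 then u else X (Suc (i - 1))) = minor 1 (Suc n) (X(0 := u))"
      by (intro minor_cong) auto
    finally show ?thesis .
  qed
  have row: "cdet t w d (Suc n) (Suc p) a = T * minor d (Suc n) (X(0 := b))" if "d \<le> 1" for d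
  proof -
    have "minor d (Suc n) (\<lambda>i. if i = 0 then pvec t w (Suc p) a else pvec t w p (a + i)) = minor d (Suc n) (X(0 := b))"
      by (intro minor_cong) (auto simp: X_def b_def)
    moreover have "{1..<Suc n} = {1..n}" by auto
    ultimately show ?thesis using cdet_row[of "Suc n" d a t w p] that assms(1) by (simp add: T_def)
  qed
  have row0: "cdet t w d (Suc n) p a = minor d (Suc n) (X(0 := X 0))" for d
    by (intro minor_cong) (auto simp: X_def)
  have rho: "cdet t w 0 (Suc n) (Suc p) a = T * ?B b e" unfolding last by (rule row) simp
  have nu1: "cdet t w 1 (Suc n) (Suc p) a = T * ((-1) ^ n * ?B e0 b)"
    unfolding first using row[of 1] by (simp flip: power_add mult.assoc)
  have mu: "cdet t w 1 (Suc n) p a = (-1) ^ n * ?B e0 (X 0)"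
    unfolding first using row0[of 1] by (simp flip: power_add mult.assoc)
  have nu2: "cdet t w 0 (Suc n) p a = ?B (X 0) e" unfolding last by (rule row0)
  have rho': "cdet t w 0 ?k (Suc p) (a - 1) = T * ((-1) ^ n * ?B b (X 0))"
  proof -
    have "minor 0 ?k (\<lambda>i. if i = 0 then b else X (i - 1)) = (-1) ^ n * ?B b (X 0)"
      by (rule minor_second_rotate)
    moreover have "minor 0 ?k (\<lambda>i. if i = 0 then pvec t w (Suc p) a else pvec t w p (a - 1 + i))
        = minor 0 ?k (\<lambda>i. if i = 0 then b else X (i - 1))"
      using assms(1) by (intro minor_cong) (auto simp: X_def b_def)
    moreover have sa: "Suc (a - 1) = a" using assms(1) by simp
    ultimately show ?thesis
      using cdet_row_shift[where d = 0 and a = "a - 1" and n = n and t = t and w = w and p = p, unfolded sa]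
      by (simp only: T_def le0)
  qed
  have mu': "cdet t w 1 n p (Suc a) = ?B e0 e"
    unfolding last by (subst minor_unit_first) (auto simp: e0_def X_def intro: minor_cong)
  have "?B b e \<noteq> 0" using ne unfolding rho by auto
  from pluecker[OF this, of e0 "X 0"]
  have "?B b e * ?B e0 (X 0) = ?B e0 b * ?B (X 0) e + ?B b (X 0) * ?B e0 e"
    by (simp add: bracket_swap[of 0 n X b e0] bracket_swap[of 0 n X e "X 0"] algebra_simps)
  then have "T * (-1) ^ n * (?B b e * ?B e0 (X 0)) = T * (-1) ^ n * (?B e0 b * ?B (X 0) e + ?B b (X 0) * ?B e0 e)"
    by simp
  then show ?thesis unfolding rho mu nu1 nu2 rho' mu' by (simp only: algebra_simps)
qed

lemma grid_max_pure:
  assumes w: "\<And>r c. r < n \<Longrightarrow> w (r, c) = 0" and n: "Suc q * Suc q \<le> n" "n \<le> p" and k: "1 \<le> k" "k \<le> q"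
  shows "grid_max w 0 k (Suc p) (Suc q) + grid_max w 0 (k - 1) p q = w (p, q) +
    max (grid_max w 0 k (Suc p) q + grid_max w 0 (k - 1) p (Suc q))
        (grid_max w 0 (k - 1) (Suc p) q + grid_max w 0 k p (Suc q))"
\<comment> \<open>For \<open>k = 1\<close> the terms of order \<open>k - 1\<close> are trivial and
  the claim is the corner recursion itself; the determinant identity starts at order 2.\<close>
proof (cases "k = 1")
  case True
  have "grid_max w 0 1 (Suc p) (Suc q) = w (p, q)
    + max (cover_max comparable ((\<lambda>_. rect 0 (Suc p) (Suc q))(0 := rect 0 p (Suc q))) w 1)
          (cover_max comparable ((\<lambda>_. rect 0 (Suc p) (Suc q))(0 := rect 0 (Suc p) q)) w 1)"
    by (rule cover_max_corner) auto
  also have "cover_max comparable ((\<lambda>_. rect 0 (Suc p) (Suc q))(0 := rect 0 p (Suc q))) w 1 = grid_max w 0 1 p (Suc q)"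
    by (rule cover_max_cong) simp
  also have "cover_max comparable ((\<lambda>_. rect 0 (Suc p) (Suc q))(0 := rect 0 (Suc p) q)) w 1 = grid_max w 0 1 (Suc p) q"
    by (rule cover_max_cong) simp
  finally show ?thesis using True by (simp add: max.commute)
next
  case False
  then obtain m where m: "k = Suc (Suc m)" using k by (metis Suc_pred' One_nat_def le_SucE le_zero_eq not_gr_zero old.nat.exhaust)
  \<comment> \<open>The first of the \<open>k\<close> consecutive end columns of which the last is
    \<open>q\<close>.\<close>
  define a where "a = Suc q - k"
  have a: "1 \<le> a" "a + Suc (Suc m) = Suc q" "a + Suc m = q" "Suc a + Suc m = Suc q" "a - 1 + Suc (Suc m) = q"
    using k m by (auto simp: a_def)
  have le: "j * c \<le> n" if "j \<le> Suc q" "c \<le> Suc q" for j c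
    using mult_le_mono[OF that] n(1) by linarith
  have asy: "asymp_pow (\<lambda>t. cdet t w 0 j p' b) (grid_max w 0 j p' (b + j))" if "n \<le> p'" "b + j \<le> Suc q" for j p' b
    using w le[of j "b + j"] that by (intro asymp_cdet[where n = n]) auto
  have rho: "asymp_pow (\<lambda>t. cdet t w 0 (Suc (Suc m)) (Suc p) a) (grid_max w 0 k (Suc p) (Suc q))"
    using asy[of "Suc p" a "Suc (Suc m)"] n(2) a m by simp
  have mu: "asymp_pow (\<lambda>t. cdet t w 0 (Suc m) p a) (grid_max w 0 (k - 1) p q)"
    using asy[of p a "Suc m"] n(2) a m by simp
  have n1: "asymp_pow (\<lambda>t. cdet t w 0 (Suc (Suc m)) (Suc p) (a - 1)) (grid_max w 0 k (Suc p) q)"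
    using asy[of "Suc p" "a - 1" "Suc (Suc m)"] n(2) a m by simp
  have n2': "asymp_pow (\<lambda>t. cdet t w 0 (Suc m) p (Suc a)) (grid_max w 0 (k - 1) p (Suc q))"
    using asy[of p "Suc a" "Suc m"] n(2) a m by simp
  have n1': "asymp_pow (\<lambda>t. cdet t w 0 (Suc m) (Suc p) a) (grid_max w 0 (k - 1) (Suc p) q)"
    using asy[of "Suc p" a "Suc m"] n(2) a m by simp
  have n2: "asymp_pow (\<lambda>t. cdet t w 0 (Suc (Suc m)) p a) (grid_max w 0 k p (Suc q))"
    using asy[of p a "Suc (Suc m)"] n(2) a m by simp
  have "asymp_pow (\<lambda>t. t ^ w (p, q) *
      (cdet t w 0 (Suc (Suc m)) (Suc p) (a - 1) * cdet t w 0 (Suc m) p (Suc a)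
       + cdet t w 0 (Suc m) (Suc p) a * cdet t w 0 (Suc (Suc m)) p a))
     (w (p, q) + max (grid_max w 0 k (Suc p) q + grid_max w 0 (k - 1) p (Suc q))
        (grid_max w 0 (k - 1) (Suc p) q + grid_max w 0 k p (Suc q)))"
    by (intro asymp_pow_mult asymp_pow_power asymp_pow_add n1 n2 n1' n2')
  then have "asymp_pow (\<lambda>t. cdet t w 0 (Suc (Suc m)) (Suc p) a * cdet t w 0 (Suc m) p a)
     (w (p, q) + max (grid_max w 0 k (Suc p) q + grid_max w 0 (k - 1) p (Suc q))
        (grid_max w 0 (k - 1) (Suc p) q + grid_max w 0 k p (Suc q)))"
  proof (rule asymp_pow_cong)
    fix t :: real assume "1 \<le> t"
    then have "cdet t w 0 (Suc (Suc m)) (Suc p) a \<noteq> 0" using asymp_pow_pos[OF rho] by force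
    from cdet_pure[OF a(1) this] a(3)
    show "t ^ w (p, q) *
      (cdet t w 0 (Suc (Suc m)) (Suc p) (a - 1) * cdet t w 0 (Suc m) p (Suc a)
       + cdet t w 0 (Suc m) (Suc p) a * cdet t w 0 (Suc (Suc m)) p a)
       = cdet t w 0 (Suc (Suc m)) (Suc p) a * cdet t w 0 (Suc m) p a"
      by (simp only: a(3))
  qed
  then show ?thesis using asymp_pow_mult[OF rho mu] asymp_pow_unique by blast
qed

lemma grid_max_mixed:
  assumes w: "\<And>r c. r < n \<Longrightarrow> w (r, c) = 0" and n: "Suc q * Suc q \<le> n" "n \<le> p" and k: "1 \<le> k" "k \<le> q"
  shows "grid_max w 0 k (Suc p) (Suc q) + grid_max w 1 k p (Suc q) =
    max (grid_max w 1 k (Suc p) (Suc q) + grid_max w 0 k p (Suc q))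
        (grid_max w 0 (Suc k) (Suc p) (Suc q) + grid_max w 1 (k - 1) p (Suc q))"
proof -
  obtain m where m: "k = Suc m" using k by (cases k) auto
  define a where "a = Suc q - k"
  have a: "1 \<le> a" "a + Suc m = Suc q" "Suc a + m = Suc q" "a - 1 + Suc (Suc m) = Suc q"
    using k m by (auto simp: a_def)
  have le: "j * c \<le> n" if "j \<le> Suc q" "c \<le> Suc q" for j c
    using mult_le_mono[OF that] n(1) by linarith
  have asy: "asymp_pow (\<lambda>t. cdet t w d j p' b) (grid_max w d j p' (b + j))" if "n \<le> p'" "b + j \<le> Suc q" "d \<le> b" for d j p' b
    using w le[of j "b + j"] that by (intro asymp_cdet[where n = n]) auto
  have rho: "asymp_pow (\<lambda>t. cdet t w 0 (Suc m) (Suc p) a) (grid_max w 0 k (Suc p) (Suc q))"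
    using asy[of "Suc p" a "Suc m" 0] n(2) a m by simp
  have mu: "asymp_pow (\<lambda>t. cdet t w 1 (Suc m) p a) (grid_max w 1 k p (Suc q))"
    using asy[of p a "Suc m" 1] n(2) a m by simp
  have n1: "asymp_pow (\<lambda>t. cdet t w 1 (Suc m) (Suc p) a) (grid_max w 1 k (Suc p) (Suc q))"
    using asy[of "Suc p" a "Suc m" 1] n(2) a m by simp
  have n2: "asymp_pow (\<lambda>t. cdet t w 0 (Suc m) p a) (grid_max w 0 k p (Suc q))"
    using asy[of p a "Suc m" 0] n(2) a m by simp
  have rho': "asymp_pow (\<lambda>t. cdet t w 0 (Suc (Suc m)) (Suc p) (a - 1)) (grid_max w 0 (Suc k) (Suc p) (Suc q))"
    using asy[of "Suc p" "a - 1" "Suc (Suc m)" 0] n(2) a m by simp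
  have mu': "asymp_pow (\<lambda>t. cdet t w 1 m p (Suc a)) (grid_max w 1 (k - 1) p (Suc q))"
    using asy[of p "Suc a" m 1] n(2) a m by simp
  have "asymp_pow (\<lambda>t. cdet t w 1 (Suc m) (Suc p) a * cdet t w 0 (Suc m) p a
    + cdet t w 0 (Suc (Suc m)) (Suc p) (a - 1) * cdet t w 1 m p (Suc a))
    (max (grid_max w 1 k (Suc p) (Suc q) + grid_max w 0 k p (Suc q))
        (grid_max w 0 (Suc k) (Suc p) (Suc q) + grid_max w 1 (k - 1) p (Suc q)))"
    by (intro asymp_pow_mult asymp_pow_add n1 n2 rho' mu')
  then have "asymp_pow (\<lambda>t. cdet t w 0 (Suc m) (Suc p) a * cdet t w 1 (Suc m) p a)
    (max (grid_max w 1 k (Suc p) (Suc q) + grid_max w 0 k p (Suc q))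
        (grid_max w 0 (Suc k) (Suc p) (Suc q) + grid_max w 1 (k - 1) p (Suc q)))"
  proof (rule asymp_pow_cong)
    fix t :: real assume "1 \<le> t"
    then have "cdet t w 0 (Suc m) (Suc p) a \<noteq> 0" using asymp_pow_pos[OF rho] by force
    from cdet_mixed[OF a(1) this]
    show "cdet t w 1 (Suc m) (Suc p) a * cdet t w 0 (Suc m) p a
      + cdet t w 0 (Suc (Suc m)) (Suc p) (a - 1) * cdet t w 1 m p (Suc a)
      = cdet t w 0 (Suc m) (Suc p) a * cdet t w 1 (Suc m) p a" by (rule sym)
  qed
  then show ?thesis using asymp_pow_mult[OF rho mu] asymp_pow_unique by blast
qed

section \<open>Grids ordered by keys\<close>

text \<open>Cells outside the image carry no weight, so intersecting chains with the image loses
  nothing. This serves both to embed a keyed grid into a padded one and to discard the vertices on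
  which a filling is extended by zero.\<close>

lemma cover_max_transfer:
  assumes inj: "inj_on h A" and Q: "\<And>x y. x \<in> A \<Longrightarrow> y \<in> A \<Longrightarrow> Q x y \<longleftrightarrow> Q' (h x) (h y)"
    and w: "\<And>x. x \<in> A \<Longrightarrow> w (h x) = f x" and sub: "h ` A \<subseteq> A'"
    and zero: "\<And>y. y \<in> A' \<Longrightarrow> y \<notin> h ` A \<Longrightarrow> w y = 0" and fin: "finite A'"
  shows "cover_max Q (\<lambda>_. A) f k = cover_max Q' (\<lambda>_. A') w k"
proof (rule antisym)
  have finA: "finite A" using inj sub fin by (meson finite_imageD finite_subset)
  show "cover_max Q (\<lambda>_. A) f k \<le> cover_max Q' (\<lambda>_. A') w k"
  proof (rule cover_max_mono)
    fix U assume U: "covered Q (\<lambda>_. A) k U"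
    then obtain K where K: "\<And>t. t < k \<Longrightarrow> clique Q (K t) \<and> K t \<subseteq> A" "U = (\<Union>t<k. K t)"
      by (elim coveredE) (rule that; simp)
    have "clique Q' (h ` K t) \<and> h ` K t \<subseteq> A'" if "t < k" for t
    proof -
      have "K t \<subseteq> A" "clique Q (K t)" using K(1)[OF that] by auto
      then show ?thesis using sub Q unfolding clique_def by blast
    qed
    then have "covered Q' (\<lambda>_. A') k (\<Union>t<k. h ` K t)" by (intro coveredI) auto
    moreover have "(\<Union>t<k. h ` K t) = h ` U" unfolding K(2) by blast
    moreover have "U \<subseteq> A" using covered_subset[OF U] by (auto split: if_splits)
    then have "sum f U = sum w (h ` U)"
      using inj w by (subst sum.reindex) (auto intro!: sum.cong intro: inj_on_subset)
    ultimately show "\<exists>U'. covered Q' (\<lambda>_. A') k U' \<and> sum f U \<le> sum w U'" by auto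
  qed (use fin finA in auto)
  show "cover_max Q' (\<lambda>_. A') w k \<le> cover_max Q (\<lambda>_. A) f k"
  proof (rule cover_max_mono)
    fix U assume U: "covered Q' (\<lambda>_. A') k U"
    then obtain K where K: "\<And>t. t < k \<Longrightarrow> clique Q' (K t) \<and> K t \<subseteq> A'" "U = (\<Union>t<k. K t)"
      by (elim coveredE) (rule that; simp)
    have "clique Q (A \<inter> h -` K t)" if "t < k" for t
      using K(1)[OF that] Q unfolding clique_def by blast
    then have "covered Q (\<lambda>_. A) k (\<Union>t<k. A \<inter> h -` K t)" by (intro coveredI) auto
    moreover have "(\<Union>t<k. A \<inter> h -` K t) = A \<inter> h -` U" unfolding K(2) by blast
    moreover have "sum w U = sum f (A \<inter> h -` U)"
    proof -
      have UA: "U \<subseteq> A'" using covered_subset[OF U] by (auto split: if_splits)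
      have "sum w U = sum w (h ` (A \<inter> h -` U))"
        using UA zero fin by (intro sum.mono_neutral_right) (auto intro: finite_subset)
      also have "\<dots> = sum f (A \<inter> h -` U)"
        using inj w by (subst sum.reindex) (auto intro!: sum.cong intro: inj_on_subset)
      finally show ?thesis .
    qed
    ultimately show "\<exists>U'. covered Q (\<lambda>_. A) k U' \<and> sum w U \<le> sum f U'" by auto
  qed (use fin finA in auto)
qed

definition key_comparable :: "(nat \<Rightarrow> int) \<Rightarrow> (nat \<Rightarrow> int) \<Rightarrow> nat \<times> nat \<Rightarrow> nat \<times> nat \<Rightarrow> bool" where
  "key_comparable \<alpha> \<beta> x y \<longleftrightarrow>
     (\<alpha> (fst x) \<le> \<alpha> (fst y) \<and> \<beta> (snd x) \<le> \<beta> (snd y)) \<or> (\<alpha> (fst y) \<le> \<alpha> (fst x) \<and> \<beta> (snd y) \<le> \<beta> (snd x))"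

definition cells :: "nat \<Rightarrow> nat \<Rightarrow> (nat \<times> nat) set" where
  "cells u v = {1..u} \<times> {1..v}"

definition cells_max :: "(nat \<Rightarrow> int) \<Rightarrow> (nat \<Rightarrow> int) \<Rightarrow> (nat \<times> nat \<Rightarrow> nat) \<Rightarrow> nat \<Rightarrow> nat \<Rightarrow> nat \<Rightarrow> nat" where
  "cells_max \<alpha> \<beta> f u v k = cover_max (key_comparable \<alpha> \<beta>) (\<lambda>_. cells u v) f k"

definition key_last :: "(nat \<Rightarrow> int) \<Rightarrow> nat \<Rightarrow> bool" where
  "key_last \<alpha> u \<longleftrightarrow> (\<forall>i. 1 \<le> i \<longrightarrow> i < u \<longrightarrow> \<alpha> i < \<alpha> u)"

definition key_first :: "(nat \<Rightarrow> int) \<Rightarrow> nat \<Rightarrow> bool" where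
  "key_first \<alpha> u \<longleftrightarrow> (\<forall>i. 1 \<le> i \<longrightarrow> i < u \<longrightarrow> \<alpha> u < \<alpha> i)"

definition key_rank :: "(nat \<Rightarrow> int) \<Rightarrow> nat \<Rightarrow> nat \<Rightarrow> nat" where
  "key_rank \<alpha> u i = card {i' \<in> {1..u}. \<alpha> i' < \<alpha> i}"

lemma key_rank_less:
  assumes "i \<in> {1..u}" "\<alpha> i < \<alpha> i'"
  shows "key_rank \<alpha> u i < key_rank \<alpha> u i'"
  unfolding key_rank_def using assms by (intro psubset_card_mono) auto

lemma key_rank_le_iff:
  assumes "i \<in> {1..u}" "i' \<in> {1..u}"
  shows "key_rank \<alpha> u i \<le> key_rank \<alpha> u i' \<longleftrightarrow> \<alpha> i \<le> \<alpha> i'"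
proof
  assume "key_rank \<alpha> u i \<le> key_rank \<alpha> u i'"
  then show "\<alpha> i \<le> \<alpha> i'" using key_rank_less[OF assms(2), of \<alpha> i] by force
next
  assume "\<alpha> i \<le> \<alpha> i'"
  then show "key_rank \<alpha> u i \<le> key_rank \<alpha> u i'"
    unfolding key_rank_def by (intro card_mono) auto
qed

lemma key_rank_inj:
  assumes "inj_on \<alpha> {1..u}"
  shows "inj_on (key_rank \<alpha> u) {1..u}"
proof (rule inj_onI)
  fix i i' assume i: "i \<in> {1..u}" "i' \<in> {1..u}" "key_rank \<alpha> u i = key_rank \<alpha> u i'"
  then have "\<alpha> i \<le> \<alpha> i'" "\<alpha> i' \<le> \<alpha> i" using key_rank_le_iff[of i u i' \<alpha>] key_rank_le_iff[of i' u i \<alpha>] by auto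
  then have "\<alpha> i = \<alpha> i'" by simp
  then show "i = i'" using inj_onD[OF assms _ i(1,2)] by blast
qed

lemma key_rank_bound:
  assumes "i \<in> {1..u}"
  shows "key_rank \<alpha> u i < u"
proof -
  have "key_rank \<alpha> u i \<le> card ({1..u} - {i})" unfolding key_rank_def by (intro card_mono) auto
  then have "key_rank \<alpha> u i \<le> u - 1" using assms by simp
  then show ?thesis using assms unfolding atLeastAtMost_iff by linarith
qed

lemma key_rank_last:
  assumes "key_last \<alpha> u"
  shows "key_rank \<alpha> u u = u - 1"
proof -
  have "{i' \<in> {1..u}. \<alpha> i' < \<alpha> u} = {1..<u}"
    using assms by (auto simp: key_last_def le_less)
  then show ?thesis by (simp add: key_rank_def)
qed

lemma key_rank_first:
  assumes "key_first \<alpha> u"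
  shows "key_rank \<alpha> u u = 0"
proof -
  have "{i' \<in> {1..u}. \<alpha> i' < \<alpha> u} = {}"
    using assms by (auto simp: key_first_def le_less)
  then show ?thesis unfolding key_rank_def by (simp only: card.empty)
qed

text \<open>The first \<^term>\<open>n\<close> rows and \<^term>\<open>m\<close> columns are weightless padding, which makes the minors positive.\<close>

definition key_pos :: "(nat \<Rightarrow> int) \<Rightarrow> (nat \<Rightarrow> int) \<Rightarrow> nat \<Rightarrow> nat \<Rightarrow> nat \<Rightarrow> nat \<Rightarrow> nat \<times> nat \<Rightarrow> nat \<times> nat" where
  "key_pos \<alpha> \<beta> u v n m x = (n + key_rank \<alpha> u (fst x), m + key_rank \<beta> v (snd x))"

definition key_weight :: "(nat \<Rightarrow> int) \<Rightarrow> (nat \<Rightarrow> int) \<Rightarrow> nat \<Rightarrow> nat \<Rightarrow> nat \<Rightarrow> nat \<Rightarrow> (nat \<times> nat \<Rightarrow> nat) \<Rightarrow> nat \<times> nat \<Rightarrow> nat" where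
  "key_weight \<alpha> \<beta> u v n m f y = (if y \<in> key_pos \<alpha> \<beta> u v n m ` cells u v
     then f (the_inv_into (cells u v) (key_pos \<alpha> \<beta> u v n m) y) else 0)"

lemma key_pos_inj:
  assumes "inj_on \<alpha> {1..u}" "inj_on \<beta> {1..v}"
  shows "inj_on (key_pos \<alpha> \<beta> u v n m) (cells u v)"
proof (rule inj_onI)
  fix x y assume "x \<in> cells u v" "y \<in> cells u v" "key_pos \<alpha> \<beta> u v n m x = key_pos \<alpha> \<beta> u v n m y"
  then show "x = y"
    using inj_onD[OF key_rank_inj[OF assms(1)], of "fst x" "fst y"] inj_onD[OF key_rank_inj[OF assms(2)], of "snd x" "snd y"]
    by (auto simp: key_pos_def cells_def prod_eq_iff)
qed

lemma key_weight_below: "r < n \<Longrightarrow> key_weight \<alpha> \<beta> u v n m f (r, c) = 0"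
  by (auto simp: key_weight_def key_pos_def)

lemma key_weight_pos:
  assumes "inj_on \<alpha> {1..u}" "inj_on \<beta> {1..v}" "x \<in> cells u v"
  shows "key_weight \<alpha> \<beta> u v n m f (key_pos \<alpha> \<beta> u v n m x) = f x"
  using assms(3) key_pos_inj[OF assms(1,2)] by (simp add: key_weight_def the_inv_into_f_f)

text \<open>All four shapes of a local rule are read off one embedding of the \<open>u\<close> by
  \<open>v\<close> grid; the last two hypotheses say that the bounds \<open>p\<close>,
  \<open>c\<close> and \<open>d\<close> cut out the smaller rectangle.\<close>

lemma cells_max_eq_grid_max:
  fixes \<alpha> \<beta> :: "nat \<Rightarrow> int"
  assumes \<alpha>: "inj_on \<alpha> {1..u}" and \<beta>: "inj_on \<beta> {1..v}" and le: "u' \<le> u" "v' \<le> v"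
    and p: "\<And>i. i \<in> {1..u} \<Longrightarrow> n + key_rank \<alpha> u i < p \<longleftrightarrow> i \<le> u'"
    and c: "\<And>j. j \<in> {1..v} \<Longrightarrow> m + key_rank \<beta> v j \<in> {d..<c} \<longleftrightarrow> j \<le> v'"
  shows "cells_max \<alpha> \<beta> f u' v' k = grid_max (key_weight \<alpha> \<beta> u v n m f) d k p c"
  unfolding cells_max_def
proof (rule cover_max_transfer)
  let ?h = "key_pos \<alpha> \<beta> u v n m"
  have sub: "cells u' v' \<subseteq> cells u v" using le by (auto simp: cells_def)
  have mem: "?h x \<in> rect d p c \<longleftrightarrow> x \<in> cells u' v'" if "x \<in> cells u v" for x
    using that p[of "fst x"] c[of "snd x"] by (cases x) (auto simp: rect_def key_pos_def cells_def)
  show "inj_on ?h (cells u' v')" using key_pos_inj[OF \<alpha> \<beta>] sub by (rule inj_on_subset)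
  show "key_comparable \<alpha> \<beta> x y \<longleftrightarrow> comparable (?h x) (?h y)" if "x \<in> cells u' v'" "y \<in> cells u' v'" for x y
    using subsetD[OF sub that(1)] subsetD[OF sub that(2)]
    by (auto simp: key_comparable_def comparable_def key_pos_def cells_def key_rank_le_iff)
  show "key_weight \<alpha> \<beta> u v n m f (?h x) = f x" if "x \<in> cells u' v'" for x
    using key_weight_pos[OF \<alpha> \<beta> subsetD[OF sub that]] .
  show "?h ` cells u' v' \<subseteq> rect d p c" using mem sub by auto
  show "key_weight \<alpha> \<beta> u v n m f y = 0" if "y \<in> rect d p c" "y \<notin> ?h ` cells u' v'" for y
  proof -
    have "y \<notin> ?h ` cells u v" using that mem by auto
    then show ?thesis by (simp add: key_weight_def)
  qed
qed simp

lemma key_rank_lt_iff_last: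
  assumes "inj_on \<alpha> {1..u}" "key_last \<alpha> u" "i \<in> {1..u}"
  shows "key_rank \<alpha> u i < u - 1 \<longleftrightarrow> i \<le> u - 1"
proof -
  have u: "u \<in> {1..u}" using assms(3) by auto
  have "key_rank \<alpha> u i = u - 1 \<longleftrightarrow> i = u"
    using key_rank_last[OF assms(2)] inj_onD[OF key_rank_inj[OF assms(1)], of i u] assms(3) u by auto
  then show ?thesis using key_rank_bound[OF assms(3), of \<alpha>] assms(3) by auto
qed

lemma key_rank_pos_iff_first:
  assumes "inj_on \<alpha> {1..u}" "key_first \<alpha> u" "i \<in> {1..u}"
  shows "1 \<le> key_rank \<alpha> u i \<longleftrightarrow> i \<le> u - 1"
proof -
  have u: "u \<in> {1..u}" using assms(3) by auto
  have "key_rank \<alpha> u i = 0 \<longleftrightarrow> i = u"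
    using key_rank_first[OF assms(2)] inj_onD[OF key_rank_inj[OF assms(1)], of i u] assms(3) u by auto
  then show ?thesis using assms(3) by auto
qed

lemma cells_max_last_last:
  assumes \<alpha>: "inj_on \<alpha> {1..u}" "key_last \<alpha> u" and \<beta>: "inj_on \<beta> {1..v}" "key_last \<beta> v"
    and uv: "1 \<le> u" "1 \<le> v" and k: "1 \<le> k"
  shows "cells_max \<alpha> \<beta> f u v k + cells_max \<alpha> \<beta> f (u - 1) (v - 1) (k - 1) = f (u, v) +
    max (cells_max \<alpha> \<beta> f u (v - 1) k + cells_max \<alpha> \<beta> f (u - 1) v (k - 1))
        (cells_max \<alpha> \<beta> f u (v - 1) (k - 1) + cells_max \<alpha> \<beta> f (u - 1) v k)"
proof -
  \<comment> \<open>The \<open>k\<close> weightless columns in front guarantee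
    \<open>k \<le> q\<close> even if \<open>v\<close> is small; \<open>n\<close> is the number of
    weightless rows demanded by \<open>grid_max_pure\<close>, and \<open>(p, q)\<close> is the
    position of the corner.\<close>
  define q where "q = k + v - 1"
  define n where "n = Suc q * Suc q"
  define p where "p = n + u - 1"
  define w where "w = key_weight \<alpha> \<beta> u v n k f"
  note G = cells_max_eq_grid_max[OF \<alpha>(1) \<beta>(1), where n = n and m = k and f = f, folded w_def]
  have row: "n + key_rank \<alpha> u i < Suc p" "n + key_rank \<alpha> u i < p \<longleftrightarrow> i \<le> u - 1" if "i \<in> {1..u}" for i
    using key_rank_bound[OF that, of \<alpha>] key_rank_lt_iff_last[OF \<alpha> that] that by (auto simp: p_def)
  have col: "k + key_rank \<beta> v j < Suc q" "k + key_rank \<beta> v j < q \<longleftrightarrow> j \<le> v - 1" if "j \<in> {1..v}" for j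
    using key_rank_bound[OF that, of \<beta>] key_rank_lt_iff_last[OF \<beta> that] that by (auto simp: q_def)
  have G1: "cells_max \<alpha> \<beta> f u v l = grid_max w 0 l (Suc p) (Suc q)" for l
    using row(1) col(1) by (intro G) auto
  have G2: "cells_max \<alpha> \<beta> f (u - 1) v l = grid_max w 0 l p (Suc q)" for l
    using row(2) col(1) by (intro G) auto
  have G3: "cells_max \<alpha> \<beta> f u (v - 1) l = grid_max w 0 l (Suc p) q" for l
    using row(1) col(2) by (intro G) auto
  have G4: "cells_max \<alpha> \<beta> f (u - 1) (v - 1) l = grid_max w 0 l p q" for l
    using row(2) col(2) by (intro G) auto
  have "n + key_rank \<alpha> u u = p" "k + key_rank \<beta> v v = q"
    using key_rank_last[OF \<alpha>(2)] key_rank_last[OF \<beta>(2)] uv by (auto simp: p_def q_def)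
  then have "w (p, q) = f (u, v)"
    using key_weight_pos[OF \<alpha>(1) \<beta>(1), of "(u, v)" n k f] uv by (simp add: w_def key_pos_def cells_def)
  moreover have "n \<le> p" "k \<le> q" using uv by (auto simp: p_def q_def)
  ultimately show ?thesis
    unfolding G1 G2 G3 G4 using grid_max_pure[of n w q p k] k by (simp add: n_def w_def key_weight_below)
qed

lemma cells_max_last_first:
  assumes \<alpha>: "inj_on \<alpha> {1..u}" "key_last \<alpha> u" and \<beta>: "inj_on \<beta> {1..v}" "key_first \<beta> v"
    and uv: "1 \<le> u" "1 \<le> v" and k: "1 \<le> k"
  shows "cells_max \<alpha> \<beta> f u v k + cells_max \<alpha> \<beta> f (u - 1) (v - 1) k =
    max (cells_max \<alpha> \<beta> f u (v - 1) k + cells_max \<alpha> \<beta> f (u - 1) v k)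
        (cells_max \<alpha> \<beta> f u v (Suc k) + cells_max \<alpha> \<beta> f (u - 1) (v - 1) (k - 1))"
proof -
  \<comment> \<open>Column \<open>v\<close> has rank 0 and has to be the one removed by the offset
    1, so nothing may be inserted before it: the \<open>k\<close> weightless columns stand on the
    right.\<close>
  define q where "q = k + v - 1"
  define n where "n = Suc q * Suc q"
  define p where "p = n + u - 1"
  define w where "w = key_weight \<alpha> \<beta> u v n 0 f"
  note G = cells_max_eq_grid_max[OF \<alpha>(1) \<beta>(1), where n = n and m = 0 and f = f, folded w_def]
  have row: "n + key_rank \<alpha> u i < Suc p" "n + key_rank \<alpha> u i < p \<longleftrightarrow> i \<le> u - 1" if "i \<in> {1..u}" for i
    using key_rank_bound[OF that, of \<alpha>] key_rank_lt_iff_last[OF \<alpha> that] that by (auto simp: p_def)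
  have col: "key_rank \<beta> v j < Suc q" "1 \<le> key_rank \<beta> v j \<longleftrightarrow> j \<le> v - 1" if "j \<in> {1..v}" for j
    using key_rank_bound[OF that, of \<beta>] key_rank_pos_iff_first[OF \<beta> that] that k by (auto simp: q_def)
  have G1: "cells_max \<alpha> \<beta> f u v l = grid_max w 0 l (Suc p) (Suc q)" for l
    using row(1) col(1) by (intro G) auto
  have G2: "cells_max \<alpha> \<beta> f (u - 1) v l = grid_max w 0 l p (Suc q)" for l
    using row(2) col(1) by (intro G) auto
  have G3: "cells_max \<alpha> \<beta> f u (v - 1) l = grid_max w 1 l (Suc p) (Suc q)" for l
    using row(1) col by (intro G) auto
  have G4: "cells_max \<alpha> \<beta> f (u - 1) (v - 1) l = grid_max w 1 l p (Suc q)" for l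
    using row(2) col by (intro G) auto
  have "n \<le> p" "k \<le> q" using uv by (auto simp: p_def q_def)
  then show ?thesis
    unfolding G1 G2 G3 G4 using grid_max_mixed[of n w q p k] k by (simp add: n_def w_def key_weight_below)
qed

text \<open>Reversing both orders keeps the chains. This reduces a row and a column that both come
  first to the case where both come last, and one mixed case to the other.\<close>

lemma cells_max_negate: "cells_max (\<lambda>i. - \<alpha> i) (\<lambda>j. - \<beta> j) = cells_max \<alpha> \<beta>"
proof -
  have "key_comparable (\<lambda>i. - \<alpha> i) (\<lambda>j. - \<beta> j) = key_comparable \<alpha> \<beta>"
    by (intro ext) (auto simp: key_comparable_def)
  then show ?thesis by (intro ext) (simp add: cells_max_def)
qed

text \<open>The rows, or else the columns, are \<open>min u v\<close> chains that cover every
  cell.\<close>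

lemma cells_max_total:
  assumes "min u v \<le> k"
  shows "cells_max \<alpha> \<beta> f u v k = sum f (cells u v)"
proof (rule antisym)
  have fin: "finite (cells u v)" by (simp add: cells_def)
  show "cells_max \<alpha> \<beta> f u v k \<le> sum f (cells u v)"
    unfolding cells_max_def
  proof (rule cover_max_le)
    fix U assume "covered (key_comparable \<alpha> \<beta>) (\<lambda>_. cells u v) k U"
    from covered_subset[OF this] show "sum f U \<le> sum f (cells u v)"
      using fin by (intro sum_mono2) (auto split: if_splits)
  qed (rule fin)
  have "covered (key_comparable \<alpha> \<beta>) (\<lambda>_. cells u v) k (cells u v)"
  proof (cases "u \<le> v")
    case True
    then have "u \<le> k" using assms by simp
    have "cells u v \<subseteq> (\<Union>t<k. cells u v \<inter> {x. fst x = Suc t})"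
    proof
      fix x assume x: "x \<in> cells u v"
      then have "fst x - 1 < k" "fst x = Suc (fst x - 1)" using \<open>u \<le> k\<close> by (auto simp: cells_def)
      then show "x \<in> (\<Union>t<k. cells u v \<inter> {x. fst x = Suc t})" using x by blast
    qed
    then have "cells u v = (\<Union>t<k. cells u v \<inter> {x. fst x = Suc t})" by blast
    moreover have "covered (key_comparable \<alpha> \<beta>) (\<lambda>_. cells u v) k (\<Union>t<k. cells u v \<inter> {x. fst x = Suc t})"
      by (intro coveredI) (auto simp: clique_def key_comparable_def)
    ultimately show ?thesis by simp
  next
    case False
    then have "v \<le> k" using assms by simp
    have "cells u v \<subseteq> (\<Union>t<k. cells u v \<inter> {x. snd x = Suc t})"
    proof
      fix x assume x: "x \<in> cells u v"
      then have "snd x - 1 < k" "snd x = Suc (snd x - 1)" using \<open>v \<le> k\<close> by (auto simp: cells_def)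
      then show "x \<in> (\<Union>t<k. cells u v \<inter> {x. snd x = Suc t})" using x by blast
    qed
    then have "cells u v = (\<Union>t<k. cells u v \<inter> {x. snd x = Suc t})" by blast
    moreover have "covered (key_comparable \<alpha> \<beta>) (\<lambda>_. cells u v) k (\<Union>t<k. cells u v \<inter> {x. snd x = Suc t})"
      by (intro coveredI) (auto simp: clique_def key_comparable_def)
    ultimately show ?thesis by simp
  qed
  then show "sum f (cells u v) \<le> cells_max \<alpha> \<beta> f u v k"
    unfolding cells_max_def by (intro cover_max_ge fin)
qed

lemma cells_max_mono: "cells_max \<alpha> \<beta> f u v k \<le> cells_max \<alpha> \<beta> f u v (Suc k)"
  unfolding cells_max_def
proof (rule cover_max_mono)
  fix U assume "covered (key_comparable \<alpha> \<beta>) (\<lambda>_. cells u v) k U"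
  then have "covered (key_comparable \<alpha> \<beta>) (\<lambda>_. cells u v) (Suc k) U"
    unfolding covered_Suc by (intro exI[of _ U] exI[of _ "{}"]) auto
  then show "\<exists>U'. covered (key_comparable \<alpha> \<beta>) (\<lambda>_. cells u v) (Suc k) U' \<and> sum f U \<le> sum f U'" by blast
qed (auto simp: cells_def)

lemma cells_max_cong:
  assumes "\<And>x. x \<in> cells u v \<Longrightarrow> f x = g x"
  shows "cells_max \<alpha> \<beta> f u v k = cells_max \<alpha> \<beta> g u v k"
  unfolding cells_max_def using assms
  by (intro cover_max_transfer[where h = id]) (auto simp: cells_def)

section \<open>The local rules on interlacing sequences\<close>

definition psum :: "(nat \<Rightarrow> nat) \<Rightarrow> nat \<Rightarrow> nat" where
  "psum \<mu> k = (\<Sum>l\<in>{1..k}. \<mu> l)"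

lemma psum_0 [simp]: "psum \<mu> 0 = 0"
  by (simp add: psum_def)

lemma psum_Suc [simp]: "psum \<mu> (Suc k) = psum \<mu> k + \<mu> (Suc k)"
  by (simp add: psum_def)

lemma psum_inject:
  assumes "\<And>k. psum \<mu> k = psum \<nu> k" "1 \<le> k"
  shows "\<mu> k = \<nu> k"
  using assms(1)[of k] assms(1)[of "k - 1"] assms(2) by (cases k) auto

text \<open>For partitions: the skew shape \<nu> / \<mu> is a horizontal strip.\<close>

definition interlaces :: "(nat \<Rightarrow> nat) \<Rightarrow> (nat \<Rightarrow> nat) \<Rightarrow> bool" where
  "interlaces \<mu> \<nu> \<longleftrightarrow> (\<forall>k\<ge>1. \<mu> k \<le> \<nu> k \<and> \<nu> (Suc k) \<le> \<mu> k)"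

lemma interlacesD: "interlaces \<mu> \<nu> \<Longrightarrow> 1 \<le> k \<Longrightarrow> \<mu> k \<le> \<nu> k" "interlaces \<mu> \<nu> \<Longrightarrow> 1 \<le> k \<Longrightarrow> \<nu> (Suc k) \<le> \<mu> k"
  unfolding interlaces_def by auto

definition pure_rule :: "(nat \<Rightarrow> nat) \<Rightarrow> (nat \<Rightarrow> nat) \<Rightarrow> (nat \<Rightarrow> nat) \<Rightarrow> (nat \<Rightarrow> nat) \<Rightarrow> nat \<Rightarrow> bool" where
  "pure_rule \<mu> \<nu>1 \<nu>2 \<rho> w \<longleftrightarrow> (\<forall>k\<ge>1. psum \<rho> k + psum \<mu> (k - 1) =
     w + max (psum \<nu>1 k + psum \<nu>2 (k - 1)) (psum \<nu>1 (k - 1) + psum \<nu>2 k))"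

text \<open>The recurrence itself does not involve \<open>w\<close>, which enters through the
  balance of total weights at \<open>r\<close>. In the application \<open>r\<close> is the shorter
  side of the rectangle, where all partial sums have reached their totals.\<close>

definition mixed_rule :: "nat \<Rightarrow> (nat \<Rightarrow> nat) \<Rightarrow> (nat \<Rightarrow> nat) \<Rightarrow> (nat \<Rightarrow> nat) \<Rightarrow> (nat \<Rightarrow> nat) \<Rightarrow> nat \<Rightarrow> bool" where
  "mixed_rule r \<mu> \<nu>1 \<nu>2 \<rho> w \<longleftrightarrow> (\<forall>k\<ge>1. psum \<rho> k + psum \<mu> k =
     max (psum \<nu>1 k + psum \<nu>2 k) (psum \<rho> (Suc k) + psum \<mu> (k - 1))) \<and>
     psum \<rho> r + psum \<mu> r = w + psum \<nu>1 r + psum \<nu>2 r"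

lemma mixed_ruleD:
  "mixed_rule r \<mu> \<nu>1 \<nu>2 \<rho> w \<Longrightarrow> psum \<rho> (Suc k) + psum \<mu> (Suc k) =
     max (psum \<nu>1 (Suc k) + psum \<nu>2 (Suc k)) (psum \<rho> (Suc (Suc k)) + psum \<mu> k)"
  unfolding mixed_rule_def by (elim conjE allE[of _ "Suc k"]) (simp del: psum_Suc)

text \<open>Subtracting consecutive equations leaves an entrywise rule, the toggle:
  \<open>\<rho> (Suc k)\<close> and \<open>\<mu> k\<close> are mirror images in the interval that
  interlacing allows.\<close>

lemma pure_rule_iff:
  "pure_rule \<mu> \<nu>1 \<nu>2 \<rho> w \<longleftrightarrow> \<rho> 1 = w + max (\<nu>1 1) (\<nu>2 1) \<and>
     (\<forall>k\<ge>1. \<rho> (Suc k) + \<mu> k = max (\<nu>1 (Suc k)) (\<nu>2 (Suc k)) + min (\<nu>1 k) (\<nu>2 k))"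
  (is "?L \<longleftrightarrow> ?R")
proof
  assume L: ?L
  have at: "psum \<rho> (Suc k) + psum \<mu> k =
     w + max (psum \<nu>1 (Suc k) + psum \<nu>2 k) (psum \<nu>1 k + psum \<nu>2 (Suc k))" for k
    using L[unfolded pure_rule_def, rule_format, of "Suc k"] by simp
  have "\<rho> (Suc k) + \<mu> k = max (\<nu>1 (Suc k)) (\<nu>2 (Suc k)) + min (\<nu>1 k) (\<nu>2 k)" if "1 \<le> k" for k
  proof -
    obtain j where "k = Suc j" using \<open>1 \<le> k\<close> by (cases k) auto
    then show ?thesis using at[of k] at[of j] by (auto simp: max_def min_def split: if_splits)
  qed
  then show ?R using at[of 0] by simp
next
  assume R: ?R
  have "psum \<rho> (Suc k) + psum \<mu> k =
     w + max (psum \<nu>1 (Suc k) + psum \<nu>2 k) (psum \<nu>1 k + psum \<nu>2 (Suc k))" for k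
  proof (induction k)
    case (Suc k)
    have "\<rho> (Suc (Suc k)) + \<mu> (Suc k) = max (\<nu>1 (Suc (Suc k))) (\<nu>2 (Suc (Suc k))) + min (\<nu>1 (Suc k)) (\<nu>2 (Suc k))"
      using R by simp
    then show ?case using Suc by (auto simp: max_def min_def split: if_splits)
  qed (use R in simp)
  then show ?L unfolding pure_rule_def by (metis Suc_diff_1 less_eq_Suc_le One_nat_def)
qed

lemma pure_rule_forward:
  assumes R: "pure_rule \<mu> \<nu>1 \<nu>2 \<rho> w" and I: "interlaces \<mu> \<nu>1" "interlaces \<mu> \<nu>2"
  shows "interlaces \<nu>1 \<rho> \<and> interlaces \<nu>2 \<rho>"
proof -
  have 1: "\<rho> 1 = w + max (\<nu>1 1) (\<nu>2 1)"
    and 2: "\<And>k. 1 \<le> k \<Longrightarrow> \<rho> (Suc k) + \<mu> k = max (\<nu>1 (Suc k)) (\<nu>2 (Suc k)) + min (\<nu>1 k) (\<nu>2 k)"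
    using R unfolding pure_rule_iff by auto
  have "\<nu>1 k \<le> \<rho> k \<and> \<nu>2 k \<le> \<rho> k \<and> \<rho> (Suc k) \<le> \<nu>1 k \<and> \<rho> (Suc k) \<le> \<nu>2 k" if k: "1 \<le> k" for k
  proof -
    have "\<nu>1 k \<le> \<rho> k \<and> \<nu>2 k \<le> \<rho> k"
    proof (cases "k = 1")
      case False
      then obtain j where j: "k = Suc j" "1 \<le> j" using k by (cases k) auto
      show ?thesis using 2[OF j(2)] interlacesD(1)[OF I(1) j(2)] interlacesD(1)[OF I(2) j(2)] j(1)
        by (auto simp: max_def min_def split: if_splits)
    qed (use 1 in \<open>simp add: max_def\<close>)
    moreover have "\<rho> (Suc k) \<le> min (\<nu>1 k) (\<nu>2 k)"
      using 2[OF k] interlacesD(2)[OF I(1) k] interlacesD(2)[OF I(2) k] by (auto simp: max_def split: if_splits)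
    ultimately show ?thesis by simp
  qed
  then show ?thesis unfolding interlaces_def by blast
qed

lemma pure_rule_unique_out:
  assumes "pure_rule \<mu> \<nu>1 \<nu>2 \<rho> w" "pure_rule \<mu> \<nu>1 \<nu>2 \<rho>' w" "1 \<le> k"
  shows "\<rho> k = \<rho>' k"
proof (cases "k = 1")
  case False
  then obtain j where j: "k = Suc j" "1 \<le> j" using assms(3) by (cases k) auto
  have "\<rho> (Suc j) + \<mu> j = \<rho>' (Suc j) + \<mu> j" using assms(1,2) j(2) unfolding pure_rule_iff by metis
  then show ?thesis using j by simp
qed (use assms in \<open>auto simp: pure_rule_iff\<close>)

lemma pure_rule_unique_in:
  assumes "pure_rule \<mu> \<nu>1 \<nu>2 \<rho> w" "pure_rule \<mu>' \<nu>1 \<nu>2 \<rho> w'"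
  shows "w = w' \<and> (\<forall>k\<ge>1. \<mu> k = \<mu>' k)"
  using assms unfolding pure_rule_iff by (metis add_left_cancel add_right_cancel)

text \<open>The last support hypothesis reflects that one of the two neighbouring rectangles has a
  side shorter than \<open>r\<close>; it makes \<open>\<mu>\<close> vanish from \<open>r\<close>
  on.\<close>

lemma pure_rule_backward:
  assumes I: "interlaces \<nu>1 \<rho>" "interlaces \<nu>2 \<rho>" and r: "1 \<le> r"
    and supp: "\<And>k. r < k \<Longrightarrow> \<nu>1 k = 0" "\<And>k. r < k \<Longrightarrow> \<nu>2 k = 0" "\<nu>1 r = 0 \<or> \<nu>2 r = 0"
  shows "\<exists>\<mu> w. pure_rule \<mu> \<nu>1 \<nu>2 \<rho> w \<and> interlaces \<mu> \<nu>1 \<and> interlaces \<mu> \<nu>2 \<and> (\<forall>k\<ge>r. \<mu> k = 0)"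
proof -
  define \<mu> where "\<mu> k = max (\<nu>1 (Suc k)) (\<nu>2 (Suc k)) + min (\<nu>1 k) (\<nu>2 k) - \<rho> (Suc k)" for k
  have le: "max (\<nu>1 k) (\<nu>2 k) \<le> \<rho> k" "\<rho> (Suc k) \<le> min (\<nu>1 k) (\<nu>2 k)" if "1 \<le> k" for k
    using I that by (auto simp: interlaces_def)
  have "pure_rule \<mu> \<nu>1 \<nu>2 \<rho> (\<rho> 1 - max (\<nu>1 1) (\<nu>2 1))"
    unfolding pure_rule_iff
  proof (intro conjI allI impI)
    fix k :: nat assume "1 \<le> k"
    then show "\<rho> (Suc k) + \<mu> k = max (\<nu>1 (Suc k)) (\<nu>2 (Suc k)) + min (\<nu>1 k) (\<nu>2 k)"
      using le(2)[of k] unfolding \<mu>_def by linarith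
  qed (use le(1)[of 1] in simp)
  moreover have "max (\<nu>1 (Suc k)) (\<nu>2 (Suc k)) \<le> \<mu> k \<and> \<mu> k \<le> min (\<nu>1 k) (\<nu>2 k)" if "1 \<le> k" for k
    using le(2)[OF that] le(1)[of "Suc k"] by (auto simp: \<mu>_def)
  then have "interlaces \<mu> \<nu>1" "interlaces \<mu> \<nu>2" by (auto simp: interlaces_def)
  moreover have "\<mu> k = 0" if "r \<le> k" for k
    using that supp le(2)[of k] r by (cases "k = r") (auto simp: \<mu>_def)
  ultimately show ?thesis by blast
qed

text \<open>The second argument of the maximum gives \<open>\<rho> (Suc k) \<le> \<mu> k\<close> at
  once; the lower bounds on \<open>\<rho>\<close> come from comparing consecutive equations.\<close>

lemma mixed_rule_forward:
  assumes R: "mixed_rule r \<mu> \<nu>1 \<nu>2 \<rho> w" and I: "interlaces \<mu> \<nu>1" "interlaces \<mu> \<nu>2"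
  shows "interlaces \<nu>1 \<rho> \<and> interlaces \<nu>2 \<rho>"
proof -
  have at: "psum \<rho> (Suc j) + psum \<mu> (Suc j) =
     max (psum \<nu>1 (Suc j) + psum \<nu>2 (Suc j)) (psum \<rho> (Suc (Suc j)) + psum \<mu> j)" for j
    by (rule mixed_ruleD[OF R])
  have "\<nu>1 k \<le> \<rho> k \<and> \<nu>2 k \<le> \<rho> k \<and> \<rho> (Suc k) \<le> \<nu>1 k \<and> \<rho> (Suc k) \<le> \<nu>2 k" if k: "1 \<le> k" for k
  proof -
    obtain j where j: "k = Suc j" using k by (cases k) auto
    note m = interlacesD(1)[OF I(1) k] interlacesD(1)[OF I(2) k]
    have "\<rho> (Suc k) \<le> \<mu> k" using at[of j] j by (auto simp: max_def split: if_splits)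
    moreover have "\<nu>1 k \<le> \<rho> k \<and> \<nu>2 k \<le> \<rho> k"
    proof (cases j)
      case 0
      then show ?thesis using at[of 0] m j by (auto simp: max_def split: if_splits)
    next
      case (Suc i)
      have "\<nu>1 k \<le> \<mu> j" "\<nu>2 k \<le> \<mu> j" using interlacesD(2)[OF I(1), of j] interlacesD(2)[OF I(2), of j] j Suc by auto
      then show ?thesis using at[of j] at[of i] m j Suc by (auto simp: max_def split: if_splits)
    qed
    ultimately show ?thesis using m by simp
  qed
  then show ?thesis unfolding interlaces_def by blast
qed

lemma psum_const: "(\<And>k. r < k \<Longrightarrow> \<rho> k = 0) \<Longrightarrow> r \<le> k \<Longrightarrow> psum \<rho> k = psum \<rho> r"
  by (induction k) (auto simp: le_Suc_eq)

text \<open>The equation for \<open>k\<close> expresses the partial sum of \<open>\<rho>\<close> at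
  \<open>k\<close> through the one at \<open>Suc k\<close>, so the recursion runs downwards from the
  total, which \<open>w\<close> fixes.\<close>

lemma mixed_rule_unique_out:
  assumes R: "mixed_rule r \<mu> \<nu>1 \<nu>2 \<rho> w" "mixed_rule r \<mu> \<nu>1 \<nu>2 \<rho>' w"
    and supp: "\<And>k. r < k \<Longrightarrow> \<rho> k = 0" "\<And>k. r < k \<Longrightarrow> \<rho>' k = 0" and k: "1 \<le> k"
  shows "\<rho> k = \<rho>' k"
proof -
  have top: "psum \<rho> r = psum \<rho>' r" using R by (auto simp: mixed_rule_def)
  have low: "psum \<rho> k = psum \<rho>' k" if "k \<le> r" for k
    using that
  proof (induction k rule: inc_induct)
    case (step n)
    show ?case
    proof (cases n)
      case (Suc j)
      show ?thesis
        using mixed_ruleD[OF R(1), of j] mixed_ruleD[OF R(2), of j] step.IH unfolding Suc by (simp del: psum_Suc)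
    qed simp
  qed (rule top)
  have "psum \<rho> k = psum \<rho>' k" for k
  proof (cases "k \<le> r")
    case False
    then have "psum \<rho> k = psum \<rho> r" "psum \<rho>' k = psum \<rho>' r" using supp by (auto intro!: psum_const)
    then show ?thesis using top by simp
  qed (rule low)
  then show ?thesis using k by (rule psum_inject)
qed

text \<open>Read for \<open>\<mu>\<close>, the same equations run upwards from the empty
  sum.\<close>

lemma mixed_rule_unique_in:
  assumes R: "mixed_rule r \<mu> \<nu>1 \<nu>2 \<rho> w" "mixed_rule r \<mu>' \<nu>1 \<nu>2 \<rho> w'"
  shows "w = w' \<and> (\<forall>k\<ge>1. \<mu> k = \<mu>' k)"
proof -
  have eq: "psum \<mu> k = psum \<mu>' k" for k
  proof (induction k)
    case (Suc k)
    show ?case using mixed_ruleD[OF R(1), of k] mixed_ruleD[OF R(2), of k] Suc by (simp del: psum_Suc)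
  qed simp
  have "w = w'" using R eq[of r] by (auto simp: mixed_rule_def)
  then show ?thesis using psum_inject[of \<mu> \<mu>'] eq by blast
qed

lemma mixed_rule_backward:
  assumes I: "interlaces \<nu>1 \<rho>" "interlaces \<nu>2 \<rho>" and r: "1 \<le> r"
    and supp: "\<And>k. r < k \<Longrightarrow> \<nu>1 k = 0" "\<And>k. r < k \<Longrightarrow> \<nu>2 k = 0" "\<nu>1 r = 0 \<or> \<nu>2 r = 0" "\<And>k. r < k \<Longrightarrow> \<rho> k = 0"
  shows "\<exists>\<mu> w. mixed_rule r \<mu> \<nu>1 \<nu>2 \<rho> w \<and> interlaces \<mu> \<nu>1 \<and> interlaces \<mu> \<nu>2 \<and> (\<forall>k\<ge>r. \<mu> k = 0)"
proof -
  let ?A = "\<lambda>k. int (psum \<nu>1 k + psum \<nu>2 k)" and ?R = "\<lambda>k. int (psum \<rho> k)"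
  \<comment> \<open>The partial sums of \<open>\<mu>\<close>, obtained by solving the recurrence for
    them; integers are needed as the first argument of the maximum may be negative.\<close>
  define m :: "nat \<Rightarrow> int" where
    "m = rec_nat 0 (\<lambda>k x. max (?A (Suc k) - ?R (Suc k)) (int (\<rho> (Suc (Suc k))) + x))"
  have m0: "m 0 = 0" and mS: "m (Suc k) = max (?A (Suc k) - ?R (Suc k)) (int (\<rho> (Suc (Suc k))) + m k)" for k
    by (simp_all add: m_def)
  define \<mu> where "\<mu> k = nat (m k - m (k - 1))" for k
  have mu: "int (\<mu> (Suc k)) = m (Suc k) - m k" for k
  proof -
    have "m k \<le> m (Suc k)" unfolding mS by (simp add: le_max_iff_disj)
    then show ?thesis by (simp add: \<mu>_def)
  qed
  have ps: "int (psum \<mu> k) = m k" for k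
    by (induction k) (auto simp: m0 mu)
  have low: "?A k - ?R k \<le> m k" for k
    by (cases k) (auto simp: m0 mS)
  have ge: "\<nu>1 k \<le> \<rho> k" "\<nu>2 k \<le> \<rho> k" "\<rho> (Suc k) \<le> \<nu>1 k" "\<rho> (Suc k) \<le> \<nu>2 k" if "1 \<le> k" for k
    using I that by (auto simp: interlaces_def)
  have lower: "\<rho> (Suc (Suc k)) \<le> \<mu> (Suc k)" for k
    using mu[of k] unfolding mS by linarith
  have upper: "\<mu> (Suc k) \<le> \<nu>1 (Suc k) \<and> \<mu> (Suc k) \<le> \<nu>2 (Suc k)" for k
    using mu[of k] low[of k] ge[of "Suc k"] unfolding mS by (auto simp: max_def split: if_splits)
  have zero: "\<mu> k = 0" if "r \<le> k" for k
  proof -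
    obtain j where j: "k = Suc j" using \<open>r \<le> k\<close> r by (cases k) auto
    have "\<nu>1 k + \<nu>2 k \<le> \<rho> k"
      using supp(1,2)[of k] supp(3) ge[of k] that r by (cases "k = r") auto
    moreover have "\<rho> (Suc k) = 0" using supp(4) that by simp
    ultimately have "m (Suc j) = m j"
      using low[of j] j unfolding mS by (auto simp: max_def)
    then show ?thesis using j by (simp add: \<mu>_def)
  qed
  \<comment> \<open>The weight is the surplus of the totals at \<open>r\<close>, which is
    nonnegative by \<open>low\<close>.\<close>
  have "mixed_rule r \<mu> \<nu>1 \<nu>2 \<rho> (nat (?R r + m r - ?A r))"
    unfolding mixed_rule_def
  proof (intro conjI allI impI)
    fix k :: nat assume "1 \<le> k"
    then obtain j where j: "k = Suc j" by (cases k) auto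
    have "int (psum \<rho> k + psum \<mu> k) = int (max (psum \<nu>1 k + psum \<nu>2 k) (psum \<rho> (Suc k) + psum \<mu> (k - 1)))"
      unfolding of_nat_add of_nat_max ps j mS by (auto simp: max_def ps)
    then show "psum \<rho> k + psum \<mu> k = max (psum \<nu>1 k + psum \<nu>2 k) (psum \<rho> (Suc k) + psum \<mu> (k - 1))"
      by (simp only: of_nat_eq_iff)
  next
    have "int (psum \<rho> r + psum \<mu> r) = int (nat (?R r + m r - ?A r) + psum \<nu>1 r + psum \<nu>2 r)"
      using low[of r] by (simp add: ps)
    then show "psum \<rho> r + psum \<mu> r = nat (?R r + m r - ?A r) + psum \<nu>1 r + psum \<nu>2 r"
      by (simp only: of_nat_eq_iff)
  qed
  moreover have "interlaces \<mu> \<nu>1 \<and> interlaces \<mu> \<nu>2"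
  proof -
    have "\<mu> k \<le> \<nu>1 k \<and> \<mu> k \<le> \<nu>2 k \<and> \<nu>1 (Suc k) \<le> \<mu> k \<and> \<nu>2 (Suc k) \<le> \<mu> k" if "1 \<le> k" for k
    proof -
      obtain j where "k = Suc j" using \<open>1 \<le> k\<close> by (cases k) auto
      then show ?thesis using lower[of j] upper[of j] ge[of "Suc k"] by auto
    qed
    then show ?thesis by (auto simp: interlaces_def)
  qed
  ultimately show ?thesis using zero by blast
qed

section \<open>Reverse plane partitions near a corner\<close>

definition downset :: "(nat \<times> nat) set \<Rightarrow> bool" where
  "downset L \<longleftrightarrow> finite L \<and> (\<forall>(i, j)\<in>L. 1 \<le> i \<and> 1 \<le> j \<and> cells i j \<subseteq> L)"

lemma downsetD:
  assumes "downset L" "(i, j) \<in> L"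
  shows "1 \<le> i" "1 \<le> j" "1 \<le> i' \<Longrightarrow> i' \<le> i \<Longrightarrow> 1 \<le> j' \<Longrightarrow> j' \<le> j \<Longrightarrow> (i', j') \<in> L"
  using assms unfolding downset_def cells_def by fastforce+

text \<open>Only neighbouring cells are compared, so that every condition relates two adjacent
  diagonals; on a diagram of a partition this amounts to monotonicity in the full order.\<close>

definition weakly_inc :: "(nat \<times> nat) set \<Rightarrow> (nat \<times> nat \<Rightarrow> nat) \<Rightarrow> bool" where
  "weakly_inc L g \<longleftrightarrow> (\<forall>i j. (i, j) \<in> L \<longrightarrow>
     ((Suc i, j) \<in> L \<longrightarrow> g (i, j) \<le> g (Suc i, j)) \<and> ((i, Suc j) \<in> L \<longrightarrow> g (i, j) \<le> g (i, Suc j)))"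

lemma weakly_incI:
  assumes "\<And>i j. (i, j) \<in> L \<Longrightarrow> (Suc i, j) \<in> L \<Longrightarrow> g (i, j) \<le> g (Suc i, j)"
    and "\<And>i j. (i, j) \<in> L \<Longrightarrow> (i, Suc j) \<in> L \<Longrightarrow> g (i, j) \<le> g (i, Suc j)"
  shows "weakly_inc L g"
  using assms unfolding weakly_inc_def by blast

lemma weakly_incD:
  assumes "weakly_inc L g"
  shows "(i, j) \<in> L \<Longrightarrow> (Suc i, j) \<in> L \<Longrightarrow> g (i, j) \<le> g (Suc i, j)"
    and "(i, j) \<in> L \<Longrightarrow> (i, Suc j) \<in> L \<Longrightarrow> g (i, j) \<le> g (i, Suc j)"
  using assms unfolding weakly_inc_def by blast+

text \<open>The entries of \<^term>\<open>g\<close> on the diagonal ending at \<open>(u, v)\<close>, read upwards and padded by zeros.\<close>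

definition diag_seq :: "(nat \<times> nat \<Rightarrow> nat) \<Rightarrow> nat \<Rightarrow> nat \<Rightarrow> nat \<Rightarrow> nat" where
  "diag_seq g u v k = (if 1 \<le> k \<and> k \<le> u \<and> k \<le> v then g (Suc u - k, Suc v - k) else 0)"

lemma diag_seq_cell:
  assumes "i + v = j + u" "1 \<le> i" "i \<le> u" "1 \<le> j" "k = Suc u - i"
  shows "diag_seq g u v k = g (i, j)"
proof -
  have "Suc u - k = i" "Suc v - k = j" "1 \<le> k" "k \<le> u" "k \<le> v" using assms by auto
  then show ?thesis by (simp add: diag_seq_def)
qed

lemma diag_seq_at:
  assumes "1 \<le> k" "k \<le> u" "k \<le> v" "a + k = Suc u" "b + k = Suc v"
  shows "diag_seq g u v k = g (a, b)"
proof -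
  have "Suc u - k = a" "Suc v - k = b" using assms by auto
  then show ?thesis using assms by (simp add: diag_seq_def)
qed

definition is_corner :: "(nat \<times> nat) set \<Rightarrow> nat \<Rightarrow> nat \<Rightarrow> bool" where
  "is_corner L u v \<longleftrightarrow> (u, v) \<in> L \<and> (\<forall>i j. (i, j) \<in> L \<longrightarrow> u \<le> i \<longrightarrow> v \<le> j \<longrightarrow> i = u \<and> j = v)"

lemma corner_cell:
  assumes "is_corner L u v" "(i, j) \<in> L" "u \<le> i" "v \<le> j"
  shows "i = u" "j = v"
  using assms unfolding is_corner_def by auto

definition off_diag :: "(nat \<times> nat) set \<Rightarrow> nat \<Rightarrow> nat \<Rightarrow> (nat \<times> nat) set" where
  "off_diag L u v = {(i, j) \<in> L. i + v \<noteq> j + u}"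

context
  fixes L u v
  assumes L: "downset L" and c: "is_corner L u v"
begin

lemma corner_pos: "1 \<le> u" "1 \<le> v"
  using c downsetD(1,2)[OF L] by (auto simp: is_corner_def)

lemma corner_below: "1 \<le> i \<Longrightarrow> i \<le> u \<Longrightarrow> 1 \<le> j \<Longrightarrow> j \<le> v \<Longrightarrow> (i, j) \<in> L"
  using c downsetD(3)[OF L] by (auto simp: is_corner_def)

text \<open>The diagonal of the corner ends in \<open>(u, v)\<close>, and its neighbours end in
  \<open>(u, v - 1)\<close> and \<open>(u - 1, v)\<close>. The inequalities that touch it are
  exactly the two interlacings.\<close>

lemma weakly_inc_corner_iff:
  "weakly_inc L g \<longleftrightarrow> weakly_inc (off_diag L u v) g \<and>
     interlaces (diag_seq g u (v - 1)) (diag_seq g u v) \<and> interlaces (diag_seq g (u - 1) v) (diag_seq g u v)"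
  (is "?L \<longleftrightarrow> ?O \<and> ?I1 \<and> ?I2")
proof (intro iffI conjI)
  assume W: ?L
  show ?O by (rule weakly_incI; rule weakly_incD[OF W]) (auto simp: off_diag_def)
  show ?I1 unfolding interlaces_def
  proof (intro allI impI conjI)
    fix k :: nat assume k: "1 \<le> k"
    show "diag_seq g u (v - 1) k \<le> diag_seq g u v k"
    proof (cases "k \<le> u \<and> k \<le> v - 1")
      case True
      have "g (Suc u - k, v - k) \<le> g (Suc u - k, Suc (v - k))"
        using True k by (intro weakly_incD[OF W] corner_below) auto
      moreover have "diag_seq g u (v - 1) k = g (Suc u - k, v - k)" by (rule diag_seq_at) (use True k in auto)
      moreover have "diag_seq g u v k = g (Suc u - k, Suc (v - k))" by (rule diag_seq_at) (use True k in auto)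
      ultimately show ?thesis by simp
    qed (auto simp: diag_seq_def)
    show "diag_seq g u v (Suc k) \<le> diag_seq g u (v - 1) k"
    proof (cases "Suc k \<le> u \<and> Suc k \<le> v")
      case True
      have "g (u - k, v - k) \<le> g (Suc (u - k), v - k)"
        using True k by (intro weakly_incD[OF W] corner_below) auto
      moreover have "diag_seq g u v (Suc k) = g (u - k, v - k)" by (rule diag_seq_at) (use True k in auto)
      moreover have "diag_seq g u (v - 1) k = g (Suc (u - k), v - k)" by (rule diag_seq_at) (use True k in auto)
      ultimately show ?thesis by simp
    qed (auto simp: diag_seq_def)
  qed
  show ?I2 unfolding interlaces_def
  proof (intro allI impI conjI)
    fix k :: nat assume k: "1 \<le> k"
    show "diag_seq g (u - 1) v k \<le> diag_seq g u v k"
    proof (cases "k \<le> u - 1 \<and> k \<le> v")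
      case True
      have "g (u - k, Suc v - k) \<le> g (Suc (u - k), Suc v - k)"
        using True k by (intro weakly_incD[OF W] corner_below) auto
      moreover have "diag_seq g (u - 1) v k = g (u - k, Suc v - k)" by (rule diag_seq_at) (use True k in auto)
      moreover have "diag_seq g u v k = g (Suc (u - k), Suc v - k)" by (rule diag_seq_at) (use True k in auto)
      ultimately show ?thesis by simp
    qed (auto simp: diag_seq_def)
    show "diag_seq g u v (Suc k) \<le> diag_seq g (u - 1) v k"
    proof (cases "Suc k \<le> u \<and> Suc k \<le> v")
      case True
      have "g (u - k, v - k) \<le> g (u - k, Suc (v - k))"
        using True k by (intro weakly_incD[OF W] corner_below) auto
      moreover have "diag_seq g u v (Suc k) = g (u - k, v - k)" by (rule diag_seq_at) (use True k in auto)
      moreover have "diag_seq g (u - 1) v k = g (u - k, Suc (v - k))" by (rule diag_seq_at) (use True k in auto)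
      ultimately show ?thesis by simp
    qed (auto simp: diag_seq_def)
  qed
next
  assume "?O \<and> ?I1 \<and> ?I2"
  then have O: ?O and I1: ?I1 and I2: ?I2 by auto
  show ?L
  proof (rule weakly_incI)
    fix i j assume ij: "(i, j) \<in> L" "(Suc i, j) \<in> L"
    note pos = downsetD(1,2)[OF L ij(1)]
    consider (x) "i + v = j + u" | (y) "Suc i + v = j + u" | (o) "i + v \<noteq> j + u" "Suc i + v \<noteq> j + u" by blast
    then show "g (i, j) \<le> g (Suc i, j)"
    proof cases
      case x
      then have "i < u" using corner_cell[OF c ij(2)] by (cases "i < u") auto
      then have "diag_seq g u v (Suc (u - i)) = g (i, j)" "diag_seq g u (v - 1) (u - i) = g (Suc i, j)"
        using x pos by (auto intro!: diag_seq_cell)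
      then show ?thesis using interlacesD(2)[OF I1, of "u - i"] \<open>i < u\<close> by simp
    next
      case y
      then have "i < u" using corner_cell[OF c ij(2)] by (cases "i < u") auto
      then have "diag_seq g u v (u - i) = g (Suc i, j)" "diag_seq g (u - 1) v (u - i) = g (i, j)"
        using y pos by (auto intro!: diag_seq_cell)
      then show ?thesis using interlacesD(1)[OF I2, of "u - i"] \<open>i < u\<close> by simp
    next
      case o
      then show ?thesis using ij by (intro weakly_incD[OF O]) (auto simp: off_diag_def)
    qed
  next
    fix i j assume ij: "(i, j) \<in> L" "(i, Suc j) \<in> L"
    note pos = downsetD(1,2)[OF L ij(1)]
    consider (x) "i + v = j + u" | (y) "i + v = Suc j + u" | (o) "i + v \<noteq> j + u" "i + v \<noteq> Suc j + u" by blast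
    then show "g (i, j) \<le> g (i, Suc j)"
    proof cases
      case x
      then have "i < u" using corner_cell[OF c ij(2)] by (cases "i < u") auto
      then have "diag_seq g u v (Suc (u - i)) = g (i, j)" "diag_seq g (u - 1) v (u - i) = g (i, Suc j)"
        using x pos by (auto intro!: diag_seq_cell)
      then show ?thesis using interlacesD(2)[OF I2, of "u - i"] \<open>i < u\<close> by simp
    next
      case y
      then have "i \<le> u" using corner_cell[OF c ij(2)] by (cases "i \<le> u") auto
      then have "diag_seq g u v (Suc u - i) = g (i, Suc j)" "diag_seq g u (v - 1) (Suc u - i) = g (i, j)"
        using y pos by (auto intro!: diag_seq_cell)
      then show ?thesis using interlacesD(1)[OF I1, of "Suc u - i"] \<open>i \<le> u\<close> by simp
    next
      case o
      then show ?thesis using ij by (intro weakly_incD[OF O]) (auto simp: off_diag_def)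
    qed
  qed
qed

text \<open>Without the corner the shortened diagonal interlaces below its neighbours instead of
  above them. The condition away from it is the same as for the full diagram, which links the
  two.\<close>

lemma weakly_inc_remove_corner_iff:
  "weakly_inc (L - {(u, v)}) g \<longleftrightarrow> weakly_inc (off_diag L u v) g \<and>
     interlaces (diag_seq g (u - 1) (v - 1)) (diag_seq g u (v - 1)) \<and>
     interlaces (diag_seq g (u - 1) (v - 1)) (diag_seq g (u - 1) v)"
  (is "?L \<longleftrightarrow> ?O \<and> ?I1 \<and> ?I2")
proof (intro iffI conjI)
  assume W: ?L
  show ?O by (rule weakly_incI; rule weakly_incD[OF W]) (auto simp: off_diag_def)
  have below: "(i, j) \<in> L - {(u, v)}" if "1 \<le> i" "i \<le> u" "1 \<le> j" "j \<le> v" "i < u \<or> j < v" for i j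
    using corner_below[OF that(1-4)] that(5) by auto
  show ?I1 unfolding interlaces_def
  proof (intro allI impI conjI)
    fix k :: nat assume k: "1 \<le> k"
    show "diag_seq g (u - 1) (v - 1) k \<le> diag_seq g u (v - 1) k"
    proof (cases "k \<le> u - 1 \<and> k \<le> v - 1")
      case True
      have "g (u - k, v - k) \<le> g (Suc (u - k), v - k)"
        using True k by (intro weakly_incD[OF W] below) auto
      moreover have "diag_seq g (u - 1) (v - 1) k = g (u - k, v - k)" by (rule diag_seq_at) (use True k in auto)
      moreover have "diag_seq g u (v - 1) k = g (Suc (u - k), v - k)" by (rule diag_seq_at) (use True k in auto)
      ultimately show ?thesis by simp
    qed (auto simp: diag_seq_def)
    show "diag_seq g u (v - 1) (Suc k) \<le> diag_seq g (u - 1) (v - 1) k"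
    proof (cases "Suc k \<le> u \<and> Suc k \<le> v - 1")
      case True
      have "g (u - k, v - Suc k) \<le> g (u - k, Suc (v - Suc k))"
        using True k by (intro weakly_incD[OF W] below) auto
      moreover have "diag_seq g u (v - 1) (Suc k) = g (u - k, v - Suc k)" by (rule diag_seq_at) (use True k in auto)
      moreover have "diag_seq g (u - 1) (v - 1) k = g (u - k, Suc (v - Suc k))" by (rule diag_seq_at) (use True k in auto)
      ultimately show ?thesis by simp
    qed (auto simp: diag_seq_def)
  qed
  show ?I2 unfolding interlaces_def
  proof (intro allI impI conjI)
    fix k :: nat assume k: "1 \<le> k"
    show "diag_seq g (u - 1) (v - 1) k \<le> diag_seq g (u - 1) v k"
    proof (cases "k \<le> u - 1 \<and> k \<le> v - 1")
      case True
      have "g (u - k, v - k) \<le> g (u - k, Suc (v - k))"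
        using True k by (intro weakly_incD[OF W] below) auto
      moreover have "diag_seq g (u - 1) (v - 1) k = g (u - k, v - k)" by (rule diag_seq_at) (use True k in auto)
      moreover have "diag_seq g (u - 1) v k = g (u - k, Suc (v - k))" by (rule diag_seq_at) (use True k in auto)
      ultimately show ?thesis by simp
    qed (auto simp: diag_seq_def)
    show "diag_seq g (u - 1) v (Suc k) \<le> diag_seq g (u - 1) (v - 1) k"
    proof (cases "Suc k \<le> u - 1 \<and> Suc k \<le> v")
      case True
      have "g (u - Suc k, v - k) \<le> g (Suc (u - Suc k), v - k)"
        using True k by (intro weakly_incD[OF W] below) auto
      moreover have "diag_seq g (u - 1) v (Suc k) = g (u - Suc k, v - k)" by (rule diag_seq_at) (use True k in auto)
      moreover have "diag_seq g (u - 1) (v - 1) k = g (Suc (u - Suc k), v - k)" by (rule diag_seq_at) (use True k in auto)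
      ultimately show ?thesis by simp
    qed (auto simp: diag_seq_def)
  qed
next
  assume "?O \<and> ?I1 \<and> ?I2"
  then have O: ?O and I1: ?I1 and I2: ?I2 by auto
  show ?L
  proof (rule weakly_incI)
    fix i j assume ij: "(i, j) \<in> L - {(u, v)}" "(Suc i, j) \<in> L - {(u, v)}"
    note pos = downsetD(1,2)[OF L, of i j]
    consider (x) "i + v = j + u" | (y) "Suc i + v = j + u" | (o) "i + v \<noteq> j + u" "Suc i + v \<noteq> j + u" by blast
    then show "g (i, j) \<le> g (Suc i, j)"
    proof cases
      case x
      then have "i < u" using corner_cell[OF c, of "Suc i" j] ij by (cases "i < u") auto
      then have "diag_seq g (u - 1) (v - 1) (u - i) = g (i, j)" "diag_seq g u (v - 1) (u - i) = g (Suc i, j)"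
        using x pos ij by (auto intro!: diag_seq_cell)
      then show ?thesis using interlacesD(1)[OF I1, of "u - i"] \<open>i < u\<close> by simp
    next
      case y
      then have "Suc i < u" using corner_cell[OF c, of "Suc i" j] ij by (cases "Suc i < u") auto
      then have "diag_seq g (u - 1) (v - 1) (u - Suc i) = g (Suc i, j)" "diag_seq g (u - 1) v (Suc (u - Suc i)) = g (i, j)"
        using y pos ij by (auto intro!: diag_seq_cell)
      then show ?thesis using interlacesD(2)[OF I2, of "u - Suc i"] \<open>Suc i < u\<close> by simp
    next
      case o
      then show ?thesis using ij by (intro weakly_incD[OF O]) (auto simp: off_diag_def)
    qed
  next
    fix i j assume ij: "(i, j) \<in> L - {(u, v)}" "(i, Suc j) \<in> L - {(u, v)}"
    note pos = downsetD(1,2)[OF L, of i j]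
    consider (x) "i + v = j + u" | (y) "i + v = Suc j + u" | (o) "i + v \<noteq> j + u" "i + v \<noteq> Suc j + u" by blast
    then show "g (i, j) \<le> g (i, Suc j)"
    proof cases
      case x
      then have "i < u" using corner_cell[OF c, of i "Suc j"] ij by (cases "i < u") auto
      then have "diag_seq g (u - 1) (v - 1) (u - i) = g (i, j)" "diag_seq g (u - 1) v (u - i) = g (i, Suc j)"
        using x pos ij by (auto intro!: diag_seq_cell)
      then show ?thesis using interlacesD(1)[OF I2, of "u - i"] \<open>i < u\<close> by simp
    next
      case y
      then have "i < u" using corner_cell[OF c, of i "Suc j"] ij by (cases "i < u") auto
      then have "diag_seq g (u - 1) (v - 1) (u - i) = g (i, Suc j)" "diag_seq g u (v - 1) (Suc (u - i)) = g (i, j)"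
        using y pos ij by (auto intro!: diag_seq_cell)
      then show ?thesis using interlacesD(2)[OF I1, of "u - i"] \<open>i < u\<close> by simp
    next
      case o
      then show ?thesis using ij by (intro weakly_incD[OF O]) (auto simp: off_diag_def)
    qed
  qed
qed

end

section \<open>Growth along a diagram\<close>

definition local_rule :: "bool \<Rightarrow> nat \<Rightarrow> (nat \<Rightarrow> nat) \<Rightarrow> (nat \<Rightarrow> nat) \<Rightarrow> (nat \<Rightarrow> nat) \<Rightarrow> (nat \<Rightarrow> nat) \<Rightarrow> nat \<Rightarrow> bool" where
  "local_rule P r = (if P then pure_rule else mixed_rule r)"

lemma local_rule_forward:
  "local_rule P r \<mu> \<nu>1 \<nu>2 \<rho> w \<Longrightarrow> interlaces \<mu> \<nu>1 \<Longrightarrow> interlaces \<mu> \<nu>2 \<Longrightarrow> interlaces \<nu>1 \<rho> \<and> interlaces \<nu>2 \<rho>"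
  unfolding local_rule_def by (cases P) (auto dest: pure_rule_forward mixed_rule_forward)

lemma local_rule_unique_out:
  assumes "local_rule P r \<mu> \<nu>1 \<nu>2 \<rho> w" "local_rule P r \<mu> \<nu>1 \<nu>2 \<rho>' w"
    and "\<And>k. r < k \<Longrightarrow> \<rho> k = 0" "\<And>k. r < k \<Longrightarrow> \<rho>' k = 0" "1 \<le> k"
  shows "\<rho> k = \<rho>' k"
proof (cases P)
  case True
  then show ?thesis using assms pure_rule_unique_out[of \<mu> \<nu>1 \<nu>2 \<rho> w \<rho>' k] by (simp add: local_rule_def)
next
  case False
  then show ?thesis using assms mixed_rule_unique_out[of r \<mu> \<nu>1 \<nu>2 \<rho> w \<rho>' k] by (simp add: local_rule_def)
qed

lemma local_rule_unique_in:
  assumes "local_rule P r \<mu> \<nu>1 \<nu>2 \<rho> w" "local_rule P r \<mu>' \<nu>1 \<nu>2 \<rho> w'"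
  shows "w = w' \<and> (\<forall>k\<ge>1. \<mu> k = \<mu>' k)"
proof (cases P)
  case True
  then show ?thesis using assms pure_rule_unique_in[of \<mu> \<nu>1 \<nu>2 \<rho> w \<mu>' w'] by (simp add: local_rule_def)
next
  case False
  then show ?thesis using assms mixed_rule_unique_in[of r \<mu> \<nu>1 \<nu>2 \<rho> w \<mu>' w'] by (simp add: local_rule_def)
qed

lemma local_rule_backward:
  assumes "interlaces \<nu>1 \<rho>" "interlaces \<nu>2 \<rho>" "1 \<le> r"
    and "\<And>k. r < k \<Longrightarrow> \<nu>1 k = 0" "\<And>k. r < k \<Longrightarrow> \<nu>2 k = 0" "\<nu>1 r = 0 \<or> \<nu>2 r = 0" "\<And>k. r < k \<Longrightarrow> \<rho> k = 0"
  shows "\<exists>\<mu> w. local_rule P r \<mu> \<nu>1 \<nu>2 \<rho> w \<and> interlaces \<mu> \<nu>1 \<and> interlaces \<mu> \<nu>2 \<and> (\<forall>k\<ge>r. \<mu> k = 0)"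
proof (cases P)
  case True
  then show ?thesis using assms pure_rule_backward[of \<nu>1 \<rho> \<nu>2 r] by (simp add: local_rule_def)
next
  case False
  then show ?thesis using assms mixed_rule_backward[of \<nu>1 \<rho> \<nu>2 r] by (simp add: local_rule_def)
qed

lemma local_rule_cong:
  assumes "local_rule P r \<mu> \<nu>1 \<nu>2 \<rho> w" "\<And>k. 1 \<le> k \<Longrightarrow> \<mu> k = \<mu>' k"
  shows "local_rule P r \<mu>' \<nu>1 \<nu>2 \<rho> w"
proof -
  have "psum \<mu> = psum \<mu>'" using assms(2) by (intro ext) (simp add: psum_def)
  then show ?thesis using assms(1) by (auto simp: local_rule_def pure_rule_def mixed_rule_def)
qed

section \<open>Removal of corners and the growth map\<close>

definition depth :: "(nat \<times> nat) set \<Rightarrow> nat \<Rightarrow> nat \<Rightarrow> nat" where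
  "depth L i j = card {d. (i + d, j + d) \<in> L}"

lemma depth_eq:
  assumes "downset L" "1 \<le> i" "1 \<le> j" "(i + d, j + d) \<in> L" "(Suc (i + d), Suc (j + d)) \<notin> L"
  shows "depth L i j = Suc d"
proof -
  have "e \<le> d" if "(i + e, j + e) \<in> L" for e
  proof (rule ccontr)
    assume "\<not> e \<le> d"
    then have "(Suc (i + d), Suc (j + d)) \<in> L" by (intro downsetD(3)[OF assms(1) that]) auto
    then show False using assms(5) by simp
  qed
  moreover have "(i + e, j + e) \<in> L" if "e \<le> d" for e
    using that assms(2,3) by (intro downsetD(3)[OF assms(1,4)]) auto
  ultimately have "{e. (i + e, j + e) \<in> L} = {..d}" by auto
  then show ?thesis by (simp add: depth_def)
qed

lemma depth_last:
  assumes L: "downset L" and ij: "(i, j) \<in> L"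
  obtains d where "depth L i j = Suc d" "(i + d, j + d) \<in> L" "(Suc (i + d), Suc (j + d)) \<notin> L"
proof -
  have fin: "finite {d. (i + d, j + d) \<in> L}"
  proof (rule finite_subset)
    show "{d. (i + d, j + d) \<in> L} \<subseteq> (\<lambda>x. fst x - i) ` L" by force
    show "finite ((\<lambda>x. fst x - i) ` L)" using L by (simp add: downset_def)
  qed
  define d where "d = Max {d. (i + d, j + d) \<in> L}"
  have "0 \<in> {d. (i + d, j + d) \<in> L}" using ij by simp
  then have "d \<in> {d. (i + d, j + d) \<in> L}" unfolding d_def using Max_in[OF fin] by blast
  moreover have "Suc d \<notin> {d. (i + d, j + d) \<in> L}"
    using Max_ge[OF fin, of "Suc d"] unfolding d_def by auto
  ultimately have "(i + d, j + d) \<in> L" "(Suc (i + d), Suc (j + d)) \<notin> L" by auto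
  then show ?thesis using depth_eq[OF L downsetD(1,2)[OF L ij]] that by blast
qed

lemma cells_subset_downset: "downset L \<Longrightarrow> (i, j) \<in> L \<Longrightarrow> cells i j \<subseteq> L"
  unfolding downset_def by auto

lemma on_diag_cell:
  assumes "downset L" "is_corner L u v" "x \<in> L" "x \<notin> off_diag L u v"
  obtains k where "1 \<le> k" "k \<le> u" "k \<le> v" "x = (Suc u - k, Suc v - k)"
proof -
  obtain i j where x: "x = (i, j)" by (cases x)
  have ij: "(i, j) \<in> L" "i + v = j + u" using assms(3,4) x by (auto simp: off_diag_def)
  have "i \<le> u" using corner_cell[OF assms(2) ij(1)] ij(2) by (cases "i \<le> u") auto
  then show ?thesis using that[of "Suc u - i"] ij(2) downsetD(1,2)[OF assms(1) ij(1)] x by auto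
qed

lemma weakly_inc_cong:
  assumes "\<And>x. x \<in> L \<Longrightarrow> f x = g x"
  shows "weakly_inc L f \<longleftrightarrow> weakly_inc L g"
  using assms unfolding weakly_inc_def by auto

lemma exists_corner:
  assumes "downset L" "L \<noteq> {}"
  obtains u v where "is_corner L u v"
proof -
  have fin: "finite L" using assms(1) by (simp add: downset_def)
  let ?s = "\<lambda>x. fst x + snd x"
  have "Max (?s ` L) \<in> ?s ` L" using fin assms(2) by (intro Max_in) auto
  then obtain u v where uv: "(u, v) \<in> L" "u + v = Max (?s ` L)" by auto
  have "i + j \<le> u + v" if "(i, j) \<in> L" for i j
    unfolding uv(2) using fin that by (intro Max_ge) force+
  then have "is_corner L u v" using uv(1) unfolding is_corner_def by fastforce
  then show ?thesis by (rule that)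
qed

text \<open>Everything that the bijection requires of the shapes, with \<open>P u v\<close>
  selecting the rule at the corner \<open>(u, v)\<close>; keys and quivers stay outside.\<close>

locale growth =
  fixes G :: "(nat \<times> nat \<Rightarrow> nat) \<Rightarrow> nat \<Rightarrow> nat \<Rightarrow> nat \<Rightarrow> nat" and P :: "nat \<Rightarrow> nat \<Rightarrow> bool"
  assumes supp: "k = 0 \<or> u < k \<or> v < k \<Longrightarrow> G f u v k = 0"
    and cong: "(\<And>x. x \<in> cells u v \<Longrightarrow> f x = g x) \<Longrightarrow> G f u v k = G g u v k"
    and rule: "1 \<le> u \<Longrightarrow> 1 \<le> v \<Longrightarrow>
      local_rule (P u v) (min u v) (G f (u - 1) (v - 1)) (G f u (v - 1)) (G f (u - 1) v) (G f u v) (f (u, v))"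
begin

text \<open>All entries of a diagonal belong to one rectangle, the one whose corner ends the
  diagonal, and the index counts from that end.\<close>

definition growth_map :: "(nat \<times> nat) set \<Rightarrow> (nat \<times> nat \<Rightarrow> nat) \<Rightarrow> nat \<times> nat \<Rightarrow> nat" where
  "growth_map L f = (\<lambda>(i, j)\<in>L. G f (i + depth L i j - 1) (j + depth L i j - 1) (depth L i j))"

lemma growth_map_cong:
  assumes L: "downset L" and fg: "\<And>x. x \<in> L \<Longrightarrow> f x = g x"
  shows "growth_map L f = growth_map L g"
  unfolding growth_map_def
proof (rule restrict_ext, clarify)
  fix i j assume ij: "(i, j) \<in> L"
  obtain d where d: "depth L i j = Suc d" "(i + d, j + d) \<in> L" using depth_last[OF L ij] .
  have "G f (i + d) (j + d) (Suc d) = G g (i + d) (j + d) (Suc d)"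
    using cells_subset_downset[OF L d(2)] fg by (intro cong) auto
  then show "G f (i + depth L i j - 1) (j + depth L i j - 1) (depth L i j)
      = G g (i + depth L i j - 1) (j + depth L i j - 1) (depth L i j)" by (simp add: d(1))
qed

lemma diag_seq_growth_map:
  assumes L: "downset L" and uv: "(u, v) \<in> L \<or> u = 0 \<or> v = 0" "(Suc u, Suc v) \<notin> L"
  shows "diag_seq (growth_map L f) u v = G f u v"
proof
  fix k
  show "diag_seq (growth_map L f) u v k = G f u v k"
  proof (cases "1 \<le> k \<and> k \<le> u \<and> k \<le> v")
    case True
    then have uvL: "(u, v) \<in> L" using uv by auto
    have ij: "Suc u - k + (k - 1) = u" "Suc v - k + (k - 1) = v" using True by auto
    have "1 \<le> Suc u - k" "1 \<le> Suc v - k" using True by auto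
    then have dep: "depth L (Suc u - k) (Suc v - k) = k"
      using depth_eq[OF L, of "Suc u - k" "Suc v - k" "k - 1"] True uvL uv(2) ij by simp
    have "(Suc u - k, Suc v - k) \<in> L" using True by (intro downsetD(3)[OF L uvL]) auto
    then show ?thesis using True by (simp add: diag_seq_def growth_map_def dep)
  next
    case False
    then show ?thesis using supp[of k u v f] by (auto simp: diag_seq_def)
  qed
qed

lemma growth_map_corner:
  assumes L: "downset L" and c: "is_corner L u v"
  shows "downset (L - {(u, v)})"
    and "x \<in> off_diag L u v \<Longrightarrow> growth_map (L - {(u, v)}) f x = growth_map L f x"
    and "diag_seq (growth_map L f) u v = G f u v"
    and "diag_seq (growth_map L f) u (v - 1) = G f u (v - 1)"
    and "diag_seq (growth_map L f) (u - 1) v = G f (u - 1) v"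
    and "diag_seq (growth_map (L - {(u, v)}) f) (u - 1) (v - 1) = G f (u - 1) (v - 1)"
    and "diag_seq (growth_map (L - {(u, v)}) f) u (v - 1) = G f u (v - 1)"
    and "diag_seq (growth_map (L - {(u, v)}) f) (u - 1) v = G f (u - 1) v"
proof -
  note pos = corner_pos[OF L c] and below = corner_below[OF L c] and cc = corner_cell[OF c]
  show L': "downset (L - {(u, v)})"
    unfolding downset_def
  proof (intro conjI ballI)
    show "finite (L - {(u, v)})" using L by (simp add: downset_def)
    fix x assume x: "x \<in> L - {(u, v)}"
    obtain i j where xij: "x = (i, j)" by (cases x)
    have ij: "(i, j) \<in> L" "(i, j) \<noteq> (u, v)" using x xij by auto
    have "(u, v) \<notin> cells i j" using cc[OF ij(1)] ij(2) by (auto simp: cells_def)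
    then show "case x of (i, j) \<Rightarrow> 1 \<le> i \<and> 1 \<le> j \<and> cells i j \<subseteq> L - {(u, v)}"
      using downsetD(1,2)[OF L ij(1)] cells_subset_downset[OF L ij(1)] unfolding xij by auto
  qed
  show "growth_map (L - {(u, v)}) f x = growth_map L f x" if x: "x \<in> off_diag L u v"
  proof (cases x)
    case (Pair i j)
    have "depth (L - {(u, v)}) i j = depth L i j"
      unfolding depth_def using x Pair by (intro arg_cong[where f = card]) (auto simp: off_diag_def)
    moreover have "x \<in> L" "x \<noteq> (u, v)" using x Pair by (auto simp: off_diag_def)
    ultimately show ?thesis using Pair by (simp add: growth_map_def)
  qed
  have n1: "(Suc u, v) \<notin> L" "(u, Suc v) \<notin> L" "(Suc u, Suc v) \<notin> L" using cc by fastforce+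
  have S: "Suc (u - 1) = u" "Suc (v - 1) = v" using pos by auto
  have m: "(u, v - 1) \<in> L \<or> u = 0 \<or> v - 1 = 0" "(u - 1, v) \<in> L \<or> u - 1 = 0 \<or> v = 0"
    "(u - 1, v - 1) \<in> L \<or> u - 1 = 0 \<or> v - 1 = 0"
    using below[of u "v - 1"] below[of "u - 1" v] below[of "u - 1" "v - 1"] pos by (cases "u = 1"; cases "v = 1"; force)+
  have ne: "v - 1 \<noteq> v" "u - 1 \<noteq> u" using pos by auto
  show "diag_seq (growth_map L f) u v = G f u v"
    using below pos n1 by (intro diag_seq_growth_map[OF L]) auto
  show "diag_seq (growth_map L f) u (v - 1) = G f u (v - 1)"
    using m n1 S by (intro diag_seq_growth_map[OF L]) auto
  show "diag_seq (growth_map L f) (u - 1) v = G f (u - 1) v"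
    using m n1 S by (intro diag_seq_growth_map[OF L]) auto
  show "diag_seq (growth_map (L - {(u, v)}) f) (u - 1) (v - 1) = G f (u - 1) (v - 1)"
    using m S ne by (intro diag_seq_growth_map[OF L']) auto
  show "diag_seq (growth_map (L - {(u, v)}) f) u (v - 1) = G f u (v - 1)"
    using m n1 S ne by (intro diag_seq_growth_map[OF L']) auto
  show "diag_seq (growth_map (L - {(u, v)}) f) (u - 1) v = G f (u - 1) v"
    using m n1 S ne by (intro diag_seq_growth_map[OF L']) auto
qed

text \<open>Two fillings with equal image share \<open>\<rho>\<close>, \<open>\<nu>1\<close> and
  \<open>\<nu>2\<close>, hence by the local rule also \<open>w\<close> and \<open>\<mu>\<close>, so
  their images on the diagram without the corner agree. For surjectivity the rule is run backwards,
  the resulting \<open>\<mu>\<close> is put on the shortened diagonal, and the smaller diagram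
  supplies the remaining entries of the filling.\<close>

theorem growth_map_bij:
  assumes "downset L"
  shows "bij_betw (growth_map L) (L \<rightarrow>\<^sub>E UNIV) {g \<in> L \<rightarrow>\<^sub>E UNIV. weakly_inc L g}"
  using assms
proof (induction "card L" arbitrary: L)
  case 0
  then have "L = {}" by (simp add: downset_def)
  then show ?case by (auto simp: bij_betw_def growth_map_def weakly_inc_def PiE_empty_domain restrict_def)
next
  case (Suc n)
  note L = Suc.prems
  have "L \<noteq> {}" using Suc.hyps(2) by auto
  then obtain u v where c: "is_corner L u v" using exists_corner[OF L] by blast
  define L' where "L' = L - {(u, v)}"
  note gm = growth_map_corner[OF L c, folded L'_def]
  note winc = weakly_inc_corner_iff[OF L c]
  note winc' = weakly_inc_remove_corner_iff[OF L c, folded L'_def]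
  note pos = corner_pos[OF L c]
  let ?r = "min u v"
  have uvL: "(u, v) \<in> L" using c by (simp add: is_corner_def)
  have off: "off_diag L u v \<subseteq> L'" "off_diag L u v \<subseteq> L" by (auto simp: off_diag_def L'_def)
  have "card L' = n" using Suc.hyps(2) uvL by (simp add: L'_def)
  then have IH: "bij_betw (growth_map L') (L' \<rightarrow>\<^sub>E UNIV) {g \<in> L' \<rightarrow>\<^sub>E UNIV. weakly_inc L' g}"
    using Suc.hyps(1) gm(1) by blast
  have restr: "growth_map L' (restrict f L') = growth_map L' f" for f
    by (rule growth_map_cong[OF gm(1)]) simp
  have ext: "growth_map L f \<in> L \<rightarrow>\<^sub>E UNIV" for f by (simp add: growth_map_def)
  have R: "local_rule (P u v) ?r (G f (u - 1) (v - 1)) (G f u (v - 1)) (G f (u - 1) v) (G f u v) (f (u, v))" for f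
    using rule[OF pos] .
  have into: "weakly_inc L (growth_map L f)" for f
  proof -
    have "growth_map L' (restrict f L') \<in> {g \<in> L' \<rightarrow>\<^sub>E UNIV. weakly_inc L' g}"
      by (rule bij_betwE[OF IH, rule_format]) simp
    then have "weakly_inc L' (growth_map L' f)" by (simp add: restr)
    then have O: "weakly_inc (off_diag L u v) (growth_map L' f)"
      and I: "interlaces (G f (u - 1) (v - 1)) (G f u (v - 1))" "interlaces (G f (u - 1) (v - 1)) (G f (u - 1) v)"
      unfolding winc' gm by auto
    from O have "weakly_inc (off_diag L u v) (growth_map L f)"
      using weakly_inc_cong[of "off_diag L u v" "growth_map L' f" "growth_map L f"] gm(2) by blast
    then show ?thesis unfolding winc gm using local_rule_forward[OF R I] by blast
  qed
  have inj: "inj_on (growth_map L) (L \<rightarrow>\<^sub>E UNIV)"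
  proof (rule inj_onI)
    fix f1 f2 assume f: "f1 \<in> L \<rightarrow>\<^sub>E UNIV" "f2 \<in> L \<rightarrow>\<^sub>E UNIV" "growth_map L f1 = growth_map L f2"
    have eq: "G f1 u v = G f2 u v" "G f1 u (v - 1) = G f2 u (v - 1)" "G f1 (u - 1) v = G f2 (u - 1) v"
      using gm(3-5)[of f1] gm(3-5)[of f2] f(3) by auto
    have in_eq: "f1 (u, v) = f2 (u, v) \<and> (\<forall>k\<ge>1. G f1 (u - 1) (v - 1) k = G f2 (u - 1) (v - 1) k)"
      using R[of f1] R[of f2] unfolding eq by (rule local_rule_unique_in)
    have "growth_map L' f1 x = growth_map L' f2 x" for x
    proof (cases "x \<in> L'")
      case True
      show ?thesis
      proof (cases "x \<in> off_diag L u v")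
        case True
        then show ?thesis using gm(2)[OF True] f(3) by simp
      next
        case False
        have "x \<in> L" using True by (simp add: L'_def)
        then obtain k where k: "1 \<le> k" "k \<le> u" "k \<le> v" "x = (Suc u - k, Suc v - k)"
          using on_diag_cell[OF L c _ False] by blast
        have "k \<noteq> 1" using True k(4) by (auto simp: L'_def)
        then have k1: "1 \<le> k - 1" using k(1) by simp
        have d: "diag_seq h (u - 1) (v - 1) (k - 1) = h x" for h
          unfolding k(4) by (rule diag_seq_at) (use k k1 in auto)
        show ?thesis
          using in_eq k1 d[of "growth_map L' f1"] d[of "growth_map L' f2"] unfolding gm by simp
      qed
    next
      case False
      then show ?thesis by (simp add: growth_map_def)
    qed
    then have "growth_map L' (restrict f1 L') = growth_map L' (restrict f2 L')" unfolding restr by blast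
    then have eq': "restrict f1 L' = restrict f2 L'"
      by (rule inj_onD[OF bij_betw_imp_inj_on[OF IH]]) simp_all
    have "f1 x = f2 x" if "x \<in> L" for x
    proof (cases "x = (u, v)")
      case False
      then have "x \<in> L'" using that by (simp add: L'_def)
      then show ?thesis using fun_cong[OF eq', of x] by simp
    qed (use in_eq in simp)
    then show "f1 = f2" using f(1,2) by (intro PiE_ext) auto
  qed
  have surj: "\<exists>f\<in>L \<rightarrow>\<^sub>E UNIV. growth_map L f = g" if g: "g \<in> L \<rightarrow>\<^sub>E UNIV" "weakly_inc L g" for g
  proof -
    let ?\<rho> = "diag_seq g u v" and ?\<nu>1 = "diag_seq g u (v - 1)" and ?\<nu>2 = "diag_seq g (u - 1) v"
    have O: "weakly_inc (off_diag L u v) g" and I: "interlaces ?\<nu>1 ?\<rho>" "interlaces ?\<nu>2 ?\<rho>"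
      using g(2) unfolding winc by auto
    have "\<exists>\<mu> w. local_rule (P u v) ?r \<mu> ?\<nu>1 ?\<nu>2 ?\<rho> w \<and> interlaces \<mu> ?\<nu>1 \<and> interlaces \<mu> ?\<nu>2 \<and> (\<forall>k\<ge>?r. \<mu> k = 0)"
      by (rule local_rule_backward[OF I]) (use pos in \<open>auto simp: diag_seq_def min_def split: if_splits\<close>)
    then obtain \<mu> w where \<mu>: "local_rule (P u v) ?r \<mu> ?\<nu>1 ?\<nu>2 ?\<rho> w" "interlaces \<mu> ?\<nu>1" "interlaces \<mu> ?\<nu>2"
      "\<And>k. ?r \<le> k \<Longrightarrow> \<mu> k = 0" by blast
    \<comment> \<open>Entry \<open>k\<close> of the diagonal ending in \<open>(u - 1, v - 1)\<close>
      lies in row \<open>u - k\<close>, hence the index \<open>u - fst x\<close>.\<close>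
    define h where "h = (\<lambda>x\<in>L'. if x \<in> off_diag L u v then g x else \<mu> (u - fst x))"
    have h_off: "h x = g x" if "x \<in> off_diag L u v" for x using that off by (auto simp: h_def)
    have h_mu: "diag_seq h (u - 1) (v - 1) k = \<mu> k" if k: "1 \<le> k" for k
    proof (cases "k \<le> u - 1 \<and> k \<le> v - 1")
      case True
      have "(u - k, v - k) \<in> L'" using True k corner_below[OF L c, of "u - k" "v - k"] by (auto simp: L'_def)
      moreover have "(u - k, v - k) \<notin> off_diag L u v" using True by (auto simp: off_diag_def)
      moreover have "diag_seq h (u - 1) (v - 1) k = h (u - k, v - k)"
        by (rule diag_seq_at) (use True k in auto)
      moreover have "u - (u - k) = k" using True by auto
      ultimately show ?thesis by (simp add: h_def)
    next
      case False
      then have "?r \<le> k" using pos by linarith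
      then show ?thesis using \<mu>(4)[of k] False by (auto simp: diag_seq_def)
    qed
    have h_nu: "diag_seq h u (v - 1) = ?\<nu>1" "diag_seq h (u - 1) v = ?\<nu>2"
    proof -
      have "h (Suc u - k, Suc (v - 1) - k) = g (Suc u - k, Suc (v - 1) - k)" if "1 \<le> k" "k \<le> u" "k \<le> v - 1" for k
        by (rule h_off) (use that corner_below[OF L c, of "Suc u - k" "Suc (v - 1) - k"] in \<open>auto simp: off_diag_def\<close>)
      moreover have "h (Suc (u - 1) - k, Suc v - k) = g (Suc (u - 1) - k, Suc v - k)" if "1 \<le> k" "k \<le> u - 1" "k \<le> v" for k
        by (rule h_off) (use that corner_below[OF L c, of "Suc (u - 1) - k" "Suc v - k"] in \<open>auto simp: off_diag_def\<close>)
      ultimately show "diag_seq h u (v - 1) = ?\<nu>1" "diag_seq h (u - 1) v = ?\<nu>2"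
        by (auto simp: diag_seq_def fun_eq_iff)
    qed
    have "weakly_inc L' h"
      unfolding winc' h_nu
      using weakly_inc_cong[of "off_diag L u v" h g] h_off O \<mu>(2,3) h_mu by (auto simp: interlaces_def)
    then have "h \<in> {g \<in> L' \<rightarrow>\<^sub>E UNIV. weakly_inc L' g}" by (simp add: h_def)
    then obtain f' where f': "f' \<in> L' \<rightarrow>\<^sub>E UNIV" "growth_map L' f' = h"
      using bij_betw_imp_surj_on[OF IH] by (metis (no_types, lifting) imageE)
    \<comment> \<open>The smaller diagram does not contain \<open>(u, v)\<close>, so
      \<open>w\<close> can be added afterwards without changing \<open>h\<close>.\<close>
    define f where "f = f'((u, v) := w)"
    have fL: "f \<in> L \<rightarrow>\<^sub>E UNIV" using f'(1) uvL by (auto simp: f_def L'_def PiE_def extensional_def)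
    have fh: "growth_map L' f = h"
      unfolding f'(2)[symmetric] by (rule growth_map_cong[OF gm(1)]) (auto simp: f_def L'_def)
    have nu: "G f u (v - 1) = ?\<nu>1" "G f (u - 1) v = ?\<nu>2" "\<And>k. 1 \<le> k \<Longrightarrow> G f (u - 1) (v - 1) k = \<mu> k"
      using gm(6-8)[of f] h_nu h_mu unfolding fh by auto
    have R': "local_rule (P u v) ?r \<mu> ?\<nu>1 ?\<nu>2 (G f u v) w"
      using local_rule_cong[OF R[of f], of \<mu>] nu by (simp add: f_def)
    have "G f u v k = ?\<rho> k" for k
    proof (cases "1 \<le> k")
      case True
      show ?thesis
        by (rule local_rule_unique_out[OF R' \<mu>(1) _ _ True]) (auto simp: diag_seq_def min_less_iff_disj intro: supp)
    qed (simp add: supp diag_seq_def)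
    then have rho: "diag_seq (growth_map L f) u v = ?\<rho>" unfolding gm by blast
    have "growth_map L f x = g x" if "x \<in> L" for x
    proof (cases "x \<in> off_diag L u v")
      case True
      then show ?thesis using gm(2)[OF True, of f] fh h_off[OF True] by simp
    next
      case False
      obtain k where k: "1 \<le> k" "k \<le> u" "k \<le> v" "x = (Suc u - k, Suc v - k)"
        using on_diag_cell[OF L c \<open>x \<in> L\<close> False] by blast
      then have "diag_seq h u v k = h x" for h by (simp add: diag_seq_def)
      then show ?thesis using fun_cong[OF rho, of k] by simp
    qed
    then have "growth_map L f = g" using ext[of f] g(1) by (intro PiE_ext) auto
    then show ?thesis using fL by blast
  qed
  show ?case
    unfolding bij_betw_def
  proof (intro conjI inj equalityI subsetI)
    fix g assume "g \<in> growth_map L ` (L \<rightarrow>\<^sub>E UNIV)"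
    then show "g \<in> {g \<in> L \<rightarrow>\<^sub>E UNIV. weakly_inc L g}" using into ext by auto
  next
    fix g assume "g \<in> {g \<in> L \<rightarrow>\<^sub>E UNIV. weakly_inc L g}"
    then show "g \<in> growth_map L ` (L \<rightarrow>\<^sub>E UNIV)" using surj by blast
  qed
qed

end

section \<open>Shapes of keyed grids obey the local rules\<close>

definition shape :: "(nat \<Rightarrow> int) \<Rightarrow> (nat \<Rightarrow> int) \<Rightarrow> (nat \<times> nat \<Rightarrow> nat) \<Rightarrow> nat \<Rightarrow> nat \<Rightarrow> nat \<Rightarrow> nat" where
  "shape \<alpha> \<beta> f u v k = cells_max \<alpha> \<beta> f u v k - cells_max \<alpha> \<beta> f u v (k - 1)"

lemma psum_shape: "psum (shape \<alpha> \<beta> f u v) k = cells_max \<alpha> \<beta> f u v k"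
proof (induction k)
  case 0
  then show ?case by (simp add: cells_max_def)
next
  case (Suc k)
  then show ?case using cells_max_mono[of \<alpha> \<beta> f u v k] by (simp add: shape_def)
qed

lemma key_inj:
  assumes "\<And>i. 1 \<le> i \<Longrightarrow> i \<le> u \<Longrightarrow> key_last \<alpha> i \<or> key_first \<alpha> i"
  shows "inj_on \<alpha> {1..u}"
proof -
  have "\<alpha> i \<noteq> \<alpha> i'" if "1 \<le> i" "i < i'" "i' \<le> u" for i i'
    using assms[of i'] that by (auto simp: key_last_def key_first_def)
  then show ?thesis unfolding inj_on_def by (metis atLeastAtMost_iff linorder_neqE_nat)
qed

lemma sum_cells_corner:
  fixes f :: "nat \<times> nat \<Rightarrow> nat"
  assumes "1 \<le> u" "1 \<le> v"
  shows "sum f (cells u v) + sum f (cells (u - 1) (v - 1)) =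
    f (u, v) + sum f (cells u (v - 1)) + sum f (cells (u - 1) v)"
proof -
  have u: "{1..u} = insert u {1..u - 1}" "u \<notin> {1..u - 1}" and v: "{1..v} = insert v {1..v - 1}" "v \<notin> {1..v - 1}"
    using assms by auto
  have c: "sum f (cells a b) = (\<Sum>i\<in>{1..a}. \<Sum>j\<in>{1..b}. f (i, j))" for a b
    by (simp add: cells_def sum.cartesian_product)
  have "(\<Sum>j\<in>{1..v}. f (i, j)) = f (i, v) + (\<Sum>j\<in>{1..v - 1}. f (i, j))" for i
    unfolding v(1) using v(2) by simp
  then have "sum f (cells a v) = (\<Sum>i\<in>{1..a}. f (i, v)) + sum f (cells a (v - 1))" for a
    unfolding c by (simp only: sum.distrib)
  moreover have "(\<Sum>i\<in>{1..u}. f (i, v)) = f (u, v) + (\<Sum>i\<in>{1..u - 1}. f (i, v))"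
    unfolding u(1) using u(2) by simp
  ultimately show ?thesis by simp
qed

lemma key_negate: "key_last (\<lambda>i. - \<gamma> i) u \<longleftrightarrow> key_first \<gamma> u" "key_first (\<lambda>i. - \<gamma> i) u \<longleftrightarrow> key_last \<gamma> u"
  by (auto simp: key_last_def key_first_def)

lemma inj_negate: "inj_on (\<lambda>i. - \<gamma> i :: int) A \<longleftrightarrow> inj_on \<gamma> A"
  by (simp add: inj_on_def)

text \<open>Each new row or column comes last or first among the earlier ones; this is the trace
  that the Coxeter element leaves in the local rules.\<close>

locale extremal_keys =
  fixes \<alpha> \<beta> :: "nat \<Rightarrow> int"
  assumes row_key: "1 \<le> i \<Longrightarrow> key_last \<alpha> i \<or> key_first \<alpha> i"
    and col_key: "1 \<le> j \<Longrightarrow> key_last \<beta> j \<or> key_first \<beta> j"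
begin

definition same_end :: "nat \<Rightarrow> nat \<Rightarrow> bool" where
  "same_end u v \<longleftrightarrow> key_last \<alpha> u \<and> key_last \<beta> v \<or> key_first \<alpha> u \<and> key_first \<beta> v"

sublocale growth "shape \<alpha> \<beta>" same_end
proof
  fix k u v :: nat and f assume "k = 0 \<or> u < k \<or> v < k"
  then consider "k = 0" | "k \<noteq> 0" "min u v \<le> k" "min u v \<le> k - 1" by fastforce
  then show "shape \<alpha> \<beta> f u v k = 0"
    by cases (simp_all add: shape_def cells_max_total)
next
  fix u v k and f g :: "nat \<times> nat \<Rightarrow> nat"
  assume fg: "\<And>x. x \<in> cells u v \<Longrightarrow> f x = g x"
  have "cells_max \<alpha> \<beta> f u v l = cells_max \<alpha> \<beta> g u v l" for l using fg by (rule cells_max_cong)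
  then show "shape \<alpha> \<beta> f u v k = shape \<alpha> \<beta> g u v k" by (simp add: shape_def)
next
  fix u v :: nat and f assume uv: "1 \<le> u" "1 \<le> v"
  have inj: "inj_on \<alpha> {1..u}" "inj_on \<beta> {1..v}"
    by (rule key_inj, erule row_key) (rule key_inj, erule col_key)
  note inj' = inj[folded inj_negate[of \<alpha>] inj_negate[of \<beta>]]
  show "local_rule (same_end u v) (min u v) (shape \<alpha> \<beta> f (u - 1) (v - 1)) (shape \<alpha> \<beta> f u (v - 1))
      (shape \<alpha> \<beta> f (u - 1) v) (shape \<alpha> \<beta> f u v) (f (u, v))"
  proof (cases "same_end u v")
    case True
    then consider "key_last \<alpha> u" "key_last \<beta> v" | "key_first \<alpha> u" "key_first \<beta> v" by (auto simp: same_end_def)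
    then have "pure_rule (shape \<alpha> \<beta> f (u - 1) (v - 1)) (shape \<alpha> \<beta> f u (v - 1)) (shape \<alpha> \<beta> f (u - 1) v)
        (shape \<alpha> \<beta> f u v) (f (u, v))"
    proof cases
      case 1
      show ?thesis unfolding pure_rule_def psum_shape
        using cells_max_last_last[OF inj(1) 1(1) inj(2) 1(2) uv] by blast
    next
      case 2
      show ?thesis unfolding pure_rule_def psum_shape
        using cells_max_last_last[OF inj'(1) _ inj'(2) _ uv, unfolded cells_max_negate key_negate, OF 2] by blast
    qed
    then show ?thesis using True by (simp add: local_rule_def)
  next
    case False
    then consider "key_last \<alpha> u" "key_first \<beta> v" | "key_first \<alpha> u" "key_last \<beta> v"
      using row_key[OF uv(1)] col_key[OF uv(2)] by (auto simp: same_end_def)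
    then have "cells_max \<alpha> \<beta> f u v k + cells_max \<alpha> \<beta> f (u - 1) (v - 1) k =
      max (cells_max \<alpha> \<beta> f u (v - 1) k + cells_max \<alpha> \<beta> f (u - 1) v k)
        (cells_max \<alpha> \<beta> f u v (Suc k) + cells_max \<alpha> \<beta> f (u - 1) (v - 1) (k - 1))" if "1 \<le> k" for k
    proof cases
      case 1
      show ?thesis by (rule cells_max_last_first[OF inj(1) 1(1) inj(2) 1(2) uv that])
    next
      case 2
      show ?thesis
        by (rule cells_max_last_first[OF inj'(1) _ inj'(2) _ uv that, unfolded cells_max_negate key_negate, OF 2])
    qed
    \<comment> \<open>At \<open>min u v\<close> all four maxima are total sums, and the equation is
      inclusion-exclusion for the rectangles.\<close>
    moreover have "cells_max \<alpha> \<beta> f u v (min u v) + cells_max \<alpha> \<beta> f (u - 1) (v - 1) (min u v)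
        = f (u, v) + cells_max \<alpha> \<beta> f u (v - 1) (min u v) + cells_max \<alpha> \<beta> f (u - 1) v (min u v)"
    proof -
      have "min (u - 1) (v - 1) \<le> min u v" "min u (v - 1) \<le> min u v" "min (u - 1) v \<le> min u v" by auto
      then show ?thesis using sum_cells_corner[OF uv, of f] by (simp only: cells_max_total order_refl)
    qed
    ultimately have "mixed_rule (min u v) (shape \<alpha> \<beta> f (u - 1) (v - 1)) (shape \<alpha> \<beta> f u (v - 1))
        (shape \<alpha> \<beta> f (u - 1) v) (shape \<alpha> \<beta> f u v) (f (u, v))"
      unfolding mixed_rule_def psum_shape by blast
    then show ?thesis using False by (simp add: local_rule_def)
  qed
qed

end

section \<open>Coxeter elements\<close>

text \<open>\<^term>\<open>A\<close> consists of the elements strictly between \<open>1\<close> and \<open>n\<close> that the cycle visits on its way up.\<close>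

definition cycle_shape :: "nat \<Rightarrow> nat set \<Rightarrow> (nat \<Rightarrow> nat) \<Rightarrow> bool" where
  "cycle_shape n A c \<longleftrightarrow> A \<subseteq> {2..<n} \<and>
    (\<forall>x. x = 1 \<or> x \<in> A \<longrightarrow> c x \<in> insert n A \<and> x < c x \<and> (\<forall>z\<in>A. x < z \<longrightarrow> c x \<le> z)) \<and>
    (\<forall>x. 2 \<le> x \<longrightarrow> x \<le> n \<longrightarrow> x \<notin> A \<longrightarrow> 1 \<le> c x \<and> c x < x \<and> c x \<notin> A \<and> (\<forall>z. z < x \<longrightarrow> z \<notin> A \<longrightarrow> z \<le> c x)) \<and>
    (\<forall>x. x = 0 \<or> n < x \<longrightarrow> c x = x)"

definition refl_prod :: "nat list \<Rightarrow> nat \<Rightarrow> nat" where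
  "refl_prod \<sigma> = foldr (\<lambda>i acc. sref i \<circ> acc) \<sigma> id"

lemma refl_prod_simps [simp]: "refl_prod [] = id" "refl_prod (i # \<sigma>) = sref i \<circ> refl_prod \<sigma>"
  by (simp_all add: refl_prod_def)

lemma refl_prod_append: "refl_prod (xs @ ys) = refl_prod xs \<circ> refl_prod ys"
  by (induction xs) (simp_all only: append.simps refl_prod_simps comp_assoc id_comp)

lemma sref_commute: "Suc i < n \<Longrightarrow> sref n \<circ> sref i = sref i \<circ> sref n"
  by (rule ext) (auto simp: sref_def transpose_def)

lemma refl_prod_commute: "(\<And>i. i \<in> set ys \<Longrightarrow> Suc i < n) \<Longrightarrow> sref n \<circ> refl_prod ys = refl_prod ys \<circ> sref n"
proof (induction ys)
  case (Cons i ys)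
  then have i: "sref n \<circ> sref i = sref i \<circ> sref n" by (intro sref_commute) auto
  have "sref n \<circ> refl_prod (i # ys) = (sref n \<circ> sref i) \<circ> refl_prod ys" by (simp only: refl_prod_simps comp_assoc)
  also have "\<dots> = sref i \<circ> (sref n \<circ> refl_prod ys)" by (simp only: i comp_assoc)
  also have "sref n \<circ> refl_prod ys = refl_prod ys \<circ> sref n" by (rule Cons.IH) (use Cons.prems in simp)
  finally show ?case by (simp only: refl_prod_simps comp_assoc)
qed simp

text \<open>The letter \<open>sref n\<close> commutes with all others except
  \<open>sref (n - 1)\<close>, which stands on at most one side of it; through the other side it
  moves out to an end of the word.\<close>

lemma coxeter_Suc:
  assumes "coxeter (Suc n) c" "1 \<le> n"
  obtains c' where "coxeter n c'" "c = sref n \<circ> c' \<or> c = c' \<circ> sref n"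
proof -
  obtain \<sigma> where \<sigma>: "distinct \<sigma>" "set \<sigma> = {1..<Suc n}" "c = refl_prod \<sigma>" using assms(1) by (auto simp: coxeter_def refl_prod_def)
  then obtain xs ys where s: "\<sigma> = xs @ n # ys" using assms(2) split_list[of n \<sigma>] by auto
  have d: "distinct (xs @ ys)" using \<sigma>(1) s by auto
  have un: "insert n (set (xs @ ys)) = {1..<Suc n}" using \<sigma>(2) s by auto
  have "n \<notin> set (xs @ ys)" using \<sigma>(1) s by auto
  then have "set (xs @ ys) = {1..<Suc n} - {n}" unfolding un[symmetric] by simp
  also have "\<dots> = {1..<n}" by auto
  finally have st: "set (xs @ ys) = {1..<n}" .
  have cox: "coxeter n (refl_prod (xs @ ys))" unfolding coxeter_def refl_prod_def using d st by blast
  have c: "c = refl_prod xs \<circ> (sref n \<circ> refl_prod ys)" unfolding \<sigma>(3) s by (simp only: refl_prod_append refl_prod_simps)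
  have lt: "i < n" if "i \<in> set xs \<or> i \<in> set ys" for i using st that by auto
  have "n - 1 \<notin> set xs \<or> n - 1 \<notin> set ys" using d by auto
  then show ?thesis
  proof
    assume a: "n - 1 \<notin> set xs"
    have "Suc i < n" if "i \<in> set xs" for i
    proof -
      have "i \<noteq> n - 1" using a that by blast
      then show ?thesis using lt[of i] that by auto
    qed
    then have "refl_prod xs \<circ> sref n = sref n \<circ> refl_prod xs" using refl_prod_commute[of xs n] by simp
    then have "c = sref n \<circ> refl_prod (xs @ ys)" unfolding c refl_prod_append by (simp only: comp_assoc[symmetric])
    then show ?thesis using that[OF cox] by blast
  next
    assume a: "n - 1 \<notin> set ys"
    have "Suc i < n" if "i \<in> set ys" for i
    proof -
      have "i \<noteq> n - 1" using a that by blast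
      then show ?thesis using lt[of i] that by auto
    qed
    then have "sref n \<circ> refl_prod ys = refl_prod ys \<circ> sref n" using refl_prod_commute[of ys n] by simp
    then have "c = refl_prod (xs @ ys) \<circ> sref n" unfolding c refl_prod_append by (simp only: comp_assoc)
    then show ?thesis using that[OF cox] by blast
  qed
qed

lemma sref_apply: "sref n x = (if x = n then Suc n else if x = Suc n then n else x)"
  by (simp add: sref_def transpose_def)

lemma cycle_shapeD:
  assumes "cycle_shape n A c"
  shows "x \<in> A \<Longrightarrow> 2 \<le> x" "x \<in> A \<Longrightarrow> x < n"
    and "x = 1 \<or> x \<in> A \<Longrightarrow> c x = n \<or> c x \<in> A" "x = 1 \<or> x \<in> A \<Longrightarrow> x < c x"
    and "x = 1 \<or> x \<in> A \<Longrightarrow> z \<in> A \<Longrightarrow> x < z \<Longrightarrow> c x \<le> z"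
    and "2 \<le> x \<Longrightarrow> x \<le> n \<Longrightarrow> x \<notin> A \<Longrightarrow> 1 \<le> c x" "2 \<le> x \<Longrightarrow> x \<le> n \<Longrightarrow> x \<notin> A \<Longrightarrow> c x < x"
    and "2 \<le> x \<Longrightarrow> x \<le> n \<Longrightarrow> x \<notin> A \<Longrightarrow> c x \<notin> A"
    and "2 \<le> x \<Longrightarrow> x \<le> n \<Longrightarrow> x \<notin> A \<Longrightarrow> z < x \<Longrightarrow> z \<notin> A \<Longrightarrow> z \<le> c x"
    and "x = 0 \<or> n < x \<Longrightarrow> c x = x"
proof -
  note unf = assms[unfolded cycle_shape_def]
  note a = unf[THEN conjunct1] and b = unf[THEN conjunct2, THEN conjunct1, THEN spec, THEN mp]
    and d = unf[THEN conjunct2, THEN conjunct2, THEN conjunct1, THEN spec, THEN mp, THEN mp, THEN mp]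
    and e = unf[THEN conjunct2, THEN conjunct2, THEN conjunct2, THEN spec, THEN mp]
  show "x \<in> A \<Longrightarrow> 2 \<le> x" "x \<in> A \<Longrightarrow> x < n" using a by auto
  show "x = 1 \<or> x \<in> A \<Longrightarrow> c x = n \<or> c x \<in> A" "x = 1 \<or> x \<in> A \<Longrightarrow> x < c x"
    and "x = 1 \<or> x \<in> A \<Longrightarrow> z \<in> A \<Longrightarrow> x < z \<Longrightarrow> c x \<le> z"
    using b[of x] by blast+
  show "2 \<le> x \<Longrightarrow> x \<le> n \<Longrightarrow> x \<notin> A \<Longrightarrow> 1 \<le> c x" "2 \<le> x \<Longrightarrow> x \<le> n \<Longrightarrow> x \<notin> A \<Longrightarrow> c x < x"
    and "2 \<le> x \<Longrightarrow> x \<le> n \<Longrightarrow> x \<notin> A \<Longrightarrow> c x \<notin> A"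
    and "2 \<le> x \<Longrightarrow> x \<le> n \<Longrightarrow> x \<notin> A \<Longrightarrow> z < x \<Longrightarrow> z \<notin> A \<Longrightarrow> z \<le> c x"
    using d[of x] by blast+
  show "x = 0 \<or> n < x \<Longrightarrow> c x = x" by (rule e)
qed

text \<open>The new top \<open>Suc n\<close> is inserted just after \<open>n\<close> in the cycle,
  which leaves \<open>n\<close> on the way up.\<close>

lemma cycle_shape_insert_after:
  assumes c: "cycle_shape n A c" and n: "2 \<le> n"
  shows "cycle_shape (Suc n) (insert n A) (c \<circ> sref n)"
proof -
  note D = cycle_shapeD[OF c]
  have low: "(c \<circ> sref n) x = c x" if "x < n" for x using that by (simp add: sref_apply)
  have at: "(c \<circ> sref n) n = Suc n" "(c \<circ> sref n) (Suc n) = c n" using D(10)[of "Suc n"] by (auto simp: sref_apply)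
  have nA: "n \<notin> A" using D(2) by blast
  show ?thesis
    unfolding cycle_shape_def
  proof (intro conjI allI impI)
    show "insert n A \<subseteq> {2..<Suc n}" using D(1,2) n by (auto simp: less_Suc_eq)
  next
    fix x assume x: "x = 1 \<or> x \<in> insert n A"
    show "(c \<circ> sref n) x \<in> insert (Suc n) (insert n A)" "x < (c \<circ> sref n) x"
      "\<forall>z\<in>insert n A. x < z \<longrightarrow> (c \<circ> sref n) x \<le> z"
    proof -
      consider "x = n" | "x < n" "x = 1 \<or> x \<in> A" using x n D(2) by fastforce
      then have "(c \<circ> sref n) x \<in> insert (Suc n) (insert n A) \<and> x < (c \<circ> sref n) x \<and>
        (\<forall>z\<in>insert n A. x < z \<longrightarrow> (c \<circ> sref n) x \<le> z)"
      proof cases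
        case 1
        then show ?thesis using at D(2) by fastforce
      next
        case 2
        have "c x \<le> n" using D(3)[OF 2(2)] D(2) by fastforce
        then show ?thesis unfolding low[OF 2(1)] using D(3,4,5)[OF 2(2)] by auto
      qed
      then show "(c \<circ> sref n) x \<in> insert (Suc n) (insert n A)" "x < (c \<circ> sref n) x"
        "\<forall>z\<in>insert n A. x < z \<longrightarrow> (c \<circ> sref n) x \<le> z" by blast+
    qed
  next
    fix x assume x: "2 \<le> x" "x \<le> Suc n" "x \<notin> insert n A"
    have "1 \<le> (c \<circ> sref n) x \<and> (c \<circ> sref n) x < x \<and> (c \<circ> sref n) x \<notin> insert n A \<and>
      (\<forall>z. z < x \<longrightarrow> z \<notin> insert n A \<longrightarrow> z \<le> (c \<circ> sref n) x)"
    proof (cases "x = Suc n")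
      case True
      have "c n \<noteq> n" using D(7)[of n] n nA by auto
      then show ?thesis unfolding True at using D(6,7,8)[of n] D(9)[of n] n nA by (auto simp: less_Suc_eq)
    next
      case False
      then have xn: "x < n" using x by auto
      have "c x < n" using D(7)[of x] x xn by auto
      then show ?thesis unfolding low[OF xn] using D(6,7,8)[of x] D(9)[of x] x xn by auto
    qed
    then show "1 \<le> (c \<circ> sref n) x" "(c \<circ> sref n) x < x" "(c \<circ> sref n) x \<notin> insert n A"
      "\<And>z. z < x \<Longrightarrow> z \<notin> insert n A \<Longrightarrow> z \<le> (c \<circ> sref n) x" by blast+
  next
    fix x assume "x = 0 \<or> Suc n < x"
    then show "(c \<circ> sref n) x = x" using D(10)[of x] n by (auto simp: sref_apply)
  qed
qed

text \<open>Here \<open>Suc n\<close> is inserted just before \<open>n\<close> in the cycle, which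
  leaves \<open>n\<close> on the way down.\<close>

lemma cycle_shape_insert_before:
  assumes c: "cycle_shape n A c" and n: "2 \<le> n"
  shows "cycle_shape (Suc n) A (sref n \<circ> c)"
proof -
  note D = cycle_shapeD[OF c]
  have nA: "n \<notin> A" using D(2) by blast
  show ?thesis
    unfolding cycle_shape_def
  proof (intro conjI allI impI)
    show "A \<subseteq> {2..<Suc n}" using D(1,2) by (auto simp: less_Suc_eq)
  next
    fix x assume x: "x = 1 \<or> x \<in> A"
    have "x < n" using x D(2) n by auto
    have "(sref n \<circ> c) x \<in> insert (Suc n) A \<and> x < (sref n \<circ> c) x \<and> (\<forall>z\<in>A. x < z \<longrightarrow> (sref n \<circ> c) x \<le> z)"
    proof (cases "c x = n")
      case True
      then have "(sref n \<circ> c) x = Suc n" by (simp add: sref_apply)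
      moreover have "\<not> x < z" if "z \<in> A" for z using D(5)[OF x that] D(2)[OF that] True by auto
      ultimately show ?thesis using \<open>x < n\<close> by auto
    next
      case False
      then have "c x \<in> A" using D(3)[OF x] by blast
      then have "(sref n \<circ> c) x = c x" using D(2)[of "c x"] by (simp add: sref_apply)
      then show ?thesis using \<open>c x \<in> A\<close> D(4,5)[OF x] by auto
    qed
    then show "(sref n \<circ> c) x \<in> insert (Suc n) A" "x < (sref n \<circ> c) x" "\<forall>z\<in>A. x < z \<longrightarrow> (sref n \<circ> c) x \<le> z"
      by blast+
  next
    fix x assume x: "2 \<le> x" "x \<le> Suc n" "x \<notin> A"
    have "1 \<le> (sref n \<circ> c) x \<and> (sref n \<circ> c) x < x \<and> (sref n \<circ> c) x \<notin> A \<and> (\<forall>z. z < x \<longrightarrow> z \<notin> A \<longrightarrow> z \<le> (sref n \<circ> c) x)"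
    proof (cases "x = Suc n")
      case True
      have "(sref n \<circ> c) x = n" using D(10)[of "Suc n"] True by (simp add: sref_apply)
      then show ?thesis using n nA True by auto
    next
      case False
      then have "(sref n \<circ> c) x = c x" using D(7)[of x] x by (simp add: sref_apply)
      then show ?thesis using D(6,7,8)[of x] D(9)[of x] x False by auto
    qed
    then show "1 \<le> (sref n \<circ> c) x" "(sref n \<circ> c) x < x" "(sref n \<circ> c) x \<notin> A"
      "\<And>z. z < x \<Longrightarrow> z \<notin> A \<Longrightarrow> z \<le> (sref n \<circ> c) x" by blast+
  next
    fix x assume "x = 0 \<or> Suc n < x"
    then show "(sref n \<circ> c) x = x" using D(10)[of x] n by (auto simp: sref_apply)
  qed
qed

lemma coxeter_cycle_shape:
  assumes "2 \<le> n" "coxeter n c"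
  shows "\<exists>A. cycle_shape n A c"
  using assms
proof (induction n arbitrary: c rule: dec_induct)
  case base
  then obtain \<sigma> where \<sigma>: "distinct \<sigma>" "set \<sigma> = {1..<2}" "c = refl_prod \<sigma>" by (auto simp: coxeter_def refl_prod_def)
  have "{1..<2} = {1::nat}" by auto
  then have "set \<sigma> = {1}" using \<sigma>(2) by simp
  moreover have "length \<sigma> = 1" using distinct_card[OF \<sigma>(1)] \<open>set \<sigma> = {1}\<close> by simp
  ultimately have "\<sigma> = [1]" by (cases \<sigma>) auto
  then have "c = sref 1" using \<sigma>(3) by simp
  then have "cycle_shape 2 {} c" by (auto simp: cycle_shape_def sref_apply)
  then show ?case by blast
next
  case (step n)
  obtain c' where "coxeter n c'" "c = sref n \<circ> c' \<or> c = c' \<circ> sref n"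
    using coxeter_Suc[OF step.prems] step.hyps by auto
  then show ?case
    using step.IH cycle_shape_insert_after cycle_shape_insert_before step.hyps(1) by blast
qed

section \<open>Auslander--Reiten quivers as grids\<close>

text \<open>Among the elements up to any bound \<open>m\<close> the cycle runs down outside
  \<open>A\<close> to 1 and then up through \<open>A\<close>; the signed value increases along this
  route for every \<open>m\<close> at once.\<close>

definition row_key :: "nat set \<Rightarrow> nat \<Rightarrow> int" where
  "row_key A x = (if x = 1 \<or> x \<in> A then int x else - int x)"

text \<open>Above \<open>m\<close> the route is the opposite one: up through \<open>A\<close> to
  \<open>n\<close>, where the key is 0, and then down through the rest.\<close>

definition col_key :: "nat \<Rightarrow> nat set \<Rightarrow> nat \<Rightarrow> int" where
  "col_key n A y = (if y \<in> A then int y - int n else int n - int y)"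

definition key_le :: "nat \<Rightarrow> nat set \<Rightarrow> nat \<times> nat \<Rightarrow> nat \<times> nat \<Rightarrow> bool" where
  "key_le n A x y \<longleftrightarrow> row_key A (fst x) \<le> row_key A (fst y) \<and> col_key n A (snd x) \<le> col_key n A (snd y)"

lemma ar_vert_m_eq: "m < n \<Longrightarrow> ar_vert_m n m = {1..m} \<times> {Suc m..n}"
  by (auto simp: ar_vert_m_def ar_vert_def)

lemma is_path_single: "x \<in> V \<Longrightarrow> is_path V Ed [x]"
  by (simp add: is_path_def)

lemma is_path_Cons:
  assumes "x \<in> V" "is_path V Ed p" "Ed x (hd p)"
  shows "is_path V Ed (x # p)"
  using assms unfolding is_path_def by (auto simp: nth_Cons hd_conv_nth split: nat.splits)

lemma is_path_join:
  assumes "is_path V Ed p" "is_path V Ed q" "last p = hd q"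
  shows "is_path V Ed (p @ tl q)"
  unfolding is_path_def
proof (intro conjI allI impI)
  show "p @ tl q \<noteq> []" using assms by (simp add: is_path_def)
  show "set (p @ tl q) \<subseteq> V" using assms by (auto simp: is_path_def dest: list.set_sel(2))
  fix k assume k: "Suc k < length (p @ tl q)"
  have ne: "p \<noteq> []" "q \<noteq> []" using assms by (auto simp: is_path_def)
  consider "Suc k < length p" | "Suc k = length p" | "length p \<le> k" by linarith
  then show "Ed ((p @ tl q) ! k) ((p @ tl q) ! Suc k)"
  proof cases
    case 1
    then show ?thesis using assms(1) by (simp add: is_path_def nth_append)
  next
    case 2
    then have "(p @ tl q) ! k = q ! 0"
      using assms(3) ne by (simp add: nth_append last_conv_nth hd_conv_nth flip: 2)
    moreover have "(p @ tl q) ! Suc k = q ! Suc 0" using 2 k by (simp add: nth_append nth_tl)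
    ultimately show ?thesis using assms(2) k 2 by (simp add: is_path_def)
  next
    case 3
    then have "(p @ tl q) ! k = q ! Suc (k - length p)" "(p @ tl q) ! Suc k = q ! Suc (Suc (k - length p))"
      using k by (simp_all add: nth_append nth_tl Suc_diff_le)
    moreover have "Suc (Suc (k - length p)) < length q" using 3 k by auto
    ultimately show ?thesis using assms(2) by (simp add: is_path_def)
  qed
qed

context
  fixes n m A c
  assumes c: "cycle_shape n A c" and m: "1 \<le> m" "m < n"
begin

abbreviation (input) "vert \<equiv> ar_vert_m n m"

lemma row_key_step:
  assumes "1 \<le> i" "i \<le> m" "c i \<le> m"
  shows "row_key A i < row_key A (c i)"
proof (cases "i = 1 \<or> i \<in> A")
  case True
  have "c i \<in> A" using cycle_shapeD(3)[OF c True] assms(3) m by auto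
  then show ?thesis using True cycle_shapeD(4)[OF c True] by (simp add: row_key_def)
next
  case False
  then have "2 \<le> i" "i \<le> n" "i \<notin> A" using assms m by auto
  note D = cycle_shapeD(6,7)[OF c this]
  show ?thesis using False D by (auto simp: row_key_def)
qed

lemma col_key_step:
  assumes "m < j" "j \<le> n" "m < c j"
  shows "col_key n A j < col_key n A (c j)"
proof (cases "j \<in> A")
  case True
  have "c j = n \<or> c j \<in> A" "j < c j" using cycle_shapeD(3,4)[OF c, of j] True by auto
  then show ?thesis using True cycle_shapeD(2)[OF c, of j] by (auto simp: col_key_def)
next
  case False
  then have j: "2 \<le> j" "j \<le> n" "j \<notin> A" using assms m by auto
  show ?thesis using j cycle_shapeD(7,8)[OF c j] by (auto simp: col_key_def)
qed

text \<open>The cycle moves to the next element in key order, so it neither leaves the rows up to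
  \<open>m\<close> nor overshoots as long as a larger key remains among them.\<close>

lemma row_key_next:
  assumes "1 \<le> i" "i \<le> m" "1 \<le> i'" "i' \<le> m" "row_key A i < row_key A i'"
  shows "1 \<le> c i" "c i \<le> m" "row_key A (c i) \<le> row_key A i'"
proof -
  have "1 \<le> c i \<and> c i \<le> m \<and> row_key A (c i) \<le> row_key A i'"
  proof (cases "i = 1 \<or> i \<in> A")
    case True
    then have "int i < row_key A i'" using assms(5) by (simp add: row_key_def)
    then have i': "i' = 1 \<or> i' \<in> A" "i < i'" by (auto simp: row_key_def split: if_splits)
    then have "i' \<in> A" using assms(1) by auto
    then have "c i \<le> i'" using i'(2) by (rule cycle_shapeD(5)[OF c True])
    moreover have "c i \<in> A" using cycle_shapeD(3)[OF c True] \<open>c i \<le> i'\<close> assms(4) m by auto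
    ultimately show ?thesis using \<open>i' \<in> A\<close> assms(4) cycle_shapeD(1)[OF c, of "c i"] by (auto simp: row_key_def)
  next
    case False
    then have i: "2 \<le> i" "i \<le> n" "i \<notin> A" using assms m by auto
    note D = cycle_shapeD(6,7,8)[OF c i] and D9 = cycle_shapeD(9)[OF c i]
    have "row_key A (c i) \<le> row_key A i'"
    proof (cases "i' = 1 \<or> i' \<in> A")
      case True
      then show ?thesis using assms(3) D by (auto simp: row_key_def)
    next
      case i': False
      then have "i' < i" using assms(5) False by (auto simp: row_key_def)
      then have "i' \<le> c i" using i' by (intro D9) auto
      moreover have "c i \<noteq> 1" using \<open>i' \<le> c i\<close> i' assms(3) by auto
      ultimately show ?thesis using i' D by (auto simp: row_key_def)
    qed
    then show ?thesis using D assms(2) by auto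
  qed
  then show "1 \<le> c i" "c i \<le> m" "row_key A (c i) \<le> row_key A i'" by auto
qed

lemma col_key_next:
  assumes "m < j" "j \<le> n" "m < j'" "j' \<le> n" "col_key n A j < col_key n A j'"
  shows "m < c j" "c j \<le> n" "col_key n A (c j) \<le> col_key n A j'"
proof -
  have "m < c j \<and> c j \<le> n \<and> col_key n A (c j) \<le> col_key n A j'"
  proof (cases "j \<in> A")
    case True
    note D = cycle_shapeD(3,4)[OF c, of j] and D5 = cycle_shapeD(5)[OF c, of j]
    have "c j \<le> n" using D True cycle_shapeD(2)[OF c, of "c j"] by auto
    moreover have "col_key n A (c j) \<le> col_key n A j'"
    proof (cases "j' \<in> A")
      case j': True
      then have "j < j'" using True assms(5) by (auto simp: col_key_def)
      then have "c j \<le> j'" using True j' by (intro D5) auto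
      then show ?thesis using j' D True cycle_shapeD(2)[OF c, of j'] by (auto simp: col_key_def)
    next
      case False
      then show ?thesis using D True \<open>c j \<le> n\<close> assms(4) by (auto simp: col_key_def)
    qed
    ultimately show ?thesis using D True assms(1) by auto
  next
    case False
    then have j: "2 \<le> j" "j \<le> n" "j \<notin> A" using assms m by auto
    have j': "j' \<notin> A" "j' < j" using False assms(2,4,5) cycle_shapeD(2)[OF c, of j'] by (auto simp: col_key_def split: if_splits)
    have "j' \<le> c j" using cycle_shapeD(9)[OF c j j'(2,1)] .
    then show ?thesis using j' assms cycle_shapeD(7,8)[OF c j] by (auto simp: col_key_def)
  qed
  then show "m < c j" "c j \<le> n" "col_key n A (c j) \<le> col_key n A j'" by auto
qed

lemma row_key_inj: "row_key A x = row_key A y \<Longrightarrow> x = y"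
  by (auto simp: row_key_def split: if_splits)

lemma col_key_inj: "x \<le> n \<Longrightarrow> y \<le> n \<Longrightarrow> col_key n A x = col_key n A y \<Longrightarrow> x = y"
  by (auto simp: col_key_def split: if_splits)

lemma ar_edge_key_le:
  assumes "x \<in> vert" "y \<in> vert" "ar_edge c x y"
  shows "key_le n A x y"
  using assms row_key_step[of "fst x"] col_key_step[of "snd x"]
  unfolding ar_edge_def key_le_def ar_vert_m_eq[OF m(2)] by (auto simp: mem_Times_iff)

text \<open>Each step raises one key without passing the target, so the sum of the two key distances
  decreases.\<close>

lemma path_exists:
  assumes "x \<in> vert" "y \<in> vert" "key_le n A x y"
  shows "\<exists>p. is_path vert (ar_edge c) p \<and> hd p = x \<and> last p = y"
  using assms
proof (induction "nat (row_key A (fst y) - row_key A (fst x)) + nat (col_key n A (snd y) - col_key n A (snd x))"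
    arbitrary: x rule: less_induct)
  case less
  have x: "1 \<le> fst x" "fst x \<le> m" "m < snd x" "snd x \<le> n" and y: "1 \<le> fst y" "fst y \<le> m" "m < snd y" "snd y \<le> n"
    using less.prems(1,2) by (auto simp: ar_vert_m_eq[OF m(2)] mem_Times_iff)
  have le: "row_key A (fst x) \<le> row_key A (fst y)" "col_key n A (snd x) \<le> col_key n A (snd y)"
    using less.prems(3) by (auto simp: key_le_def)
  have step: ?case if z: "z \<in> vert" "key_le n A z y" "ar_edge c x z"
    and lt: "nat (row_key A (fst y) - row_key A (fst z)) + nat (col_key n A (snd y) - col_key n A (snd z))
      < nat (row_key A (fst y) - row_key A (fst x)) + nat (col_key n A (snd y) - col_key n A (snd x))" for z
  proof -
    obtain p where p: "is_path vert (ar_edge c) p" "hd p = z" "last p = y"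
      using less.hyps[OF lt z(1) less.prems(2) z(2)] by blast
    have "is_path vert (ar_edge c) (x # p)" using less.prems(1) p z(3) by (intro is_path_Cons) auto
    then show ?thesis using p by (intro exI[of _ "x # p"]) (auto simp: is_path_def)
  qed
  consider "row_key A (fst x) < row_key A (fst y)" | "col_key n A (snd x) < col_key n A (snd y)"
    | "row_key A (fst x) = row_key A (fst y)" "col_key n A (snd x) = col_key n A (snd y)" using le by linarith
  then show ?case
  proof cases
    case 1
    note nx = row_key_next[OF x(1,2) y(1,2) 1]
    show ?thesis
    proof (rule step[of "(c (fst x), snd x)"])
      show "(c (fst x), snd x) \<in> vert" using nx x by (simp add: ar_vert_m_eq[OF m(2)])
      show "key_le n A (c (fst x), snd x) y" using nx le by (simp add: key_le_def)
      show "ar_edge c x (c (fst x), snd x)" using nx x by (simp add: ar_edge_def)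
    qed (use row_key_step[OF x(1,2) nx(2)] nx(3) in simp)
  next
    case 2
    note nx = col_key_next[OF x(3,4) y(3,4) 2]
    show ?thesis
    proof (rule step[of "(fst x, c (snd x))"])
      show "(fst x, c (snd x)) \<in> vert" using nx x by (simp add: ar_vert_m_eq[OF m(2)])
      show "key_le n A (fst x, c (snd x)) y" using nx le by (simp add: key_le_def)
      show "ar_edge c x (fst x, c (snd x))" using nx x by (simp add: ar_edge_def)
    qed (use col_key_step[OF x(3,4) nx(1)] nx(3) in simp)
  next
    case 3
    then have "x = y" using row_key_inj col_key_inj x y by (intro prod_eqI) blast+
    then show ?thesis using less.prems by (intro exI[of _ "[x]"]) (simp add: is_path_single)
  qed
qed

lemma path_clique:
  assumes p: "is_path vert (ar_edge c) p"
  shows "clique (key_comparable (row_key A) (col_key n A)) (set p)"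
proof -
  have mono: "key_le n A (p ! a) (p ! (a + e))" if "a + e < length p" for a e
    using that
  proof (induction e)
    case (Suc e)
    have "p ! (a + e) \<in> vert" "p ! (a + Suc e) \<in> vert" "ar_edge c (p ! (a + e)) (p ! (a + Suc e))"
      using p Suc.prems by (auto simp: is_path_def)
    then have "key_le n A (p ! (a + e)) (p ! (a + Suc e))" by (rule ar_edge_key_le)
    then show ?case using Suc by (auto simp: key_le_def)
  qed (simp add: key_le_def)
  show ?thesis
    unfolding clique_def
  proof (intro ballI)
    fix x y assume "x \<in> set p" "y \<in> set p"
    then obtain a b where ab: "a < length p" "x = p ! a" "b < length p" "y = p ! b" by (auto simp: in_set_conv_nth)
    show "key_comparable (row_key A) (col_key n A) x y"
    proof (cases "a \<le> b")
      case True
      then show ?thesis using mono[of a "b - a"] ab by (auto simp: key_le_def key_comparable_def)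
    next
      case False
      then show ?thesis using mono[of b "a - b"] ab by (auto simp: key_le_def key_comparable_def)
    qed
  qed
qed

text \<open>The chain is peeled from its greatest vertex, the one with the largest sum of keys, and
  a path from the previous top is joined on.\<close>

lemma clique_path:
  assumes "clique (key_comparable (row_key A) (col_key n A)) K" "K \<subseteq> vert" "K \<noteq> {}"
  shows "\<exists>p. is_path vert (ar_edge c) p \<and> K \<subseteq> set p \<and> last p \<in> K"
  using assms
proof (induction "card K" arbitrary: K rule: less_induct)
  case less
  have fin: "finite K" using less.prems(2) by (rule finite_subset) (simp add: ar_vert_m_eq[OF m(2)])
  let ?s = "\<lambda>x. row_key A (fst x) + col_key n A (snd x)"
  have "Max (?s ` K) \<in> ?s ` K" using fin less.prems(3) by (intro Max_in) auto
  then obtain z where z: "z \<in> K" "Max (?s ` K) = ?s z" by blast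
  have top: "key_le n A x z" if "x \<in> K" for x
  proof -
    have "?s x \<le> ?s z" unfolding z(2)[symmetric] using fin that by (intro Max_ge) auto
    moreover have "key_comparable (row_key A) (col_key n A) x z" using less.prems(1) that z(1) by (auto simp: clique_def)
    ultimately show ?thesis by (auto simp: key_comparable_def key_le_def)
  qed
  show ?case
  proof (cases "K - {z} = {}")
    case True
    then show ?thesis using z(1) less.prems(2) by (intro exI[of _ "[z]"]) (auto simp: is_path_single)
  next
    case False
    have cl: "clique (key_comparable (row_key A) (col_key n A)) (K - {z})"
      using less.prems(1) by (rule clique_subset) auto
    have "card (K - {z}) < card K" using fin z(1) by (rule card_Diff1_less)
    then obtain p where p: "is_path vert (ar_edge c) p" "K - {z} \<subseteq> set p" "last p \<in> K - {z}"
      using less.hyps[OF _ cl _ False] less.prems(2) by blast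
    obtain q where q: "is_path vert (ar_edge c) q" "hd q = last p" "last q = z"
      using path_exists[of "last p" z] top[of "last p"] p(3) z(1) less.prems(2) by blast
    have ne: "p \<noteq> []" "q \<noteq> []" using p q by (auto simp: is_path_def)
    have "last p \<noteq> z" using p(3) by blast
    then have tq: "tl q \<noteq> []" using q ne by (cases q) auto
    have "last (p @ tl q) = z" using tq q(3) by (simp add: last_tl)
    moreover have "z \<in> set (tl q)" using tq q(3) last_tl[of q] last_in_set[OF tq] by simp
    ultimately show ?thesis
      using is_path_join[OF p(1) q(1) q(2)[symmetric]] p(2) z(1) by (intro exI[of _ "p @ tl q"]) auto
  qed
qed

text \<open>Supports of paths are chains, and every chain lies on a path; since weights are
  nonnegative, enlarging chains to paths cannot lower the total.\<close>

lemma GK_M_eq_cover_max: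
  "GK_M vert (ar_edge c) w l = cover_max (key_comparable (row_key A) (col_key n A)) (\<lambda>_. vert) w l"
proof (cases "l = 0")
  case False
  let ?Q = "key_comparable (row_key A) (col_key n A)"
  let ?S = "{sum w (\<Union>p\<in>set ps. set p) | ps. length ps = l \<and> (\<forall>p\<in>set ps. is_path vert (ar_edge c) p)}"
  have fV: "finite vert" by (simp add: ar_vert_m_eq[OF m(2)])
  \<comment> \<open>Paths are nonempty, so an empty chain has to be replaced by a path; this vertex
    is always available.\<close>
  have v0: "(1, n) \<in> vert" using m by (simp add: ar_vert_m_eq[OF m(2)])
  have sub: "(\<Union>p\<in>set ps. set p) \<subseteq> vert" if "\<forall>p\<in>set ps. is_path vert (ar_edge c) p" for ps
    using that by (auto simp: is_path_def)
  have fS: "finite ?S"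
  proof (rule finite_subset)
    show "?S \<subseteq> sum w ` Pow vert" using sub by blast
  qed (simp add: fV)
  have "sum w (\<Union>p\<in>set (replicate l [(1, n)]). set p) \<in> ?S"
    using v0 by (intro CollectI exI[of _ "replicate l [(1, n)]"]) (auto simp: is_path_single)
  then have neS: "?S \<noteq> {}" by blast
  have "Max ?S = cover_max ?Q (\<lambda>_. vert) w l"
  proof (rule antisym)
    show "Max ?S \<le> cover_max ?Q (\<lambda>_. vert) w l"
    proof (rule Max.boundedI[OF fS neS])
      fix s assume "s \<in> ?S"
      then obtain ps where ps: "s = sum w (\<Union>p\<in>set ps. set p)" "length ps = l"
        "\<forall>p\<in>set ps. is_path vert (ar_edge c) p" by blast
      have "clique ?Q (set (ps ! t)) \<and> set (ps ! t) \<subseteq> vert" if "t < l" for t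
        using path_clique[of "ps ! t"] ps(2,3) that by (auto simp: is_path_def)
      then have "covered ?Q (\<lambda>_. vert) l (\<Union>t<l. set (ps ! t))" by (intro coveredI) auto
      moreover have "(\<Union>t<l. set (ps ! t)) = (\<Union>p\<in>set ps. set p)"
        using ps(2) by (fastforce simp: in_set_conv_nth)
      ultimately have "covered ?Q (\<lambda>_. vert) l (\<Union>p\<in>set ps. set p)" by simp
      then show "s \<le> cover_max ?Q (\<lambda>_. vert) w l" unfolding ps(1) using fV by (intro cover_max_ge) auto
    qed
    show "cover_max ?Q (\<lambda>_. vert) w l \<le> Max ?S"
    proof (rule cover_max_le)
      fix U assume "covered ?Q (\<lambda>_. vert) l U"
      then obtain K where K: "\<And>t. t < l \<Longrightarrow> clique ?Q (K t) \<and> K t \<subseteq> vert" "U = (\<Union>t<l. K t)"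
        by (elim coveredE) (rule that; simp)
      have "\<exists>p. is_path vert (ar_edge c) p \<and> K t \<subseteq> set p" if "t < l" for t
      proof (cases "K t = {}")
        case True
        then show ?thesis using is_path_single[OF v0, of "ar_edge c"] by auto
      next
        case False
        then show ?thesis using clique_path[of "K t"] K(1)[OF that] by blast
      qed
      then obtain P where P: "\<And>t. t < l \<Longrightarrow> is_path vert (ar_edge c) (P t) \<and> K t \<subseteq> set (P t)" by metis
      let ?ps = "map P [0..<l]"
      have ps: "\<forall>p\<in>set ?ps. is_path vert (ar_edge c) p" using P by auto
      have "U \<subseteq> (\<Union>p\<in>set ?ps. set p)" unfolding K(2) using P by fastforce
      then have "sum w U \<le> sum w (\<Union>p\<in>set ?ps. set p)" by (intro sum_mono2) auto
      also have "\<dots> \<le> Max ?S" using ps by (intro Max_ge[OF fS] CollectI exI[of _ ?ps]) auto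
      finally show "sum w U \<le> Max ?S" .
    qed (rule fV)
  qed
  then show ?thesis using False by (simp add: GK_M_def)
qed (simp add: GK_M_def)

end

section \<open>Elementary interval bipartitions\<close>

lemma nth_el_pos_el:
  assumes S: "finite S" and i: "1 \<le> i" "i \<le> card S"
  shows "nth_el S i \<in> S" "pos_el S (nth_el S i) = i"
proof -
  let ?xs = "sorted_list_of_set S"
  have xs: "set ?xs = S" "length ?xs = card S" "sorted_wrt (<) ?xs" using S by auto
  have k: "i - 1 < length ?xs" using i xs(2) by simp
  then show "nth_el S i \<in> S" unfolding nth_el_def using xs(1) nth_mem by blast
  have lt: "?xs ! a < ?xs ! b" if "a < b" "b < length ?xs" for a b
    using sorted_wrt_nth_less[OF xs(3) that] .
  have "{y \<in> S. y \<le> ?xs ! (i - 1)} = (\<lambda>a. ?xs ! a) ` {..i - 1}"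
  proof (intro equalityI subsetI)
    fix y assume y: "y \<in> {y \<in> S. y \<le> ?xs ! (i - 1)}"
    then have "y \<in> set ?xs" using xs(1) by simp
    then obtain a where a: "a < length ?xs" "y = ?xs ! a" by (auto simp: in_set_conv_nth)
    have "\<not> i - 1 < a" using lt[of "i - 1" a] a y by auto
    then show "y \<in> (\<lambda>a. ?xs ! a) ` {..i - 1}" using a by auto
  next
    fix y assume "y \<in> (\<lambda>a. ?xs ! a) ` {..i - 1}"
    then obtain a where a: "a \<le> i - 1" "y = ?xs ! a" by auto
    have "?xs ! a \<le> ?xs ! (i - 1)" using lt[of a "i - 1"] a(1) k by (cases "a = i - 1") auto
    moreover have "?xs ! a \<in> S" using nth_mem[of a ?xs] a(1) k xs(1) by auto
    ultimately show "y \<in> {y \<in> S. y \<le> ?xs ! (i - 1)}" using a(2) by simp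
  qed
  moreover have "inj_on (\<lambda>a. ?xs ! a) {..i - 1}"
    using k by (intro inj_on_nth) auto
  ultimately have "pos_el S (?xs ! (i - 1)) = card {..i - 1}" by (simp add: pos_el_def card_image)
  then show "pos_el S (nth_el S i) = i" using i by (simp add: nth_el_def)
qed

lemma pos_el_less:
  assumes "finite S" "y \<in> S" "x < y"
  shows "pos_el S x < pos_el S y"
  unfolding pos_el_def
proof (rule psubset_card_mono)
  have "y \<in> {z \<in> S. z \<le> y}" "y \<notin> {z \<in> S. z \<le> x}" using assms by auto
  moreover have "{z \<in> S. z \<le> x} \<subseteq> {z \<in> S. z \<le> y}" using assms(3) by auto
  ultimately show "{z \<in> S. z \<le> x} \<subset> {z \<in> S. z \<le> y}" by blast
qed (use assms in simp)

lemma pos_el_mono: "finite S \<Longrightarrow> x \<le> y \<Longrightarrow> pos_el S x \<le> pos_el S y"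
  unfolding pos_el_def by (intro card_mono) auto

lemma pos_el_bounds:
  assumes "finite S" "x \<in> S"
  shows "1 \<le> pos_el S x" "pos_el S x \<le> card S"
proof -
  have "card {x} \<le> pos_el S x" unfolding pos_el_def using assms by (intro card_mono) auto
  then show "1 \<le> pos_el S x" by simp
  show "pos_el S x \<le> card S" unfolding pos_el_def using assms by (intro card_mono) auto
qed

lemma pos_el_inject:
  assumes "finite S" "x \<in> S" "y \<in> S" "pos_el S x = pos_el S y"
  shows "x = y"
  using pos_el_less[OF assms(1,2), of y] pos_el_less[OF assms(1,3), of x] assms(4)
  by (cases x y rule: linorder_cases) auto

lemma nth_el_of_pos_el:
  assumes "finite S" "x \<in> S"
  shows "nth_el S (pos_el S x) = x"
  using nth_el_pos_el[OF assms(1) pos_el_bounds[OF assms]] pos_el_inject[OF assms(1) _ assms(2)] by blast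

lemma nth_el_less:
  assumes "finite S" "1 \<le> i" "i < j" "j \<le> card S"
  shows "nth_el S i < nth_el S j"
proof -
  have "i \<le> card S" "1 \<le> j" using assms by auto
  note a = nth_el_pos_el(2)[OF assms(1,2) \<open>i \<le> card S\<close>] and b = nth_el_pos_el(2)[OF assms(1) \<open>1 \<le> j\<close> assms(4)]
  show ?thesis using pos_el_mono[OF assms(1), of "nth_el S j" "nth_el S i"] a b assms(3) by (cases "nth_el S i < nth_el S j") auto
qed

definition good_bipartition :: "(nat \<Rightarrow> nat) \<Rightarrow> nat set \<Rightarrow> nat set \<Rightarrow> bool" where
  "good_bipartition lam B E \<longleftrightarrow> elementary B E \<and> (\<forall>i\<ge>1. lamBE B E i = lam i)"

locale bipartition =
  fixes lam :: "nat \<Rightarrow> nat" and B E :: "nat set"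
  assumes good: "good_bipartition lam B E"
begin

definition N :: nat where "N = Max (B \<union> E)"

lemma union: "B \<union> E = {1..N}" and disjoint: "B \<inter> E = {}" and one: "1 \<in> B" and last: "N \<in> E"
proof -
  have el: "elementary B E" using good by (simp add: good_bipartition_def)
  then obtain a b where ab: "B \<union> E = {a..b}" unfolding elementary_def interval_bipartition_def by blast
  have ib: "B \<inter> E = {}" "0 \<notin> B \<union> E" using el by (auto simp: elementary_def interval_bipartition_def)
  show o: "1 \<in> B" and "B \<inter> E = {}" and "N \<in> E" using el ib by (auto simp: elementary_def N_def)
  have "1 \<in> {a..b}" "0 \<notin> {a..b}" using o ib(2) unfolding ab[symmetric] by auto
  then have "a = 1" "1 \<le> b" by auto
  then have "N = b" unfolding N_def ab by (intro Max_eqI) auto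
  then show "B \<union> E = {1..N}" using ab \<open>a = 1\<close> by simp
qed

lemma fin: "finite B" "finite E"
  using union by (metis finite_Un finite_atLeastAtMost)+

lemma B_lt: "x \<in> B \<Longrightarrow> 1 \<le> x" "x \<in> B \<Longrightarrow> x < N"
proof -
  assume x: "x \<in> B"
  then have "x \<in> {1..N}" "x \<noteq> N" using union disjoint last by auto
  then show "1 \<le> x" "x < N" by auto
qed

lemma E_gt: "y \<in> E \<Longrightarrow> 1 < y" "y \<in> E \<Longrightarrow> y \<le> N"
proof -
  assume y: "y \<in> E"
  then have "y \<in> {1..N}" "y \<noteq> 1" using union disjoint one by auto
  then show "1 < y" "y \<le> N" by auto
qed

lemma count: "m \<le> N \<Longrightarrow> pos_el B m + pos_el E m = m"
proof -
  assume m: "m \<le> N"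
  have "{y \<in> B. y \<le> m} \<union> {y \<in> E. y \<le> m} = {1..m}"
  proof -
    have "{y \<in> B. y \<le> m} \<union> {y \<in> E. y \<le> m} = {y \<in> B \<union> E. y \<le> m}" by auto
    also have "\<dots> = {1..m}" unfolding union using m by auto
    finally show ?thesis .
  qed
  moreover have "{y \<in> B. y \<le> m} \<inter> {y \<in> E. y \<le> m} = {}" using disjoint by auto
  ultimately show ?thesis
    unfolding pos_el_def using card_Un_disjoint[of "{y \<in> B. y \<le> m}" "{y \<in> E. y \<le> m}"] fin by simp
qed

lemma above: "card {e \<in> E. m < e} + pos_el E m = card E"
proof -
  have "E = {e \<in> E. m < e} \<union> {e \<in> E. e \<le> m}" by auto
  then have "card E = card ({e \<in> E. m < e} \<union> {e \<in> E. e \<le> m})" by simp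
  also have "\<dots> = card {e \<in> E. m < e} + card {e \<in> E. e \<le> m}" using fin by (intro card_Un_disjoint) auto
  finally show ?thesis by (simp add: pos_el_def)
qed

lemma lam_pos: "x \<in> B \<Longrightarrow> lam (pos_el B x) = card {e \<in> E. x < e}"
  using good pos_el_bounds[OF fin(1), of x] nth_el_of_pos_el[OF fin(1), of x]
  by (auto simp: good_bipartition_def lamBE_def dest!: spec[of _ "pos_el B x"])

lemma lam_nth: "1 \<le> i \<Longrightarrow> i \<le> card B \<Longrightarrow> lam i = card {e \<in> E. nth_el B i < e}"
  using good by (auto simp: good_bipartition_def lamBE_def)

lemma lam_beyond: "card B < i \<Longrightarrow> lam i = 0"
proof -
  assume i: "card B < i"
  then have "lamBE B E i = lam i" using good by (simp add: good_bipartition_def)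
  then show "lam i = 0" using i by (simp add: lamBE_def)
qed

lemma lam_1: "lam 1 = card E"
proof -
  have "pos_el B 1 = 1" using count[of 1] B_lt(2)[OF one] pos_el_bounds(1)[OF fin(1) one] by simp
  moreover have "pos_el E 1 = 0" using count[of 1] B_lt(2)[OF one] \<open>pos_el B 1 = 1\<close> by simp
  ultimately show ?thesis using lam_pos[OF one] above[of 1] by simp
qed

lemma lam_positive: "1 \<le> i \<Longrightarrow> 0 < lam i \<longleftrightarrow> i \<le> card B"
proof
  assume i: "1 \<le> i" "i \<le> card B"
  have "nth_el B i < N" using nth_el_pos_el(1)[OF fin(1) i] B_lt(2) by blast
  then have "N \<in> {e \<in> E. nth_el B i < e}" using last by simp
  then show "0 < lam i" unfolding lam_nth[OF i] using fin by (auto simp: card_gt_0_iff)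
next
  assume "0 < lam i"
  then show "i \<le> card B" using lam_beyond[of i] by (cases "i \<le> card B") auto
qed

lemma N_eq: "N = card B + lam 1"
proof -
  have "card {1..N} = card B + card E" unfolding union[symmetric] using fin disjoint by (rule card_Un_disjoint)
  then show ?thesis using lam_1 by simp
qed

text \<open>Up to this element lie \<open>i\<close> elements of \<open>B\<close> and the
  \<open>lam 1 - lam i\<close> elements of \<open>E\<close> that \<open>lam i\<close> does not
  count. Hence the partition determines \<open>B\<close>, and with it \<open>E\<close>.\<close>

lemma nth_B: "1 \<le> i \<Longrightarrow> i \<le> card B \<Longrightarrow> nth_el B i + lam i = i + lam 1"
proof -
  assume i: "1 \<le> i" "i \<le> card B"
  have "nth_el B i \<le> N" using B_lt(2)[OF nth_el_pos_el(1)[OF fin(1) i]] by simp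
  then show ?thesis
    using count[of "nth_el B i"] above[of "nth_el B i"] nth_el_pos_el(2)[OF fin(1) i] lam_nth[OF i] lam_1 by simp
qed

lemma B_eq: "B = (\<lambda>i. i + lam 1 - lam i) ` {i. 1 \<le> i \<and> lam i \<noteq> 0}"
proof -
  have s: "{i. 1 \<le> i \<and> lam i \<noteq> 0} = {1..card B}" using lam_positive by auto
  have "B = nth_el B ` {1..card B}"
  proof (intro equalityI subsetI)
    fix x assume "x \<in> B"
    then show "x \<in> nth_el B ` {1..card B}"
      using nth_el_of_pos_el[OF fin(1), of x] pos_el_bounds[OF fin(1), of x] by (intro image_eqI[of _ _ "pos_el B x"]) auto
  qed (use nth_el_pos_el(1)[OF fin(1)] in auto)
  also have "\<dots> = (\<lambda>i. i + lam 1 - lam i) ` {1..card B}"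
  proof (rule image_cong)
    fix i assume "i \<in> {1..card B}"
    then show "nth_el B i = i + lam 1 - lam i" using nth_B[of i] by auto
  qed simp
  finally show ?thesis unfolding s .
qed

end

lemma good_bipartition_unique:
  assumes "good_bipartition lam B E" "good_bipartition lam B' E'"
  shows "B = B'" "E = E'"
proof -
  interpret b: bipartition lam B E by unfold_locales (rule assms)
  interpret b': bipartition lam B' E' by unfold_locales (rule assms)
  show BB: "B = B'" by (subst b.B_eq, subst b'.B_eq) (rule refl)
  have "b.N = b'.N" using b.N_eq b'.N_eq BB by simp
  moreover have "E = {1..b.N} - B" using b.union b.disjoint by blast
  moreover have "E' = {1..b'.N} - B'" using b'.union b'.disjoint by blast
  ultimately show "E = E'" using BB by simp
qed

lemma good_bipartition_exists:
  assumes p: "is_partition lam" and nz: "nonzero_partition lam"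
  shows "\<exists>B E. good_bipartition lam B E"
proof -
  have dec: "lam j \<le> lam i" if "1 \<le> i" "i \<le> j" for i j using p that by (auto simp: is_partition_def)
  define I where "I = {i. 1 \<le> i \<and> lam i \<noteq> 0}"
  have finI: "finite I" using p by (simp add: is_partition_def I_def)
  have neI: "I \<noteq> {}" using nz by (auto simp: nonzero_partition_def I_def)
  define P where "P = Max I"
  have PI: "P \<in> I" unfolding P_def using finI neI by (rule Max_in)
  have I_eq: "I = {1..P}"
  proof
    show "I \<subseteq> {1..P}" using Max_ge[OF finI] by (auto simp: I_def P_def)
    show "{1..P} \<subseteq> I"
    proof
      fix i assume "i \<in> {1..P}"
      then show "i \<in> I" using PI dec[of i P] by (simp add: I_def)
    qed
  qed
  have P1: "1 \<le> P" using PI by (simp add: I_def)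
  have pos: "0 < lam i \<longleftrightarrow> i \<le> P" if "1 \<le> i" for i
  proof -
    have "i \<in> I \<longleftrightarrow> i \<in> {1..P}" by (simp only: I_eq)
    then show ?thesis using that by (simp add: I_def)
  qed
  \<comment> \<open>The value forced by \<open>nth_B\<close>: the vertical steps of the boundary
    path of the diagram, read from the end of the first row.\<close>
  define b where "b i = i + lam 1 - lam i" for i
  define N where "N = P + lam 1"
  define B where "B = b ` {1..P}"
  define E where "E = {1..N} - B"
  have bi: "b i + lam i = i + lam 1" if "1 \<le> i" for i using dec[of 1 i] that by (simp add: b_def)
  have b_less: "b i < b j" if "1 \<le> i" "i < j" for i j using bi[of i] bi[of j] dec[of i j] that by simp
  have b1: "b 1 = 1" using bi[of 1] by simp
  have b_bound: "1 \<le> b i" "b i < N" if "1 \<le> i" "i \<le> P" for i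
  proof -
    show "1 \<le> b i" using bi[of i] dec[of 1 i] that by simp
    show "b i < N" using bi[of i] pos[of i] that by (simp add: N_def)
  qed
  have BN': "x \<in> {1..<N}" if "x \<in> B" for x
  proof -
    obtain i where "1 \<le> i" "i \<le> P" "x = b i" using \<open>x \<in> B\<close> by (auto simp: B_def)
    then show ?thesis using b_bound[of i] by simp
  qed
  then have BN: "B \<subseteq> {1..N}" by fastforce
  have finB: "finite B" by (simp add: B_def)
  have inj: "inj_on b {1..P}"
    by (rule linorder_inj_onI) (use b_less in \<open>auto simp: less_imp_neq\<close>)
  have cardB: "card B = P" using inj by (simp add: B_def card_image)
  have un: "B \<union> E = {1..N}" using BN by (auto simp: E_def)
  have N1: "1 \<le> N" using P1 by (simp add: N_def)
  have NE: "N \<in> E" using N1 BN'[of N] by (auto simp: E_def)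
  have "elementary B E"
    unfolding elementary_def interval_bipartition_def
  proof (intro conjI)
    show "B \<inter> E = {}" by (auto simp: E_def)
    show "0 \<notin> B \<union> E" "\<exists>a b. B \<union> E = {a..b}" unfolding un by auto
    show "1 \<in> B" unfolding B_def using b1 P1 by (intro image_eqI[of _ _ 1]) auto
    have "Max {1..N} = N" using N1 by (intro Max_eqI) auto
    then show "Max (B \<union> E) \<in> E" unfolding un using NE by simp
  qed
  moreover have "lamBE B E i = lam i" if i: "1 \<le> i" for i
  proof (cases "i \<le> P")
    case True
    have "{y \<in> B. y \<le> b i} = b ` {1..i}"
    proof (intro equalityI subsetI)
      fix y assume "y \<in> {y \<in> B. y \<le> b i}"
      then obtain j where j: "1 \<le> j" "y = b j" "b j \<le> b i" by (auto simp: B_def)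
      have "j \<le> i" using b_less[of i j] i j(3) by (cases "j \<le> i") auto
      then show "y \<in> b ` {1..i}" using j by auto
    next
      fix y assume "y \<in> b ` {1..i}"
      then obtain j where j: "1 \<le> j" "j \<le> i" "y = b j" by auto
      then have "b j \<le> b i" using b_less[of j i] by (cases "j = i") auto
      then show "y \<in> {y \<in> B. y \<le> b i}" using j True by (auto simp: B_def)
    qed
    moreover have "inj_on b {1..i}" by (rule inj_on_subset[OF inj]) (use True in auto)
    ultimately have pe: "pos_el B (b i) = i" by (simp add: pos_el_def card_image)
    have biB: "b i \<in> B" using i True by (simp add: B_def)
    have nth: "nth_el B i = b i" using nth_el_of_pos_el[OF finB biB] pe by simp
    have "{e \<in> E. b i < e} = {b i<..N} - {y \<in> B. b i < y}" by (auto simp: E_def)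
    moreover have "{y \<in> B. b i < y} \<subseteq> {b i<..N}" using BN by auto
    ultimately have "card {e \<in> E. b i < e} = (N - b i) - card {y \<in> B. b i < y}"
      using finB by (simp add: card_Diff_subset)
    moreover have "card {y \<in> B. b i < y} = P - i"
    proof -
      have "B = {y \<in> B. y \<le> b i} \<union> {y \<in> B. b i < y}" by auto
      then have "card B = card ({y \<in> B. y \<le> b i} \<union> {y \<in> B. b i < y})" by simp
      also have "\<dots> = card {y \<in> B. y \<le> b i} + card {y \<in> B. b i < y}" using finB by (intro card_Un_disjoint) auto
      finally show ?thesis using pe cardB by (simp add: pos_el_def)
    qed
    moreover have "N - b i - (P - i) = lam i" using bi[OF i] True by (simp add: N_def)
    ultimately show ?thesis using i True by (simp add: lamBE_def cardB nth)
  next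
    case False
    then show ?thesis using pos[OF i] i by (simp add: lamBE_def cardB)
  qed
  ultimately show ?thesis by (auto simp: good_bipartition_def)
qed

lemma ebp_good:
  assumes "is_partition lam" "nonzero_partition lam"
  shows "good_bipartition lam (fst (ebp lam)) (snd (ebp lam))"
proof -
  obtain B E where g: "good_bipartition lam B E" using good_bipartition_exists[OF assms] by blast
  have "\<exists>!BE. good_bipartition lam (fst BE) (snd BE)"
  proof (rule ex1I[of _ "(B, E)"])
    show "good_bipartition lam (fst (B, E)) (snd (B, E))" using g by simp
    fix BE assume "good_bipartition lam (fst BE) (snd BE)"
    then show "BE = (B, E)" using good_bipartition_unique[OF _ g] by (intro prod_eqI) auto
  qed
  from theI'[OF this] show ?thesis
    unfolding ebp_def good_bipartition_def by simp
qed

section \<open>The bijection\<close>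

locale partition_bipartition = bipartition lam B E for lam B E +
  assumes part: "is_partition lam"
begin

lemma lam_dec: "1 \<le> i \<Longrightarrow> i \<le> j \<Longrightarrow> lam j \<le> lam i"
  using part by (auto simp: is_partition_def)

lemma Fer_bounds:
  assumes "(i, j) \<in> Fer lam"
  shows "1 \<le> i" "i \<le> card B" "1 \<le> j" "j \<le> lam i" "j \<le> lam 1"
proof -
  show i: "1 \<le> i" and "1 \<le> j" and ji: "j \<le> lam i" using assms by (auto simp: Fer_def)
  then show "i \<le> card B" using lam_positive[OF i] by auto
  show "j \<le> lam 1" using ji lam_dec[of 1 i] i by simp
qed

lemma downset_Fer: "downset (Fer lam)"
  unfolding downset_def
proof (intro conjI ballI)
  show "finite (Fer lam)"
  proof (rule finite_subset)
    show "Fer lam \<subseteq> {1..card B} \<times> {1..lam 1}" using Fer_bounds by auto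
  qed simp
  fix x assume "x \<in> Fer lam"
  then obtain i j where x: "x = (i, j)" "(i, j) \<in> Fer lam" by (cases x) auto
  have "(i', j') \<in> Fer lam" if "1 \<le> i'" "i' \<le> i" "1 \<le> j'" "j' \<le> j" for i' j'
    using Fer_bounds(4)[OF x(2)] lam_dec[OF that(1,2)] that by (simp add: Fer_def)
  then show "case x of (i, j) \<Rightarrow> 1 \<le> i \<and> 1 \<le> j \<and> cells i j \<subseteq> Fer lam"
    using Fer_bounds[OF x(2)] unfolding x(1) by (auto simp: cells_def)
qed

lemma hook11_eq: "hook11 lam + 1 = N"
proof -
  have B1: "1 \<le> card B" using pos_el_bounds[OF fin(1) one] by simp
  have "{(i, j) \<in> Fer lam. i = 1 \<or> j = 1} = {1} \<times> {1..lam 1} \<union> {2..card B} \<times> {1}"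
  proof (intro equalityI subsetI)
    fix x assume "x \<in> {(i, j) \<in> Fer lam. i = 1 \<or> j = 1}"
    then obtain i j where x: "x = (i, j)" "(i, j) \<in> Fer lam" "i = 1 \<or> j = 1" by auto
    then show "x \<in> {1} \<times> {1..lam 1} \<union> {2..card B} \<times> {1}"
      using Fer_bounds[OF x(2)] by (cases "i = 1") auto
  next
    fix x assume "x \<in> {1} \<times> {1..lam 1} \<union> {2..card B} \<times> {1}"
    then consider j where "x = (1, j)" "1 \<le> j" "j \<le> lam 1" | i where "x = (i, 1)" "2 \<le> i" "i \<le> card B" by auto
    then show "x \<in> {(i, j) \<in> Fer lam. i = 1 \<or> j = 1}"
    proof cases
      case 1
      then show ?thesis by (simp add: Fer_def)
    next
      case 2
      then show ?thesis using lam_positive[of i] by (simp add: Fer_def)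
    qed
  qed
  moreover have "card ({1} \<times> {1..lam 1} \<union> {2..card B} \<times> {1}) = lam 1 + (card B - 1)"
    by (subst card_Un_disjoint) auto
  ultimately show ?thesis using N_eq B1 by (simp add: hook11_def)
qed

end

locale rsk = partition_bipartition lam B E for lam B E +
  fixes c :: "nat \<Rightarrow> nat" and A :: "nat set"
  assumes ebp_eq: "ebp lam = (B, E)" and cycle: "cycle_shape N A c"
begin

text \<open>The values at indices beyond the diagram are chosen only to keep the keys extremal.\<close>

definition row_idx_key :: "nat \<Rightarrow> int" where
  "row_idx_key i = (if i \<le> card B then row_key A (nth_el B i) else int N + int i)"

definition col_idx_key :: "nat \<Rightarrow> int" where
  "col_idx_key j = (if j \<le> card E then col_key N A (nth_el E (card E + 1 - j)) else int N + int j)"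

lemma row_key_bounds: "- int x \<le> row_key A x" "row_key A x \<le> int x"
  by (auto simp: row_key_def)

lemma col_key_bounds: "y \<le> N \<Longrightarrow> col_key N A y \<le> int N - int y" "y \<le> N \<Longrightarrow> int y - int N \<le> col_key N A y"
  by (auto simp: col_key_def)

text \<open>Elements of \<open>B\<close> enter in increasing order and the key of \<open>x\<close>
  is \<open>x\<close> or \<open>- x\<close>, so a new key exceeds the earlier ones in absolute value
  and its sign decides at which end it stands.\<close>

lemma row_idx_key_extremal:
  assumes i: "1 \<le> i"
  shows "key_last row_idx_key i \<or> key_first row_idx_key i"
proof (cases "i \<le> card B")
  case True
  let ?x = "nth_el B i"
  have lt: "nth_el B i' < ?x" "1 \<le> nth_el B i'" if "1 \<le> i'" "i' < i" for i'
    using nth_el_less[OF fin(1) that True] B_lt(1)[OF nth_el_pos_el(1)[OF fin(1) that(1)]] that True by auto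
  show ?thesis
  proof (cases "?x = 1 \<or> ?x \<in> A")
    case x: True
    have "row_idx_key i' < row_idx_key i" if i': "1 \<le> i'" "i' < i" for i'
    proof -
      have "row_idx_key i' \<le> int (nth_el B i')" using row_key_bounds(2) i' True by (simp add: row_idx_key_def)
      moreover have "row_idx_key i = int ?x" using True x by (auto simp: row_idx_key_def row_key_def)
      ultimately show ?thesis using lt(1)[OF i'] by simp
    qed
    then show ?thesis by (simp add: key_last_def)
  next
    case x: False
    have "row_idx_key i < row_idx_key i'" if i': "1 \<le> i'" "i' < i" for i'
    proof -
      have "- int (nth_el B i') \<le> row_idx_key i'" using row_key_bounds(1) i' True by (simp add: row_idx_key_def)
      moreover have "row_idx_key i = - int ?x" using True x by (auto simp: row_idx_key_def row_key_def)
      ultimately show ?thesis using lt(1)[OF i'] by simp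
    qed
    then show ?thesis by (simp add: key_first_def)
  qed
next
  case False
  have "row_idx_key i' < row_idx_key i" if i': "1 \<le> i'" "i' < i" for i'
  proof (cases "i' \<le> card B")
    case True
    then have "nth_el B i' < N" using B_lt(2)[OF nth_el_pos_el(1)[OF fin(1) i'(1)]] by simp
    then show ?thesis using True False row_key_bounds(2)[of "nth_el B i'"] by (simp add: row_idx_key_def)
  qed (use False i' in \<open>simp add: row_idx_key_def\<close>)
  then show ?thesis by (simp add: key_last_def)
qed

text \<open>Columns are numbered against the order of \<open>E\<close>, so the distance
  \<open>N - y\<close> grows with the index, and the key is this distance up to sign.\<close>

lemma col_idx_key_extremal:
  assumes j: "1 \<le> j"
  shows "key_last col_idx_key j \<or> key_first col_idx_key j"
proof (cases "j \<le> card E")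
  case True
  let ?y = "\<lambda>j. nth_el E (card E + 1 - j)"
  have lt: "?y j < ?y j'" "?y j' \<le> N" if j': "1 \<le> j'" "j' < j" for j'
  proof -
    have "1 \<le> card E + 1 - j'" "card E + 1 - j' \<le> card E" using j' True by auto
    then show "?y j' \<le> N" using E_gt(2)[OF nth_el_pos_el(1)[OF fin(2)]] by blast
    show "?y j < ?y j'" using j' True by (intro nth_el_less[OF fin(2)]) auto
  qed
  have key: "col_idx_key j' = col_key N A (?y j')" if "j' \<le> j" for j' using that True by (simp add: col_idx_key_def)
  show ?thesis
  proof (cases "?y j \<in> A")
    case y: True
    have "col_idx_key j < col_idx_key j'" if j': "1 \<le> j'" "j' < j" for j'
      using lt[OF j'] y col_key_bounds(2)[of "?y j'"] j' by (simp add: key col_key_def)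
    then show ?thesis by (simp add: key_first_def)
  next
    case y: False
    have "col_idx_key j' < col_idx_key j" if j': "1 \<le> j'" "j' < j" for j'
      using lt[OF j'] y col_key_bounds(1)[of "?y j'"] j' by (simp add: key col_key_def)
    then show ?thesis by (simp add: key_last_def)
  qed
next
  case False
  have "col_idx_key j' < col_idx_key j" if j': "1 \<le> j'" "j' < j" for j'
  proof (cases "j' \<le> card E")
    case True
    have "1 \<le> card E + 1 - j'" "card E + 1 - j' \<le> card E" using j' True by auto
    then have "nth_el E (card E + 1 - j') \<le> N" using E_gt(2)[OF nth_el_pos_el(1)[OF fin(2)]] by blast
    then show ?thesis using True False col_key_bounds(1)[of "nth_el E (card E + 1 - j')"] by (simp add: col_idx_key_def)
  qed (use False j' in \<open>simp add: col_idx_key_def\<close>)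
  then show ?thesis by (simp add: key_last_def)
qed

sublocale extremal_keys row_idx_key col_idx_key
  by unfold_locales (rule row_idx_key_extremal col_idx_key_extremal; assumption)+

section \<open>The rectangle of the diagram carried by each subquiver\<close>

definition rows_upto :: "nat \<Rightarrow> nat" where "rows_upto m = pos_el B m"

definition cols_above :: "nat \<Rightarrow> nat" where "cols_above m = card {e \<in> E. m < e}"

text \<open>Places \<open>(rows_upto m, cols_above m)\<close> on the diagonal \<open>m\<close>; if
  that diagonal is nonempty, this is its last cell.\<close>

lemma rows_cols: "m \<le> N \<Longrightarrow> rows_upto m + lam 1 = m + cols_above m"
  using count[of m] above[of m] lam_1 by (simp add: rows_upto_def cols_above_def)

lemma row_le_iff:
  assumes "1 \<le> i" "i \<le> card B"
  shows "nth_el B i \<le> m \<longleftrightarrow> i \<le> rows_upto m"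
proof
  assume "nth_el B i \<le> m"
  then show "i \<le> rows_upto m" using pos_el_mono[OF fin(1)] nth_el_pos_el(2)[OF fin(1) assms] by (metis rows_upto_def)
next
  assume le: "i \<le> rows_upto m"
  show "nth_el B i \<le> m"
  proof (rule ccontr)
    assume "\<not> nth_el B i \<le> m"
    then have "pos_el B m < pos_el B (nth_el B i)" by (intro pos_el_less fin nth_el_pos_el assms) auto
    then show False using le nth_el_pos_el(2)[OF fin(1) assms] by (simp add: rows_upto_def)
  qed
qed

lemma col_gt_iff:
  assumes "1 \<le> j" "j \<le> card E"
  shows "m < nth_el E (card E + 1 - j) \<longleftrightarrow> j \<le> cols_above m"
proof -
  let ?y = "nth_el E (card E + 1 - j)"
  have b: "1 \<le> card E + 1 - j" "card E + 1 - j \<le> card E" using assms by auto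
  have y: "?y \<in> E" "pos_el E ?y = card E + 1 - j" using nth_el_pos_el[OF fin(2) b] by auto
  have ab: "cols_above m + pos_el E m = card E" using above[of m] by (simp add: cols_above_def)
  show ?thesis
  proof
    assume "m < ?y"
    then have "pos_el E m < pos_el E ?y" by (intro pos_el_less fin y)
    then show "j \<le> cols_above m" using y(2) ab by simp
  next
    assume le: "j \<le> cols_above m"
    show "m < ?y"
    proof (rule ccontr)
      assume "\<not> m < ?y"
      then have "pos_el E ?y \<le> pos_el E m" by (intro pos_el_mono fin) simp
      then show False using y(2) ab le assms by simp
    qed
  qed
qed

lemma cells_in_Fer: "cells (rows_upto m) (cols_above m) \<subseteq> Fer lam"
proof
  fix x assume "x \<in> cells (rows_upto m) (cols_above m)"
  then obtain i j where x: "x = (i, j)" "1 \<le> i" "i \<le> rows_upto m" "1 \<le> j" "j \<le> cols_above m"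
    by (auto simp: cells_def)
  have "rows_upto m \<le> card B" unfolding rows_upto_def pos_el_def using fin by (intro card_mono) auto
  then have i: "i \<le> card B" using x(3) by simp
  have "nth_el B i \<le> m" using row_le_iff[OF x(2) i] x(3) by simp
  then have "cols_above m \<le> lam i"
    unfolding lam_nth[OF x(2) i] cols_above_def using fin by (intro card_mono) auto
  then show "x \<in> Fer lam" using x by (simp add: Fer_def)
qed

lemma last_not_in_Fer: "(Suc (rows_upto m), Suc (cols_above m)) \<notin> Fer lam"
proof
  assume F: "(Suc (rows_upto m), Suc (cols_above m)) \<in> Fer lam"
  note b = Fer_bounds(1,2)[OF F]
  have "m < nth_el B (Suc (rows_upto m))" using row_le_iff[OF b, of m] by simp
  then have "lam (Suc (rows_upto m)) \<le> cols_above m"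
    unfolding lam_nth[OF b] cols_above_def using fin by (intro card_mono) auto
  then show False using Fer_bounds(4)[OF F] by simp
qed

lemma diag_end:
  assumes F: "(i, j) \<in> Fer lam" and m: "m + j = i + lam 1"
  shows "i \<le> rows_upto m" "j \<le> cols_above m" "rows_upto m + j = cols_above m + i"
    and "1 \<le> m" "m < N" "(rows_upto m, cols_above m) \<in> Fer lam"
proof -
  note b = Fer_bounds[OF F]
  show m1: "1 \<le> m" "m < N" using b m N_eq by auto
  have eq: "rows_upto m + lam 1 = m + cols_above m" using rows_cols[of m] m1 by simp
  then show eq': "rows_upto m + j = cols_above m + i" using m by simp
  show le: "i \<le> rows_upto m"
  proof (rule ccontr)
    assume "\<not> i \<le> rows_upto m"
    then have "(Suc (rows_upto m), Suc (cols_above m)) \<in> Fer lam"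
      using eq' by (intro downsetD(3)[OF downset_Fer F]) auto
    then show False using last_not_in_Fer by blast
  qed
  show "j \<le> cols_above m" using le eq' by simp
  then show "(rows_upto m, cols_above m) \<in> Fer lam"
    using le b cells_in_Fer[of m] by (auto simp: cells_def)
qed

lemma diag_max_eq:
  assumes F: "(i, j) \<in> Fer lam" and m: "m + j = i + lam 1"
  shows "diag_max lam m = (rows_upto m, cols_above m)"
  unfolding diag_max_def
proof (rule the_equality)
  note d = diag_end[OF F m]
  have memb: "(a, b) \<in> diag lam m \<longleftrightarrow> (a, b) \<in> Fer lam \<and> m + b = a + lam 1" for a b
    by (auto simp: diag_def)
  have top: "(rows_upto m, cols_above m) \<in> diag lam m"
    unfolding memb using d(6) rows_cols[of m] d(5) by simp
  have max: "prod_le q (rows_upto m, cols_above m)" if q: "q \<in> diag lam m" for q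
  proof (cases q)
    case (Pair a b)
    then have "(a, b) \<in> Fer lam" "m + b = a + lam 1" using q memb by auto
    from diag_end(1,2)[OF this] show ?thesis using Pair by (simp add: prod_le_def)
  qed
  show "(rows_upto m, cols_above m) \<in> diag lam m \<and> (\<forall>q\<in>diag lam m. prod_le q (rows_upto m, cols_above m))"
    using top max by blast
  fix p assume p: "p \<in> diag lam m \<and> (\<forall>q\<in>diag lam m. prod_le q p)"
  then have "prod_le (rows_upto m, cols_above m) p" "prod_le p (rows_upto m, cols_above m)" using top max by auto
  then show "p = (rows_upto m, cols_above m)" by (auto simp: prod_le_def prod_eq_iff)
qed

lemma cover_max_fbar:
  assumes m: "1 \<le> m" "m < N"
  shows "cover_max (key_comparable (row_key A) (col_key N A)) (\<lambda>_. ar_vert_m N m) (fbar lam f) k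
    = cells_max row_idx_key col_idx_key f (rows_upto m) (cols_above m) k"
proof -
  define h where "h x = (nth_el B (fst x), nth_el E (card E + 1 - snd x))" for x
  let ?A = "cells (rows_upto m) (cols_above m)"
  have vert: "ar_vert_m N m = {1..m} \<times> {Suc m..N}" using m(2) by (rule ar_vert_m_eq)
  have uB: "rows_upto m \<le> card B" unfolding rows_upto_def pos_el_def using fin by (intro card_mono) auto
  have vE: "cols_above m \<le> card E" unfolding cols_above_def using fin by (intro card_mono) auto
  have bounds: "1 \<le> fst x" "fst x \<le> rows_upto m" "fst x \<le> card B" "1 \<le> snd x" "snd x \<le> cols_above m" "snd x \<le> card E"
    "1 \<le> card E + 1 - snd x" "card E + 1 - snd x \<le> card E" if "x \<in> ?A" for x
    using that uB vE by (auto simp: cells_def)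
  have hB: "nth_el B (fst x) \<in> B" "pos_el B (nth_el B (fst x)) = fst x" if "x \<in> ?A" for x
    using nth_el_pos_el[OF fin(1)] bounds[OF that] by blast+
  have hE: "nth_el E (card E + 1 - snd x) \<in> E" "pos_el E (nth_el E (card E + 1 - snd x)) = card E + 1 - snd x"
    if "x \<in> ?A" for x
    using nth_el_pos_el[OF fin(2)] bounds[OF that] by blast+
  have fb: "fbar lam f (x, y) = (let i = pos_el B x; j = card E + 1 - pos_el E y in
      if x \<in> B \<and> y \<in> E \<and> (i, j) \<in> Fer lam then f (i, j) else 0)" for x y
    by (simp add: fbar_def ebp_eq)
  have "cover_max (key_comparable row_idx_key col_idx_key) (\<lambda>_. ?A) f k
    = cover_max (key_comparable (row_key A) (col_key N A)) (\<lambda>_. ar_vert_m N m) (fbar lam f) k"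
  proof (rule cover_max_transfer)
    show "inj_on h ?A"
    proof (rule inj_onI)
      fix x y assume xy: "x \<in> ?A" "y \<in> ?A" "h x = h y"
      have eq: "nth_el B (fst x) = nth_el B (fst y)" "nth_el E (card E + 1 - snd x) = nth_el E (card E + 1 - snd y)"
        using xy(3) unfolding h_def by blast+
      have "fst x = fst y" using hB(2)[OF xy(1)] hB(2)[OF xy(2)] unfolding eq(1) by (rule trans[OF sym])
      moreover have "card E + 1 - snd x = card E + 1 - snd y"
        using hE(2)[OF xy(1)] hE(2)[OF xy(2)] unfolding eq(2) by (rule trans[OF sym])
      then have "snd x = snd y" using bounds(6)[OF xy(1)] bounds(6)[OF xy(2)] by simp
      ultimately show "x = y" by (rule prod_eqI)
    qed
    show "key_comparable row_idx_key col_idx_key x y \<longleftrightarrow> key_comparable (row_key A) (col_key N A) (h x) (h y)"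
      if "x \<in> ?A" "y \<in> ?A" for x y
      using bounds(3,6)[OF that(1)] bounds(3,6)[OF that(2)]
      by (simp add: key_comparable_def h_def row_idx_key_def col_idx_key_def)
    show "fbar lam f (h x) = f x" if x: "x \<in> ?A" for x
    proof -
      have "card E + 1 - (card E + 1 - snd x) = snd x" using bounds(6)[OF x] by simp
      moreover have "x \<in> Fer lam" using cells_in_Fer x by blast
      ultimately show ?thesis using hB[OF x] hE[OF x] by (simp add: h_def fb)
    qed
    show "h ` ?A \<subseteq> ar_vert_m N m"
    proof
      fix z assume "z \<in> h ` ?A"
      then obtain x where x: "x \<in> ?A" "z = h x" by blast
      have "nth_el B (fst x) \<le> m" using row_le_iff bounds(1-3)[OF x(1)] by blast
      moreover have "m < nth_el E (card E + 1 - snd x)" using col_gt_iff bounds(4-6)[OF x(1)] by blast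
      ultimately show "z \<in> ar_vert_m N m"
        using B_lt(1)[OF hB(1)[OF x(1)]] E_gt(2)[OF hE(1)[OF x(1)]] unfolding vert x(2) h_def by simp
    qed
    show "fbar lam f z = 0" if z: "z \<in> ar_vert_m N m" "z \<notin> h ` ?A" for z
    proof (rule ccontr)
      assume nz: "fbar lam f z \<noteq> 0"
      obtain x y where xy: "z = (x, y)" by (cases z)
      have BE: "x \<in> B" "y \<in> E" using nz unfolding xy fb by (auto simp: Let_def split: if_splits)
      have xm: "x \<le> m" "m < y" using z(1) unfolding vert xy by auto
      define i j where "i = pos_el B x" and "j = card E + 1 - pos_el E y"
      have i: "1 \<le> i" "i \<le> card B" "nth_el B i = x"
        using pos_el_bounds[OF fin(1) BE(1)] nth_el_of_pos_el[OF fin(1) BE(1)] by (auto simp: i_def)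
      note p = pos_el_bounds[OF fin(2) BE(2)]
      have j: "1 \<le> j" "j \<le> card E" "nth_el E (card E + 1 - j) = y"
        using p nth_el_of_pos_el[OF fin(2) BE(2)] by (auto simp: j_def)
      have "i \<le> rows_upto m" using row_le_iff[OF i(1,2), of m] i(3) xm by simp
      moreover have "j \<le> cols_above m" using col_gt_iff[OF j(1,2), of m] j(3) xm by simp
      ultimately have "(i, j) \<in> ?A" using i j by (simp add: cells_def)
      moreover have "h (i, j) = z" using i(3) j(3) xy by (simp add: h_def)
      ultimately show False using z(2) by blast
    qed
    show "finite (ar_vert_m N m)" unfolding vert by simp
  qed
  then show ?thesis by (simp add: cells_max_def)
qed

text \<open>The last cell of diagonal \<open>m\<close> is the corner of the rectangle carried by the
  subquiver, so the index \<open>u + 1 - i\<close> is the depth of the cell.\<close>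

lemma RSK_eq_growth_map: "RSK lam c f = growth_map (Fer lam) f"
proof
  fix p
  show "RSK lam c f p = growth_map (Fer lam) f p"
  proof (cases "p \<in> Fer lam")
    case True
    obtain i j where p: "p = (i, j)" by (cases p)
    have F: "(i, j) \<in> Fer lam" using True p by simp
    define m where "m = i + lam 1 - j"
    have m: "m + j = i + lam 1" using Fer_bounds[OF F] by (simp add: m_def)
    note d = diag_end[OF F m]
    define e where "e = rows_upto m - i"
    have e: "rows_upto m = i + e" "cols_above m = j + e" using d(1-3) by (auto simp: e_def)
    have dep: "depth (Fer lam) i j = Suc e"
      using d(6) last_not_in_Fer[of m] Fer_bounds[OF F] unfolding e by (intro depth_eq[OF downset_Fer]) auto
    have gk: "GK_M (ar_vert_m N m) (ar_edge c) (fbar lam f) l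
        = cells_max row_idx_key col_idx_key f (i + e) (j + e) l" for l
      using GK_M_eq_cover_max[OF cycle d(4,5), of "fbar lam f" l] cover_max_fbar[OF d(4,5), of f l] unfolding e by simp
    have "RSK lam c f p = GK (ar_vert_m N m) (ar_edge c) (fbar lam f) (Suc e)"
      using True diag_max_eq[OF F m] e(1) hook11_eq unfolding RSK_def p by (simp add: m_def Let_def)
    also have "\<dots> = shape row_idx_key col_idx_key f (i + e) (j + e) (Suc e)"
      by (simp add: GK_def shape_def gk)
    also have "\<dots> = growth_map (Fer lam) f p" using True by (simp add: growth_map_def p dep)
    finally show ?thesis .
  next
    case False
    then show ?thesis by (simp add: RSK_def growth_map_def)
  qed
qed

text \<open>Comparable cells are joined by a walk inside the diagram, down the column first and then
  along the row.\<close>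

lemma weakly_inc_iff_rpp: "weakly_inc (Fer lam) g \<longleftrightarrow> (\<forall>p\<in>Fer lam. \<forall>q\<in>Fer lam. prod_le p q \<longrightarrow> g p \<le> g q)"
proof
  assume W: "weakly_inc (Fer lam) g"
  show "\<forall>p\<in>Fer lam. \<forall>q\<in>Fer lam. prod_le p q \<longrightarrow> g p \<le> g q"
  proof (intro ballI impI)
    fix p q assume pq: "p \<in> Fer lam" "q \<in> Fer lam" "prod_le p q"
    obtain i j i' j' where ij: "p = (i, j)" "q = (i', j')" by (cases p, cases q)
    have le: "i \<le> i'" "j \<le> j'" and F: "(i', j') \<in> Fer lam" and pos: "1 \<le> i" "1 \<le> j"
      using pq Fer_bounds[of i j] unfolding ij by (auto simp: prod_le_def)
    have mem: "(a, b) \<in> Fer lam" if "1 \<le> a" "a \<le> i'" "1 \<le> b" "b \<le> j'" for a b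
      using that by (rule downsetD(3)[OF downset_Fer F])
    have "g (i, j) \<le> g (a, j)" if "i \<le> a" "a \<le> i'" for a
      using that
    proof (induction a rule: dec_induct)
      case (step a)
      have "g (a, j) \<le> g (Suc a, j)" using step pos le by (intro weakly_incD(1)[OF W] mem) auto
      then show ?case using step by simp
    qed simp
    then have "g (i, j) \<le> g (i', j)" using le by simp
    also have "g (i', j) \<le> g (i', b)" if "j \<le> b" "b \<le> j'" for b
      using that
    proof (induction b rule: dec_induct)
      case (step b)
      have "g (i', b) \<le> g (i', Suc b)" using step pos le by (intro weakly_incD(2)[OF W] mem) auto
      then show ?case using step by simp
    qed simp
    then have "g (i', j) \<le> g (i', j')" using le by simp
    finally show "g p \<le> g q" using ij by simp
  qed
next
  assume "\<forall>p\<in>Fer lam. \<forall>q\<in>Fer lam. prod_le p q \<longrightarrow> g p \<le> g q"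
  then show "weakly_inc (Fer lam) g" by (auto simp: weakly_inc_def prod_le_def)
qed

lemma RSK_bij: "bij_betw (RSK lam c) (fillings lam) (rpp lam)"
proof -
  have "RSK lam c = growth_map (Fer lam)" using RSK_eq_growth_map by blast
  moreover have "rpp lam = {g \<in> Fer lam \<rightarrow>\<^sub>E UNIV. weakly_inc (Fer lam) g}"
    unfolding rpp_def fillings_def weakly_inc_iff_rpp ..
  ultimately show ?thesis using growth_map_bij[OF downset_Fer] by (simp add: fillings_def)
qed

end

theorem theorem4p1:
  fixes lam :: "nat \<Rightarrow> nat" and n :: nat and c :: "nat \<Rightarrow> nat"
  assumes "is_partition lam" and "nonzero_partition lam"
    and "n = hook11 lam + 1"
    and "coxeter n c"
  shows "bij_betw (RSK lam c) (fillings lam) (rpp lam)"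
proof -
  obtain B E where BE: "ebp lam = (B, E)" by (cases "ebp lam")
  interpret partition_bipartition lam B E
    using ebp_good[OF assms(1,2)] assms(1) by unfold_locales (simp_all add: BE)
  have N2: "2 \<le> N" using E_gt[OF last] by simp
  obtain A where "cycle_shape N A c" using coxeter_cycle_shape[OF N2, of c] assms(3,4) hook11_eq by auto
  then interpret rsk lam B E c A using BE by unfold_locales
  show ?thesis by (rule RSK_bij)
qed

end
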